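(* Let $k\ge 2$ and let $\boldsymbol X$ be a Kotz Type III elliptical random vector in $\mathbb R^k$, i.e. $\boldsymbol X\stackrel{d}{=}A^\top R\,\boldsymbol U$, where $A\in\mathbb R^{k\times k}$ is a non-singular matrix such that $\Sigma:=A^\top A$ is a correlation matrix, $\boldsymbol U$ is uniformly distributed on the unit sphere of $\mathbb R^k$, and $R>0$ is a random variable independent of $\boldsymbol U$ with $$\boldsymbol P\{R>u\}=(1+o(1))\,p\,u^{N}\exp(-q u^{\delta}),\quad u\to\infty,$$ for some constants $\delta>0$, $p>0$, $q>0$, $N\in\mathbb R$. Let $t_n$, $n\ge 1$, be positive constants with $\lim_{n\to\infty}t_n=\infty$ and let $\boldsymbol a\in\mathbb R^k\setminus(-\infty,0]^k$. Let $I$ be the minimal index set of the quadratic programming problem $\boldsymbol Q(\Sigma,\boldsymbol a)$, and suppose that $J:=\{1,\dots,k\}\setminus I$ is non-empty. Put $\|\boldsymbol a_I\|:=(\boldsymbol a_I^\top\Sigma_{II}^{-1}\boldsymbol a_I)^{1/2}$ and $$h_n:=\sqrt{q\delta}\,(t_n\|\boldsymbol a_I\|)^{\delta/2-1},\quad n\ge 1.$$ Let $\boldsymbol V_{n;I;\boldsymbol a}$ be a random vector in $\mathbb R^{|J|}$ whose distribution is the conditional distribution of $\boldsymbol X_J$ given $\boldsymbol X_I>t_n\boldsymbol a_I$. Then we have the convergence in distribution $$h_n\bigl(\boldsymbol V_{n;I;\boldsymbol a}-t_n\Sigma_{JI}\Sigma_{II}^{-1}\boldsymbol a_I\bigr)\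 \stackrel{d}{\to}\ \boldsymbol Z_J\mid\boldsymbol Z_I=\boldsymbol 0_I,\qquad n\to\infty,$$ where $\boldsymbol Z$ is a mean-zero Gaussian random vector in $\mathbb R^k$ with covariance matrix $\Sigma$, and the limit denotes a random vector with the conditional distribution of $\boldsymbol Z_J$ given $\boldsymbol Z_I=\boldsymbol 0_I$.
   Context: Notation. For $\boldsymbol x\in\mathbb R^k$ and a non-empty $K\subset\{1,\dots,k\}$, $\boldsymbol x_K=(x_i,i\in K)^\top$ is the subvector. For index sets $K,L$, $\Sigma_{KL}$ is the submatrix of $\Sigma$ with rows in $K$ and columns in $L$; $\Sigma_{II}^{-1}$ means $(\Sigma_{II})^{-1}$. Inequalities between vectors are componentwise ($\boldsymbol x>\boldsymbol y$ means $x_i>y_i$ for all $i$; similarly $\ge$). $\boldsymbol 0$ is the zero vector. A correlation matrix here is a positive definite symmetric matrix with all diagonal entries equal to 1. The conditional law of $\boldsymbol Z_J$ given $\boldsymbol Z_I=\boldsymbol 0_I$ is the centered Gaussian law with covariance matrix $\Sigma_{JJ}-\Sigma_{JI}\Sigma_{II}^{-1}\Sigma_{IJ}$. Minimal index set. The problem $\boldsymbol Q(\Sigma,\boldsymbol a)$, $\boldsymbol a\in\mathbb R^k\setminus(-\infty,0]^k$, is: minimise $\boldsymbol x^\top\Sigma^{-1}\boldsymbol x$ under the linear constraint $\boldsymbol x\ge\boldsymbol a$. It has a unique solution $\widetilde{\boldsymbol a}$, and it determines a unique non-empty index set $I\subset\{1,\dots,k\}$, called the minimal index set, such that, with $J=\{1,\dots,k\}\setminus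 I$: $\widetilde{\boldsymbol a}_I=\boldsymbol a_I$, $\Sigma_{II}^{-1}\boldsymbol a_I>\boldsymbol 0_I$, and (if $J\neq\emptyset$) $\widetilde{\boldsymbol a}_J=\Sigma_{JI}\Sigma_{II}^{-1}\boldsymbol a_I\ge\boldsymbol a_J$; the minimum is $\boldsymbol a_I^\top\Sigma_{II}^{-1}\boldsymbol a_I>0$. *)

theory Defs
  imports "HOL-Probability.Probability" "HOL-Library.Landau_Symbols"
begin

text \<open>
  An index set \<open>K \<subseteq> {1, ..., k}\<close> is given by an injection \<open>e :: 'm \<Rightarrow> 'k\<close> with range \<open>K\<close>,
  where \<open>'m\<close> is a finite type; vectors indexed by \<open>K\<close> are then elements of \<open>real ^ 'm\<close>.
  Since \<open>'m\<close> is non-empty, so is \<open>K\<close>.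
\<close>

definition subvec :: "('m::finite \<Rightarrow> 'k::finite) \<Rightarrow> real ^ 'k \<Rightarrow> real ^ 'm"
  where "subvec e x = (\<chi> i. x $ e i)"

definition submat ::
    "('m::finite \<Rightarrow> 'k::finite) \<Rightarrow> ('n::finite \<Rightarrow> 'l::finite) \<Rightarrow> real ^ 'l ^ 'k \<Rightarrow> real ^ 'n ^ 'm"
  where "submat e f S = (\<chi> i j. S $ e i $ f j)"

definition correlation_matrix :: "real ^ 'k ^ 'k::finite \<Rightarrow> bool"
  where "correlation_matrix S \<longleftrightarrow>
    transpose S = S \<and> (\<forall>x. x \<noteq> 0 \<longrightarrow> 0 < x \<bullet> (S *v x)) \<and> (\<forall>i. S $ i $ i = 1)"

definition qp_solution :: "real ^ 'k ^ 'k::finite \<Rightarrow> real ^ 'k \<Rightarrow> real ^ 'k \<Rightarrow> bool"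
  where "qp_solution S a x \<longleftrightarrow>
    is_arg_min (\<lambda>y. y \<bullet> (matrix_inv S *v y)) (\<lambda>y. \<forall>i. a $ i \<le> y $ i) x"

text \<open>
  The injection \<open>e\<close> enumerates the minimal index set \<open>I = range e\<close> of the quadratic programming
  problem. The clause about the complement of \<open>I\<close> is stated row by row (\<open>submat id e S\<close> consists
  of all rows and the columns in \<open>I\<close>), so that it is void if the complement is empty.
\<close>

definition enumerates_minimal_index_set ::
    "real ^ 'k ^ 'k::finite \<Rightarrow> real ^ 'k \<Rightarrow> ('i::finite \<Rightarrow> 'k) \<Rightarrow> bool"
  where "enumerates_minimal_index_set S a e \<longleftrightarrow>
    inj e \<and>
    (\<exists>x. qp_solution S a x \<and>
      subvec e x = subvec e a \<and>
      (\<forall>i. 0 < (matrix_inv (submat e e S) *v subvec e a) $ i) \<and>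
      (\<forall>j. j \<notin> range e \<longrightarrow>
        x $ j = (submat id e S *v (matrix_inv (submat e e S) *v subvec e a)) $ j \<and>
        a $ j \<le> x $ j))"

text \<open>
  Normalised surface measure on the unit sphere, as the cone measure: the law of \<open>x / norm x\<close>
  for \<open>x\<close> uniformly distributed in the unit ball.
\<close>

definition uniform_sphere :: "'a::euclidean_space measure"
  where "uniform_sphere = distr (uniform_measure lborel (ball 0 1)) borel (\<lambda>x. x /\<^sub>R norm x)"

text \<open>
  The library's \<open>indep_var\<close> requires both random variables to have values in the same type.
\<close>

definition independent_rvs ::
    "'w measure \<Rightarrow> ('w \<Rightarrow> 'a::topological_space) \<Rightarrow> ('w \<Rightarrow> 'b::topological_space) \<Rightarrow> bool"
  where "independent_rvs M Y Z \<longleftrightarrow>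
    prob_space.indep_set M {Y -` B \<inter> space M | B. B \<in> sets borel} {Z -` B \<inter> space M | B. B \<in> sets borel}"

text \<open>The conditional law of \<open>Y\<close> given an event \<open>B\<close> (of positive probability).\<close>

definition conditional_law ::
    "'w measure \<Rightarrow> ('w \<Rightarrow> bool) \<Rightarrow> ('w \<Rightarrow> 'a::topological_space) \<Rightarrow> 'a measure"
  where "conditional_law M B Y = distr (uniform_measure M {\<omega> \<in> space M. B \<omega>}) borel Y"

text \<open>The centered Gaussian law with positive definite covariance matrix \<open>C\<close>.\<close>

definition centered_gaussian :: "real ^ 'n ^ 'n::finite \<Rightarrow> (real ^ 'n) measure"
  where "centered_gaussian C = density lborel
    (\<lambda>x. ennreal (exp (- (x \<bullet> (matrix_inv C *v x)) / 2) / sqrt ((2 * pi) ^ CARD('n) * det C)))"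

text \<open>
  For \<open>Z\<close> centered Gaussian with covariance matrix \<open>S\<close>: the conditional law of \<open>Z\<^sub>J\<close> given
  that \<open>Z\<^sub>I\<close> is zero, where \<open>f\<close> enumerates \<open>J\<close> and \<open>e\<close> enumerates \<open>I\<close>.
\<close>

definition gaussian_given_zero ::
    "real ^ 'k ^ 'k::finite \<Rightarrow> ('j::finite \<Rightarrow> 'k) \<Rightarrow> ('i::finite \<Rightarrow> 'k) \<Rightarrow> (real ^ 'j) measure"
  where "gaussian_given_zero S f e = centered_gaussian
    (submat f f S - submat f e S ** matrix_inv (submat e e S) ** submat e f S)"

text \<open>
  Convergence in distribution of random variables \<open>Y n\<close>, each defined on its own probability
  space \<open>\<Omega> n\<close>, to the law \<open>\<nu>\<close>.
\<close>

definition converges_in_distribution ::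
    "(nat \<Rightarrow> 'w measure) \<Rightarrow> (nat \<Rightarrow> 'w \<Rightarrow> 'a::metric_space) \<Rightarrow> 'a measure \<Rightarrow> bool"
  where "converges_in_distribution \<Omega> Y \<nu> \<longleftrightarrow>
    (\<forall>g :: 'a \<Rightarrow> real. continuous_on UNIV g \<longrightarrow> bounded (range g) \<longrightarrow>
      (\<lambda>n. \<integral>\<omega>. g (Y n \<omega>) \<partial>\<Omega> n) \<longlonglongrightarrow> (\<integral>y. g y \<partial>\<nu>))"

end

theory Submission
  imports Defs "HOL-Real_Asymp.Real_Asymp"
begin

text \<open>
  Let \<open>\<kappa>\<close> be the norm of \<open>a\<^sub>I\<close>, let \<open>b = \<Sigma>\<^sub>I\<^sub>I\<^sup>-\<^sup>1 a\<^sub>I\<close>, and put \<open>s = t \<kappa>\<close>, \<open>\<lambda> = q \<delta> s\<^sup>\<delta>\<close>; then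
  \<open>h = \<surd>\<lambda> / s\<close>. Since \<open>b\<close> has positive entries, \<open>X\<^sub>I > t a\<^sub>I\<close> implies
  \<open>b \<bullet> X\<^sub>I > t \<kappa>\<^sup>2\<close>, and the Cauchy-Schwarz inequality for the form of \<open>\<Sigma>\<^sub>I\<^sub>I\<^sup>-\<^sup>1\<close> gives
  \<open>R > s\<close>. So only the law of \<open>R\<close> above \<open>s\<close> matters, and there the tail hypothesis says that the
  scaled excess \<open>\<lambda> (R / s - 1)\<close> converges in law to a standard exponential variable.

  In the coordinates \<open>\<xi> = x\<^sub>I\<close> and \<open>\<eta> = x\<^sub>J - \<Sigma>\<^sub>J\<^sub>I \<Sigma>\<^sub>I\<^sub>I\<^sup>-\<^sup>1 x\<^sub>I\<close> the form of
  \<open>\<Sigma>\<^sup>-\<^sup>1\<close> is the sum of the form of \<open>\<Sigma>\<^sub>I\<^sub>I\<^sup>-\<^sup>1\<close> in \<open>\<xi>\<close> and of the form \<open>H\<close> of the inverse Schur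
  complement in \<open>\<eta>\<close>. A uniform direction depends on a point \<open>x\<close> only through \<open>x / \<parallel>x\<parallel>\<close>, so on a half
  space its law may be computed with the measure \<open>\<parallel>x\<parallel>\<^sup>-\<^sup>k dx\<close> on any slab that is parallel to the
  boundary (\<open>uniform_sphere_slab\<close>). The slab \<open>\<kappa>\<^sup>2 \<le> b \<bullet> \<xi> \<le> \<kappa>\<^sup>2 (1 + 1/\<lambda>)\<close> is as thin as the scale
  on which \<open>\<xi>\<close> fluctuates, so that with \<open>\<xi> = a\<^sub>I + z/\<lambda>\<close> and \<open>\<eta> = \<kappa> y/\<surd>\<lambda>\<close> it becomes the fixed
  slab \<open>0 \<le> b \<bullet> z \<le> \<kappa>\<^sup>2\<close>, and \<open>n\<close> enters the integrand only through \<open>\<lambda>\<close> and the excess. Numerator and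
  denominator of the conditional expectation of \<open>g\<close> carry the same constant factor, which contains
  the probability of \<open>R > s\<close> and all Jacobians; it cancels (\<open>exceedance_integral_eq\<close>).

  In these coordinates the norm of the point is \<open>\<kappa> (1 + (b \<bullet> z / \<kappa>\<^sup>2 + H y / 2) / \<lambda> + o(1/\<lambda>))\<close>.
  Hence the integrand converges to \<open>g y\<close> times the indicator of the slab and of
  \<open>z\<^sub>i + a\<^sub>i (x - b \<bullet> z / \<kappa>\<^sup>2 - H y / 2) > 0\<close> for all \<open>i\<close>, where \<open>x\<close> is exponential. Shifting \<open>x\<close> splits
  off the factor \<open>exp (- H y / 2)\<close>, which is up to a constant the Gaussian density with the Schur
  complement as covariance, and leaves a factor in which \<open>y\<close> does not occur. Dominated convergence applies
  (\<open>kern_integral_tendsto\<close>) because \<open>z\<close> and \<open>y\<close> are bounded by a multiple of \<open>1\<close> plus the excess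
  (\<open>region_bounded\<close>), while the quantile function of the excess, run on an exponential variable \<open>x\<close>,
  is bounded by a multiple of \<open>exp (x / m)\<close> for \<open>m\<close> as large as desired (\<open>kotz_excess_coupling\<close>).
\<close>

section \<open>Linear changes of variables and the Gaussian normalising constant\<close>

text \<open>
  Uniqueness of Haar measure: the image of Lebesgue measure under \<open>f\<close> is translation invariant and
  finite on compact sets. The two spaces may be different types of the same dimension, and the
  constant is left undetermined because it cancels in conditional laws.
\<close>

lemma linear_bij_lborel_scales:
  fixes f :: "'a::euclidean_space \<Rightarrow> 'b::euclidean_space"
  assumes f: "linear f" "bij f"
  shows "\<exists>c>0. \<forall>\<Phi>\<in>borel_measurable borel.
           (\<integral>\<^sup>+x. \<Phi> (f x) \<partial>lborel) = ennreal c * (\<integral>\<^sup>+y. \<Phi> y \<partial>lborel)"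
proof -
  have fm[measurable]: "f \<in> borel_measurable borel"
    using f(1) by (intro borel_measurable_continuous_onI linear_continuous_on)
      (simp add: linear_conv_bounded_linear)
  obtain g where g0: "linear g" "g \<circ> f = id"
    using linear_injective_left_inverse[of f] f by (auto simp: bij_def)
  have g: "linear g" "\<And>x. g (f x) = x" "\<And>y. f (g y) = y"
  proof -
    show "linear g" by fact
    show *: "g (f x) = x" for x using g0(2) by (simp add: fun_eq_iff)
    show "f (g y) = y" for y
    proof -
      obtain x where "y = f x" using f(2) by (auto simp: bij_def surj_def)
      then show ?thesis by (simp add: *)
    qed
  qed
  have gc: "continuous_on UNIV g" "continuous_on UNIV f"
    using g(1) f(1) by (auto intro!: linear_continuous_on simp: linear_conv_bounded_linear)
  define \<mu> where "\<mu> = distr lborel borel f"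
  have sets\<mu>[simp, measurable_cong]: "sets \<mu> = sets borel" and [simp]: "space \<mu> = UNIV"
    by (auto simp: \<mu>_def)
  have em: "emeasure \<mu> A = emeasure lborel (g ` A)" if "A \<in> sets borel" for A
  proof -
    have "f -` A = g ` A"
    proof (intro set_eqI iffI)
      fix x assume "x \<in> f -` A"
      then show "x \<in> g ` A" using g(2)[of x] by (intro image_eqI[of _ _ "f x"]) auto
    qed (use g in auto)
    then show ?thesis using that by (simp add: \<mu>_def emeasure_distr)
  qed
  have fin: "emeasure \<mu> A < \<infinity>" if "compact A" for A
  proof -
    have "compact (g ` A)" using that gc continuous_on_subset compact_continuous_image by blast
    then show ?thesis using that emeasure_compact_finite[of "g ` A"] by (simp add: em borel_compact)
  qed
  interpret \<mu>: sigma_finite_measure \<mu>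
  proof
    show "\<exists>A. countable A \<and> A \<subseteq> sets \<mu> \<and> \<Union>A = space \<mu> \<and> (\<forall>a\<in>A. emeasure \<mu> a \<noteq> \<infinity>)"
      using fin[OF compact_cball]
      by (intro exI[of _ "range (\<lambda>n. cball 0 (real n))"])
         (auto simp: less_top[symmetric] real_arch_simple)
  qed
  interpret pair_sigma_finite \<mu> "lborel :: 'b measure" ..
  have trans: "(\<integral>\<^sup>+x. \<Phi> (x + v) \<partial>\<mu>) = (\<integral>\<^sup>+x. \<Phi> x \<partial>\<mu>)"
    if [measurable]: "\<Phi> \<in> borel_measurable borel" for \<Phi> :: "'b \<Rightarrow> ennreal" and v
  proof -
    have "(\<integral>\<^sup>+x. \<Phi> (x + v) \<partial>\<mu>) = (\<integral>\<^sup>+x. \<Phi> (f (g v + x)) \<partial>lborel)"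
      using f(1) g by (simp add: \<mu>_def nn_integral_distr linear_add add.commute)
    also have "\<dots> = (\<integral>\<^sup>+x. \<Phi> (f x) \<partial>(distr lborel borel ((+) (g v))))"
      by (subst nn_integral_distr) auto
    finally show ?thesis by (simp add: lborel_distr_plus \<mu>_def nn_integral_distr)
  qed
  \<comment> \<open>Integrate \<open>1\<^sub>A (x + y) 1\<^sub>B y\<close> in both orders; translation invariance of \<open>\<mu>\<close> is used in one
    order and that of Lebesgue measure in the other.\<close>
  have key: "emeasure \<mu> A * emeasure lborel B = emeasure lborel A * (\<integral>\<^sup>+x. indicator B (- x) \<partial>\<mu>)"
    if [measurable]: "A \<in> sets borel" "B \<in> sets borel" for A B :: "'b set"
  proof -
    have "emeasure \<mu> A * emeasure lborel B
        = (\<integral>\<^sup>+y. (\<integral>\<^sup>+x. indicator A (x + y) * indicator B y \<partial>\<mu>) \<partial>lborel)"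
      by (simp add: nn_integral_multc nn_integral_cmult trans[of "indicator A"])
    also have "\<dots> = (\<integral>\<^sup>+x. (\<integral>\<^sup>+y. indicator A (x + y) * indicator B y \<partial>lborel) \<partial>\<mu>)"
      by (rule Fubini') simp
    also have "\<dots> = (\<integral>\<^sup>+x. (\<integral>\<^sup>+y. indicator A y * indicator B (y - x) \<partial>lborel) \<partial>\<mu>)"
    proof (rule nn_integral_cong)
      fix x
      have "(\<integral>\<^sup>+y. indicator A y * indicator B (y - x) \<partial>(distr lborel borel ((+) x))) =
        (\<integral>\<^sup>+y. indicator A (x + y) * indicator B y \<partial>(lborel::'b measure))"
        by (subst nn_integral_distr) (auto intro!: nn_integral_cong)
      then show "(\<integral>\<^sup>+y. indicator A (x + y) * indicator B y \<partial>lborel) =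
        (\<integral>\<^sup>+y. indicator A y * indicator B (y - x) \<partial>(lborel::'b measure))"
        by (simp add: lborel_distr_plus)
    qed
    also have "\<dots> = (\<integral>\<^sup>+y. (\<integral>\<^sup>+x. indicator A y * indicator B (y - x) \<partial>\<mu>) \<partial>lborel)"
      by (rule Fubini'[symmetric]) simp
    also have "\<dots> = (\<integral>\<^sup>+y. indicator A y * (\<integral>\<^sup>+x. indicator B (- x) \<partial>\<mu>) \<partial>lborel)"
    proof (rule nn_integral_cong)
      fix y
      have "(\<integral>\<^sup>+x. indicator B (y - x) \<partial>\<mu>) = (\<integral>\<^sup>+x. indicator B (- x) \<partial>\<mu>)"
        using trans[of "\<lambda>x. indicator B (-x)" "-y"] by simp
      then show "(\<integral>\<^sup>+x. indicator A y * indicator B (y - x) \<partial>\<mu>) =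
        indicator A y * (\<integral>\<^sup>+x. indicator B (- x) \<partial>\<mu>)"
        by (simp add: nn_integral_cmult)
    qed
    finally show ?thesis by (simp add: nn_integral_multc)
  qed
  define B where "B = ball (0::'b) 1"
  define m where "m = (\<integral>\<^sup>+x. indicator B (- x) \<partial>\<mu>)"
  have mB: "m = emeasure \<mu> B"
  proof -
    have "(\<lambda>x. indicator B (- x) :: ennreal) = indicator B" by (auto simp: B_def indicator_def)
    then show ?thesis by (simp add: m_def B_def)
  qed
  have Bb: "B \<in> sets borel" by (simp add: B_def)
  have eB: "emeasure lborel B \<noteq> 0" "emeasure lborel B \<noteq> \<infinity>"
    using unit_ball_vol_pos[of "real DIM('b)", OF of_nat_0_le_iff]
    by (simp_all add: B_def emeasure_ball not_le less_imp_neq[symmetric])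
  have m0: "m \<noteq> 0"
  proof
    assume "m = 0"
    with key[of UNIV B] have "emeasure \<mu> UNIV = 0" using eB Bb by (simp add: m_def[symmetric])
    moreover have "emeasure \<mu> UNIV = \<infinity>"
      using g by (simp add: em) (metis emeasure_lborel_UNIV infinity_ennreal_def surjI)
    ultimately show False by simp
  qed
  have mfin: "m \<noteq> \<infinity>"
  proof -
    have "emeasure \<mu> B \<le> emeasure \<mu> (cball 0 1)" by (rule emeasure_mono) (auto simp: B_def)
    with fin[of "cball 0 1"] show ?thesis using mB by (auto simp: top_unique)
  qed
  obtain c where c: "ennreal c = m / emeasure lborel B" "c > 0"
  proof -
    obtain r where r: "m = ennreal r" "r > 0"
      using m0 mfin by (cases m) (auto simp: less_le)
    obtain e where e: "emeasure lborel B = ennreal e" "e > 0"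
      using eB by (cases "emeasure lborel B") (auto simp: less_le)
    show ?thesis using r e by (intro that[of "r / e"]) (auto simp: divide_ennreal)
  qed
  have "\<mu> = scale_measure (ennreal c) lborel"
  proof (rule measure_eqI)
    fix A assume "A \<in> sets \<mu>"
    then have "emeasure \<mu> A * emeasure lborel B = emeasure lborel A * m"
      using key[of A B] Bb by (simp add: m_def)
    then have "emeasure \<mu> A = emeasure lborel A * m / emeasure lborel B"
      using eB by (metis ennreal_mult_divide_eq mult.commute infinity_ennreal_def)
    then show "emeasure \<mu> A = emeasure (scale_measure (ennreal c) lborel) A"
      by (simp add: c ennreal_times_divide mult.commute)
  qed simp
  then have "(\<integral>\<^sup>+x. \<Phi> (f x) \<partial>lborel) = ennreal c * (\<integral>\<^sup>+y. \<Phi> y \<partial>lborel)"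
    if [measurable]: "\<Phi> \<in> borel_measurable borel" for \<Phi>
    using that nn_integral_distr[of f lborel borel \<Phi>]
    by (simp add: \<mu>_def nn_integral_scale_measure)
  with c(2) show ?thesis by blast
qed

text \<open>
  By \<open>linear_bij_lborel_scales\<close> some constant exists, and it is multiplicative in \<open>M\<close>; so it suffices to
  identify it for elementary matrices. Diagonal matrices scale boxes. A transposition is an
  involution, and a shear \<open>S\<close> satisfies \<open>D S = S S D\<close> for a diagonal matrix \<open>D\<close>, which forces both the
  constant and the absolute value of the determinant to be \<open>1\<close>.
\<close>

lemma lborel_change_of_variables_matrix:
  fixes M :: "real^'n^'n" and \<Phi> :: "real^'n \<Rightarrow> ennreal"
  assumes "det M \<noteq> 0" "\<Phi> \<in> borel_measurable borel"
  shows "(\<integral>\<^sup>+x. \<Phi> x \<partial>lborel) = ennreal \<bar>det M\<bar> * (\<integral>\<^sup>+x. \<Phi> (M *v x) \<partial>lborel)"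
proof -
  have meas[measurable]: "(\<lambda>x. A *v x) \<in> borel_measurable borel" for A :: "real^'n^'n"
    by (intro borel_measurable_continuous_onI linear_continuous_on) auto
  have haar: "\<exists>c>0. \<forall>\<Phi>\<in>borel_measurable borel.
      (\<integral>\<^sup>+x. \<Phi> (A *v x) \<partial>lborel) = ennreal c * (\<integral>\<^sup>+y. \<Phi> y \<partial>lborel)"
    if "det A \<noteq> 0" for A :: "real^'n^'n"
    using that by (intro linear_bij_lborel_scales)
      (auto simp: invertible_det_nz[symmetric] invertible_eq_bij)
  define B where "B = cball (0::real^'n) 1"
  have B[measurable]: "B \<in> sets borel" by (simp add: B_def)
  have B0: "emeasure lborel B \<noteq> 0" "emeasure lborel B \<noteq> \<top>"
    using unit_ball_vol_pos[of "real CARD('n)", OF of_nat_0_le_iff]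
    by (simp_all add: B_def emeasure_cball not_le less_imp_neq[symmetric])
  have cancel: "c = d" if "ennreal c * emeasure lborel B = ennreal d * emeasure lborel B" "c \<ge> 0" "d \<ge> 0"
    for c d
    using that B0 by (cases "emeasure lborel B") (auto simp: ennreal_mult[symmetric])
  have iB: "(\<integral>\<^sup>+y. indicator B y \<partial>lborel) = emeasure lborel B" by simp
  define P where "P A \<longleftrightarrow> (det A \<noteq> 0 \<longrightarrow> (\<forall>\<Phi>\<in>borel_measurable borel.
      (\<integral>\<^sup>+x. \<Phi> x \<partial>lborel) = ennreal \<bar>det A\<bar> * (\<integral>\<^sup>+x. \<Phi> (A *v x) \<partial>lborel)))" for A :: "real^'n^'n"
  have PD: "(\<integral>\<^sup>+x. \<Phi> x \<partial>lborel) = ennreal \<bar>det A\<bar> * (\<integral>\<^sup>+x. \<Phi> (A *v x) \<partial>lborel)"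
    if "P A" "det A \<noteq> 0" "\<Phi> \<in> borel_measurable borel" for A :: "real^'n^'n" and \<Phi> :: "real^'n \<Rightarrow> ennreal"
    using that unfolding P_def by blast
  have diag: "P A" if A: "\<And>i j. i \<noteq> j \<Longrightarrow> A$i$j = 0" for A
    unfolding P_def
  proof (intro impI ballI)
    fix \<Phi> :: "real^'n \<Rightarrow> ennreal" assume d: "det A \<noteq> 0" and [measurable]: "\<Phi> \<in> borel_measurable borel"
    have dA: "det A = (\<Prod>i\<in>UNIV. A$i$i)" by (rule det_diagonal) (use A in auto)
    define c where "c = (\<lambda>j. j \<bullet> (A *v j))"
    have bas: "(Basis :: (real^'n) set) = (\<lambda>i. axis i 1) ` UNIV"
      by (auto simp: Basis_vec_def)
    have inj: "inj (\<lambda>i::'n. axis i (1::real))" by (auto simp: inj_on_def axis_eq_axis)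
    have cax: "c (axis i 1) = A$i$i" for i
      by (simp add: c_def inner_axis' matrix_vector_mult_basis column_def)
    have T: "(0::real^'n) + (\<Sum>j\<in>Basis. (c j * (x \<bullet> j)) *\<^sub>R j) = A *v x" for x
    proof -
      have "(\<Sum>j\<in>Basis. (c j * (x \<bullet> j)) *\<^sub>R j) = (\<Sum>i\<in>UNIV. (A$i$i * x$i) *\<^sub>R axis i 1)"
        unfolding bas by (subst sum.reindex[OF inj]) (simp add: cax inner_axis)
      also have "\<dots> = A *v x"
      proof (rule vec_eq_iff[THEN iffD2], rule allI)
        fix k
        have "(\<Sum>i\<in>UNIV. (A$i$i * x$i) *\<^sub>R axis i (1::real)) $ k = A$k$k * x$k"
          by (simp add: axis_def if_distrib[of "\<lambda>x. _ * x"] cong: if_cong)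
        also have "\<dots> = (\<Sum>j\<in>UNIV. if j = k then A$k$j * x$j else 0)" by simp
        also have "\<dots> = (\<Sum>j\<in>UNIV. A$k$j * x$j)"
          by (rule sum.cong) (use A[of k] in auto)
        also have "\<dots> = (A *v x) $ k" by (simp add: matrix_vector_mult_def)
        finally show "(\<Sum>i\<in>UNIV. (A$i$i * x$i) *\<^sub>R axis i (1::real)) $ k = (A *v x) $ k" .
      qed
      finally show ?thesis by simp
    qed
    have nz: "c j \<noteq> 0" if "j \<in> Basis" for j
      using that d by (auto simp: bas cax dA)
    have "lborel = density (distr lborel borel (\<lambda>x. A *v x)) (\<lambda>_. ennreal (\<Prod>j\<in>Basis. \<bar>c j\<bar>))"
      using lborel_affine_euclidean[of c 0, OF nz] unfolding T by simp
    also have "(\<Prod>j\<in>Basis. \<bar>c j\<bar>) = \<bar>det A\<bar>"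
      unfolding bas dA by (subst prod.reindex[OF inj]) (simp add: cax abs_prod)
    finally have eq: "lborel = density (distr lborel borel (\<lambda>x. A *v x)) (\<lambda>_. ennreal \<bar>det A\<bar>)" .
    show "(\<integral>\<^sup>+x. \<Phi> x \<partial>lborel) = ennreal \<bar>det A\<bar> * (\<integral>\<^sup>+x. \<Phi> (A *v x) \<partial>lborel)"
      by (subst eq) (simp add: nn_integral_density nn_integral_distr nn_integral_cmult)
  qed
  have "P M"
  proof (induction M rule: induct_matrix_elementary_alt)
    case (1 A B)
    show ?case unfolding P_def
    proof (intro impI ballI)
      fix \<Phi> :: "real^'n \<Rightarrow> ennreal" assume d: "det (A ** B) \<noteq> 0" and m[measurable]: "\<Phi> \<in> borel_measurable borel"
      have "(\<integral>\<^sup>+x. \<Phi> x \<partial>lborel) = ennreal \<bar>det A\<bar> * (\<integral>\<^sup>+x. \<Phi> (A *v x) \<partial>lborel)"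
        using d by (intro PD[OF 1(1) _ m]) (auto simp: det_mul)
      also have "(\<integral>\<^sup>+x. \<Phi> (A *v x) \<partial>lborel) = ennreal \<bar>det B\<bar> * (\<integral>\<^sup>+x. \<Phi> (A *v (B *v x)) \<partial>lborel)"
        using d by (intro PD[OF 1(2)]) (auto simp: det_mul)
      finally show "(\<integral>\<^sup>+x. \<Phi> x \<partial>lborel) = ennreal \<bar>det (A ** B)\<bar> * (\<integral>\<^sup>+x. \<Phi> ((A ** B) *v x) \<partial>lborel)"
        by (simp add: det_mul abs_mult ennreal_mult mult.assoc matrix_vector_mul_assoc)
    qed
  next
    case (2 A i)
    then show ?case by (simp add: P_def det_zero_row)
  next
    case (3 A)
    then show ?case by (rule diag)
  next
    case (4 m n)
    define S :: "real^'n^'n" where "S = (\<chi> i j. mat 1 $ i $ Transposition.transpose m n j)"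
    have "(S *v x) $ i = x $ Transposition.transpose m n i" for x i
    proof -
      have eq: "(i = Transposition.transpose m n j) = (j = Transposition.transpose m n i)" for j
        by (auto simp: Transposition.transpose_def)
      show ?thesis
        by (simp add: S_def matrix_vector_mult_def mat_def eq if_distrib[of "\<lambda>x. x * _"] cong: if_cong)
    qed
    then have "S *v (S *v x) = x" for x
      by (simp add: vec_eq_iff)
    then have "S ** S = mat 1" by (simp add: matrix_eq flip: matrix_vector_mul_assoc)
    then have "det S * det S = 1" "S *v (S *v x) = x" for x
      by (simp_all add: det_mul[symmetric] matrix_vector_mul_assoc)
    then have d: "\<bar>det S\<bar> = 1" "det S \<noteq> 0" and inv: "S *v (S *v x) = x" for x
      by (auto simp: abs_square_eq_1 power2_eq_square[symmetric])
    obtain c where c: "c > 0" "\<And>\<Phi>. \<Phi>\<in>borel_measurable borel \<Longrightarrow>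
      (\<integral>\<^sup>+x. \<Phi> (S *v x) \<partial>lborel) = ennreal c * (\<integral>\<^sup>+y. \<Phi> y \<partial>lborel)"
      using haar[OF d(2)] by blast
    have "emeasure lborel B = ennreal c * (ennreal c * emeasure lborel B)"
      using c(2)[of "\<lambda>x. indicator B (S *v x)"] c(2)[of "indicator B"] by (simp add: inv)
    then have "c * c = 1"
      using cancel[of 1 "c * c"] c(1) by (simp add: ennreal_mult mult.assoc)
    then have "c = 1" using c(1) by (metis abs_of_pos abs_square_eq_1 power2_eq_square)
    with c(2) show ?case unfolding S_def[symmetric] by (simp add: P_def d)
  next
    case (5 m n)
    define S :: "real^'n^'n" where "S = (\<chi> i j. of_bool (i = m \<and> j = n \<or> i = j))"
    define D :: "real^'n^'n" where "D = (\<chi> i j. if i = j then (if j = m then 2 else 1) else 0)"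
    have DS: "D ** S = S ** (S ** D)"
    proof -
      have Sx: "(S *v x) $ i = (if i = m then x$m + x$n else x$i)" for x i
      proof -
        have "(S *v x) $ i = (\<Sum>j\<in>UNIV. (if j = i then x$j else 0) + (if j = n then (if i = m then x$j else 0) else 0))"
          unfolding matrix_vector_mult_def S_def using 5 by (auto intro!: sum.cong)
        then show ?thesis by (simp add: sum.distrib)
      qed
      have Dx: "(D *v x) $ i = (if i = m then 2 * x$i else x$i)" for x i
        unfolding matrix_vector_mult_def D_def by (simp add: if_distrib[of "\<lambda>x. x * _"] cong: if_cong)
      have "D *v (S *v x) = S *v (S *v (D *v x))" for x
        using 5 by (simp add: vec_eq_iff Sx Dx)
      then show ?thesis by (simp add: matrix_eq matrix_vector_mul_assoc)
    qed
    have dD: "det D \<noteq> 0" unfolding D_def by (subst det_diagonal) auto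
    have "P S"
    proof (cases "det S = 0")
      case False
      have "det S = 1" using arg_cong[OF DS, of det] dD False by (simp add: det_mul)
      obtain c where c: "c > 0" "\<And>\<Phi>. \<Phi>\<in>borel_measurable borel \<Longrightarrow>
        (\<integral>\<^sup>+x. \<Phi> (S *v x) \<partial>lborel) = ennreal c * (\<integral>\<^sup>+y. \<Phi> y \<partial>lborel)"
        using haar[OF False] by blast
      obtain d where d: "d > 0" "\<And>\<Phi>. \<Phi>\<in>borel_measurable borel \<Longrightarrow>
        (\<integral>\<^sup>+x. \<Phi> (D *v x) \<partial>lborel) = ennreal d * (\<integral>\<^sup>+y. \<Phi> y \<partial>lborel)"
        using haar[OF dD] by blast
      have "(\<integral>\<^sup>+x. indicator B (D *v (S *v x)) \<partial>lborel) = ennreal (c * d) * emeasure lborel B"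
        using c(2)[of "\<lambda>x. indicator B (D *v x)"] d(2)[of "indicator B"] c(1) d(1)
        by (simp add: ennreal_mult mult.assoc)
      moreover have "(\<integral>\<^sup>+x. indicator B (S *v (S *v (D *v x))) \<partial>lborel) = ennreal (d * (c * c)) * emeasure lborel B"
        using d(2)[of "\<lambda>x. indicator B (S *v (S *v x))"] c(2)[of "\<lambda>x. indicator B (S *v x)"]
          c(2)[of "indicator B"] c(1) d(1)
        by (simp add: ennreal_mult mult.assoc)
      moreover have "D *v (S *v x) = S *v (S *v (D *v x))" for x
        using arg_cong[OF DS, of "\<lambda>B. B *v x"] by (simp add: matrix_vector_mul_assoc)
      ultimately have "c * d = d * (c * c)" using cancel[of "c * d" "d * (c * c)"] c(1) d(1) by simp
      then have "c = 1" using c(1) d(1) by simp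
      with c(2) show ?thesis by (simp add: P_def \<open>det S = 1\<close>)
    qed (simp add: P_def)
    then show ?case unfolding S_def .
  qed
  then show ?thesis using assms by (rule PD)
qed

lemma matrix_inverse:
  fixes C :: "real^'n^'n"
  assumes "invertible C"
  shows "C ** matrix_inv C = mat 1" "matrix_inv C ** C = mat 1"
  using someI_ex[OF assms[unfolded invertible_def]] by (auto simp: matrix_inv_def)

lemma nn_integral_standard_gaussian:
  "(\<integral>\<^sup>+x. ennreal (exp (- (x \<bullet> x) / 2)) \<partial>(lborel :: (real^'n) measure)) = ennreal (sqrt ((2 * pi) ^ CARD('n)))"
proof -
  have 1: "(\<integral>\<^sup>+x. ennreal (exp (- x\<^sup>2 / 2)) \<partial>lborel) = ennreal (sqrt (2 * pi))"
  proof -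
    interpret prob_space "density lborel std_normal_density"
      by (rule prob_space_normal_density) simp
    have "(\<integral>\<^sup>+x. ennreal (exp (- x\<^sup>2 / 2)) \<partial>lborel)
        = (\<integral>\<^sup>+x. ennreal (sqrt (2 * pi)) * ennreal (std_normal_density x) \<partial>lborel)"
      by (intro nn_integral_cong) (simp add: std_normal_density_def ennreal_mult[symmetric])
    also have "\<dots> = ennreal (sqrt (2 * pi)) * emeasure (density lborel std_normal_density) UNIV"
      by (simp add: nn_integral_cmult emeasure_density)
    finally show ?thesis using emeasure_space_1 by simp
  qed
  have "(\<integral>\<^sup>+x. ennreal (exp (- (x \<bullet> x) / 2)) \<partial>(lborel :: (real^'n) measure))
     = (\<integral>\<^sup>+x. (\<Prod>b\<in>Basis. ennreal (exp (- (x \<bullet> b)\<^sup>2 / 2))) \<partial>(lborel :: (real^'n) measure))"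
  proof (rule nn_integral_cong)
    fix x :: "real^'n"
    have "x \<bullet> x = (\<Sum>b\<in>Basis. (x \<bullet> b)\<^sup>2)"
      by (subst euclidean_inner) (simp add: power2_eq_square)
    then have "exp (- (x \<bullet> x) / 2) = (\<Prod>b\<in>Basis. exp (- (x \<bullet> b)\<^sup>2 / 2))"
      by (simp add: exp_sum[symmetric] sum_divide_distrib sum_negf)
    then show "ennreal (exp (- (x \<bullet> x) / 2)) = (\<Prod>b\<in>Basis. ennreal (exp (- (x \<bullet> b)\<^sup>2 / 2)))"
      by (simp add: prod_ennreal)
  qed
  also have "\<dots> = (\<Prod>b\<in>(Basis :: (real^'n) set). ennreal (sqrt (2 * pi)))"
    by (subst nn_integral_lborel_prod) (simp_all add: 1[simplified])
  finally show ?thesis by (simp add: ennreal_power real_sqrt_mult real_sqrt_power power_mult_distrib)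
qed

text \<open>
  The columns of \<open>V\<close> are a basis that is orthonormal for the inner product of \<open>C\<close>; the Gram-Schmidt
  process builds it one index at a time.
\<close>

lemma exists_matrix_orthonormalizing:
  fixes C :: "real^'n^'n"
  assumes sym: "transpose C = C" and pos: "\<And>x. x \<noteq> 0 \<Longrightarrow> 0 < x \<bullet> (C *v x)"
  shows "\<exists>V :: real^'n^'n. transpose V ** C ** V = mat 1"
proof -
  have symC: "x \<bullet> (C *v y) = y \<bullet> (C *v x)" for x y
    by (metis sym dot_lmul_matrix inner_commute transpose_matrix_vector)
  have "\<exists>v. \<forall>i\<in>F. \<forall>j\<in>F. v i \<bullet> (C *v v j) = (if i = j then 1 else 0 :: real)" for F :: "'n set"
    using finite[of F]
  proof (induction F rule: finite_induct)
    case (insert k F)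
    then obtain v where v: "\<And>i j. i \<in> F \<Longrightarrow> j \<in> F \<Longrightarrow> v i \<bullet> (C *v v j) = (if i = j then 1 else 0)" by blast
    have "dim (v ` F) \<le> card F"
      using insert(1) by (meson card_image_le dim_le_card' finite_imageI le_trans)
    also have "card F < CARD('n)"
      using insert by (metis UNIV_I finite_code psubset_card_mono psubsetI subset_UNIV)
    finally have "span (v ` F) \<noteq> UNIV"
      by (metis DIM_cart DIM_real dim_UNIV dim_span less_irrefl mult.right_neutral)
    then obtain w where w: "w \<notin> span (v ` F)" by blast
    define u where "u = w - (\<Sum>j\<in>F. (v j \<bullet> (C *v w)) *\<^sub>R v j)"
    have "(\<Sum>j\<in>F. (v j \<bullet> (C *v w)) *\<^sub>R v j) \<in> span (v ` F)"
      by (intro span_sum span_scale span_base imageI)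
    then have u0: "u \<noteq> 0" using w by (auto simp: u_def)
    have uv: "v i \<bullet> (C *v u) = 0" if "i \<in> F" for i
    proof -
      have "v i \<bullet> (C *v u) = v i \<bullet> (C *v w) - (\<Sum>j\<in>F. (v j \<bullet> (C *v w)) * (v i \<bullet> (C *v v j)))"
        unfolding u_def matrix_vector_mult_diff_distrib inner_diff_right
        by (simp add: linear_sum[OF matrix_vector_mul_linear] o_def inner_sum_right matrix_vector_mult_scaleR)
      also have "(\<Sum>j\<in>F. (v j \<bullet> (C *v w)) * (v i \<bullet> (C *v v j))) = (\<Sum>j\<in>F. if j = i then v j \<bullet> (C *v w) else 0)"
        using v that by (intro sum.cong) auto
      finally show ?thesis using that insert(1) by simp
    qed
    define r where "r = sqrt (u \<bullet> (C *v u))"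
    have r: "r > 0" "r * r = u \<bullet> (C *v u)" using pos[OF u0] by (auto simp: r_def)
    define v' where "v' = v(k := (1 / r) *\<^sub>R u)"
    have "v' i \<bullet> (C *v v' j) = (if i = j then 1 else 0)" if "i \<in> insert k F" "j \<in> insert k F" for i j
      using that insert(2) v uv r symC[of u "v j"]
      by (auto simp: v'_def matrix_vector_mult_scaleR field_simps)
    then show ?case by blast
  qed simp
  from this[of UNIV] obtain v where v: "\<And>i j::'n. v i \<bullet> (C *v v j) = (if i = j then 1 else 0)" by auto
  define V :: "real^'n^'n" where "V = (\<chi> i j. v j $ i)"
  have Vx: "V *v axis j 1 = v j" for j
    by (simp add: matrix_vector_mult_basis column_def V_def vec_eq_iff)
  have "transpose V ** C ** V = mat 1"
  proof (rule vec_eq_iff[THEN iffD2], rule allI, rule vec_eq_iff[THEN iffD2], rule allI)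
    fix i j
    have "(transpose V ** C ** V) $ i $ j = axis i 1 \<bullet> ((transpose V ** C ** V) *v axis j 1)"
      by (simp add: inner_axis' matrix_vector_mult_basis column_def)
    also have "\<dots> = (V *v axis i 1) \<bullet> (C *v (V *v axis j 1))"
      by (metis (no_types, lifting) dot_lmul_matrix matrix_vector_mul_assoc transpose_matrix_vector inner_commute)
    also have "\<dots> = mat 1 $ i $ j" by (simp add: Vx v mat_def)
    finally show "(transpose V ** C ** V) $ i $ j = mat 1 $ i $ j" .
  qed
  then show ?thesis by blast
qed

text \<open>
  With \<open>V\<close> orthonormalizing \<open>C\<close>, the substitution \<open>x = C V z\<close> turns the form of the inverse of \<open>C\<close> into the
  standard one, and the square of the determinant of \<open>C V\<close> is \<open>det C\<close>.
\<close>

lemma nn_integral_gaussian: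
  fixes C :: "real^'n^'n"
  assumes sym: "transpose C = C" and pos: "\<And>x. x \<noteq> 0 \<Longrightarrow> 0 < x \<bullet> (C *v x)"
  shows "det C > 0"
    and "(\<integral>\<^sup>+x. ennreal (exp (- (x \<bullet> (matrix_inv C *v x)) / 2)) \<partial>lborel) = ennreal (sqrt ((2 * pi) ^ CARD('n) * det C))"
proof -
  obtain V :: "real^'n^'n" where V: "transpose V ** C ** V = mat 1"
    using exists_matrix_orthonormalizing[OF assms] by blast
  have "det V * det C * det V = 1" using arg_cong[OF V, of det] by (simp add: det_mul det_transpose)
  then have dV: "det C * (det V)\<^sup>2 = 1" by (simp add: power2_eq_square mult.commute mult.left_commute)
  then have dV0: "det V \<noteq> 0" by auto
  show dC: "det C > 0" using dV dV0 by (metis zero_less_mult_pos2 zero_less_power2 zero_less_one)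
  have VC: "V ** (transpose V ** C) = mat 1"
    using V matrix_left_right_inverse by blast
  have inv: "matrix_inv C ** C = mat 1"
    using dC matrix_inverse[of C] by (auto simp: invertible_det_nz)
  have CV: "transpose V ** (C ** V) = mat 1" using V by (simp add: matrix_mul_assoc)
  have dCV: "\<bar>det (C ** V)\<bar> = sqrt (det C)"
  proof (rule real_sqrt_unique[symmetric])
    show "\<bar>det (C ** V)\<bar>\<^sup>2 = det C"
      using dV by (simp add: det_mul power_mult_distrib) (simp add: power2_eq_square)
  qed simp
  have q: "((C ** V) *v x) \<bullet> (matrix_inv C *v ((C ** V) *v x)) = x \<bullet> x" for x
  proof -
    have "matrix_inv C *v ((C ** V) *v x) = V *v x"
      using inv by (metis matrix_mul_assoc matrix_mul_lid matrix_vector_mul_assoc)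
    then have "((C ** V) *v x) \<bullet> (matrix_inv C *v ((C ** V) *v x)) = (transpose V *v ((C ** V) *v x)) \<bullet> x"
      by (metis dot_lmul_matrix transpose_matrix_vector transpose_transpose)
    then show ?thesis using CV by (metis matrix_vector_mul_assoc matrix_vector_mul_lid)
  qed
  have [measurable]: "(\<lambda>x. A *v x) \<in> borel_measurable borel" for A :: "real^'n^'n"
    by (intro borel_measurable_continuous_onI linear_continuous_on) auto
  have "(\<integral>\<^sup>+x. ennreal (exp (- (x \<bullet> (matrix_inv C *v x)) / 2)) \<partial>lborel)
    = ennreal (sqrt (det C)) * (\<integral>\<^sup>+x. ennreal (exp (- (x \<bullet> x) / 2)) \<partial>(lborel::(real^'n) measure))"
    using lborel_change_of_variables_matrix[of "C ** V" "\<lambda>x. ennreal (exp (- (x \<bullet> (matrix_inv C *v x)) / 2))"] dC dCV dV0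
    by (simp add: q det_mul)
  then show "(\<integral>\<^sup>+x. ennreal (exp (- (x \<bullet> (matrix_inv C *v x)) / 2)) \<partial>lborel) = ennreal (sqrt ((2 * pi) ^ CARD('n) * det C))"
    unfolding nn_integral_standard_gaussian
    using dC by (simp add: ennreal_mult[symmetric] real_sqrt_mult mult.commute)
qed

section \<open>The uniform law on the sphere as an integral over a slab\<close>

lemma nn_integral_lborel_scaleR:
  fixes G :: "'a::euclidean_space \<Rightarrow> ennreal"
  assumes [measurable]: "G \<in> borel_measurable borel" and "r > 0"
  shows "(\<integral>\<^sup>+u. G u \<partial>lborel) = ennreal (r ^ DIM('a)) * (\<integral>\<^sup>+x. G (r *\<^sub>R x) \<partial>lborel)"
  using assms(2) arg_cong[OF lborel_affine[of r "0::'a"], of "\<lambda>M. \<integral>\<^sup>+u. G u \<partial>M"]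
  by (simp add: nn_integral_density nn_integral_distr nn_integral_cmult)

definition slab_integral :: "'a::euclidean_space \<Rightarrow> real \<Rightarrow> real \<Rightarrow> ('a \<Rightarrow> ennreal) \<Rightarrow> ennreal"
  where "slab_integral l \<alpha> \<beta> f = (\<integral>\<^sup>+x. f x * indicator {x. \<alpha> \<le> l \<bullet> x \<and> l \<bullet> x \<le> \<beta>} x * ennreal (1 / norm x ^ DIM('a)) \<partial>lborel)"

text \<open>
  Both sides weigh the directions in the half space equally. Write \<open>1 / norm x ^ n\<close> as the integral of
  \<open>n r\<^sup>n\<^sup>-\<^sup>1\<close> over \<open>0 < r < 1 / norm x\<close>, exchange the integrals and substitute \<open>u = r x\<close>: by homogeneity
  the ball appears, and \<open>r\<close> is left to run over an interval \<open>l \<bullet> u / \<beta> \<le> r \<le> l \<bullet> u / \<alpha>\<close> whose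
  logarithmic length \<open>ln (\<beta> / \<alpha>)\<close> does not depend on \<open>u\<close>.
\<close>

lemma ball_integral_eq_slab_integral:
  fixes l :: "'a::euclidean_space"
  assumes \<alpha>: "0 < \<alpha>" "\<alpha> < \<beta>"
  shows "\<exists>c>0. \<forall>f\<in>borel_measurable borel. (\<forall>r x. r > 0 \<longrightarrow> f (r *\<^sub>R x) = f x) \<longrightarrow> (\<forall>x. l \<bullet> x \<le> 0 \<longrightarrow> f x = 0) \<longrightarrow>
      (\<integral>\<^sup>+x. f x * indicator (ball 0 1) x \<partial>lborel)
       = ennreal c * slab_integral l \<alpha> \<beta> f"
proof -
  have [measurable]: "ball (0::'a) 1 \<in> sets borel" by simp
  define n where "n = DIM('a)"
  have n: "n > 0" by (simp add: n_def)
  define c where "c = 1 / (real n * ln (\<beta> / \<alpha>))"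
  have c: "c > 0" using n \<alpha> by (simp add: c_def ln_gt_zero)
  have main: "(\<integral>\<^sup>+x. f x * indicator {x. \<alpha> \<le> l \<bullet> x \<and> l \<bullet> x \<le> \<beta>} x * ennreal (1 / norm x ^ n) \<partial>lborel)
      = ennreal (1 / c) * (\<integral>\<^sup>+x. f x * indicator (ball 0 1) x \<partial>lborel)"
    if [measurable]: "f \<in> borel_measurable borel" and hom: "\<And>r x. r > 0 \<Longrightarrow> f (r *\<^sub>R x) = f x"
      and l0: "\<And>x. l \<bullet> x \<le> 0 \<Longrightarrow> f x = 0" for f
  proof -
    define G :: "real \<Rightarrow> 'a \<Rightarrow> ennreal"
      where "G = (\<lambda>r u. f u * (if r * \<alpha> \<le> l \<bullet> u \<and> l \<bullet> u \<le> r * \<beta> \<and> norm u < 1 then 1 else 0))"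
    have Gm[measurable]: "(\<lambda>p. G (fst p) (snd p)) \<in> borel_measurable (borel \<Otimes>\<^sub>M borel)"
      unfolding G_def by measurable
    have rad: "(\<integral>\<^sup>+r. ennreal (real n * r ^ (n - 1)) * (if 0 < r \<and> r * norm x < 1 then 1 else 0) \<partial>lborel)
        = ennreal (1 / norm x ^ n)" if "x \<noteq> 0" for x :: 'a
    proof -
      have "(\<integral>\<^sup>+r. ennreal (real n * r ^ (n - 1)) * (if 0 < r \<and> r * norm x < 1 then 1 else 0) \<partial>lborel)
        = (\<integral>\<^sup>+r. ennreal (real n * r ^ (n - 1)) * indicator {0..1 / norm x} r \<partial>lborel)"
        using AE_lborel_singleton[of "1 / norm x"] AE_lborel_singleton[of "0::real"]
        by (intro nn_integral_cong_AE, eventually_elim) (use that in \<open>auto simp: indicator_def field_simps\<close>)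
      also have "\<dots> = ennreal ((1 / norm x) ^ n - 0 ^ n)"
        by (rule nn_integral_FTC_Icc) (auto intro!: derivative_eq_intros)
      finally show ?thesis using n by (simp add: power_divide power_0_left)
    qed
    have log: "(\<integral>\<^sup>+r. ennreal (real n / r) * (if 0 < r \<and> r * \<alpha> \<le> v \<and> v \<le> r * \<beta> then 1 else 0) \<partial>lborel)
        = ennreal (1 / c)" if "v > 0" for v
    proof -
      have "(\<integral>\<^sup>+r. ennreal (real n / r) * (if 0 < r \<and> r * \<alpha> \<le> v \<and> v \<le> r * \<beta> then 1 else 0) \<partial>lborel)
        = (\<integral>\<^sup>+r. ennreal (real n / r) * indicator {v / \<beta>..v / \<alpha>} r \<partial>lborel)"
      proof (rule nn_integral_cong)
        fix r :: real
        have "(0 < r \<and> r * \<alpha> \<le> v \<and> v \<le> r * \<beta>) \<longleftrightarrow> (v / \<beta> \<le> r \<and> r \<le> v / \<alpha>)"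
        proof (cases "r > 0")
          case True
          then show ?thesis using \<alpha> by (auto simp: pos_divide_le_eq pos_le_divide_eq)
        next
          case False
          moreover have "0 < v / \<beta>" using \<alpha> that by simp
          ultimately show ?thesis by linarith
        qed
        then show "ennreal (real n / r) * (if 0 < r \<and> r * \<alpha> \<le> v \<and> v \<le> r * \<beta> then 1 else 0)
          = ennreal (real n / r) * indicator {v / \<beta>..v / \<alpha>} r"
          by (auto simp: indicator_def)
      qed
      also have "\<dots> = ennreal (real n * ln (v / \<alpha>) - real n * ln (v / \<beta>))"
      proof (rule nn_integral_FTC_Icc)
        show "v / \<beta> \<le> v / \<alpha>" using \<alpha> that by (intro divide_left_mono) auto
        fix r assume "r \<in> {v / \<beta>..v / \<alpha>}"
        moreover have "0 < v / \<beta>" using \<alpha> that by simp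
        ultimately have "r > 0" by simp
        then show "((\<lambda>a. real n * ln a) has_real_derivative real n / r) (at r)" "0 \<le> real n / r"
          by (auto intro!: derivative_eq_intros)
      qed auto
      also have "real n * ln (v / \<alpha>) - real n * ln (v / \<beta>) = 1 / c"
        using \<alpha> that by (simp add: c_def ln_div right_diff_distrib)
      finally show ?thesis .
    qed
    have "(\<integral>\<^sup>+x. f x * indicator {x. \<alpha> \<le> l \<bullet> x \<and> l \<bullet> x \<le> \<beta>} x * ennreal (1 / norm x ^ n) \<partial>lborel)
      = (\<integral>\<^sup>+x. (\<integral>\<^sup>+r. ennreal (real n * r ^ (n - 1)) * (if 0 < r \<and> r * norm x < 1 then 1 else 0)
           * (f x * indicator {x. \<alpha> \<le> l \<bullet> x \<and> l \<bullet> x \<le> \<beta>} x) \<partial>lborel) \<partial>lborel)"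
    proof (rule nn_integral_cong)
      fix x :: 'a
      show "f x * indicator {x. \<alpha> \<le> l \<bullet> x \<and> l \<bullet> x \<le> \<beta>} x * ennreal (1 / norm x ^ n) =
        (\<integral>\<^sup>+r. ennreal (real n * r ^ (n - 1)) * (if 0 < r \<and> r * norm x < 1 then 1 else 0)
           * (f x * indicator {x. \<alpha> \<le> l \<bullet> x \<and> l \<bullet> x \<le> \<beta>} x) \<partial>lborel)"
        using l0[of x] rad[of x] by (cases "x = 0"; subst nn_integral_multc) (simp_all add: mult.commute)
    qed
    also have "\<dots> = (\<integral>\<^sup>+r. (\<integral>\<^sup>+x. ennreal (real n * r ^ (n - 1)) * (if 0 < r \<and> r * norm x < 1 then 1 else 0)
           * (f x * indicator {x. \<alpha> \<le> l \<bullet> x \<and> l \<bullet> x \<le> \<beta>} x) \<partial>lborel) \<partial>lborel)"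
      by (rule lborel_pair.Fubini'[symmetric]) (simp add: split_beta')
    also have "\<dots> = (\<integral>\<^sup>+r. (\<integral>\<^sup>+u. ennreal (real n / r) * (if 0 < r then 1 else 0) * G r u \<partial>lborel) \<partial>lborel)"
    proof (rule nn_integral_cong)
      fix r :: real
      show "(\<integral>\<^sup>+x. ennreal (real n * r ^ (n - 1)) * (if 0 < r \<and> r * norm x < 1 then 1 else 0)
           * (f x * indicator {x. \<alpha> \<le> l \<bullet> x \<and> l \<bullet> x \<le> \<beta>} x) \<partial>lborel)
         = (\<integral>\<^sup>+u. ennreal (real n / r) * (if 0 < r then 1 else 0) * G r u \<partial>lborel)"
      proof (cases "r > 0")
        case True
        have [measurable]: "G r \<in> borel_measurable borel" unfolding G_def by measurable
        have "(\<integral>\<^sup>+u. ennreal (real n / r) * (if 0 < r then 1 else 0) * G r u \<partial>lborel)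
            = ennreal (real n / r) * (ennreal (r ^ n) * (\<integral>\<^sup>+x. G r (r *\<^sub>R x) \<partial>lborel))"
          using True nn_integral_lborel_scaleR[of "G r" r] by (simp add: nn_integral_cmult n_def)
        also have "\<dots> = ennreal (real n * r ^ (n - 1)) * (\<integral>\<^sup>+x. G r (r *\<^sub>R x) \<partial>lborel)"
        proof -
          have "real n / r * r ^ n = real n * r ^ (n - 1)"
            using True n by (cases n) auto
          then show ?thesis using True by (simp add: mult.assoc[symmetric] ennreal_mult[symmetric])
        qed
        also have "(\<integral>\<^sup>+x. G r (r *\<^sub>R x) \<partial>lborel) = (\<integral>\<^sup>+x. (if r * norm x < 1 then 1 else 0)
           * (f x * indicator {x. \<alpha> \<le> l \<bullet> x \<and> l \<bullet> x \<le> \<beta>} x) \<partial>lborel)"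
          using True by (intro nn_integral_cong) (auto simp: G_def hom indicator_def)
        also have "ennreal (real n * r ^ (n - 1)) * \<dots> = (\<integral>\<^sup>+x. ennreal (real n * r ^ (n - 1)) * (if 0 < r \<and> r * norm x < 1 then 1 else 0)
           * (f x * indicator {x. \<alpha> \<le> l \<bullet> x \<and> l \<bullet> x \<le> \<beta>} x) \<partial>lborel)"
          using True by (subst nn_integral_cmult[symmetric]) (simp_all add: mult.assoc)
        finally show ?thesis ..
      qed simp
    qed
    also have "\<dots> = (\<integral>\<^sup>+u. (\<integral>\<^sup>+r. ennreal (real n / r) * (if 0 < r then 1 else 0) * G r u \<partial>lborel) \<partial>lborel)"
      unfolding G_def by (rule lborel_pair.Fubini') (simp add: split_beta')
    also have "\<dots> = (\<integral>\<^sup>+u. ennreal (1 / c) * (f u * indicator (ball 0 1) u) \<partial>lborel)"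
    proof (rule nn_integral_cong)
      fix u :: 'a
      have "(\<integral>\<^sup>+r. ennreal (real n / r) * (if 0 < r then 1 else 0) * G r u \<partial>lborel)
        = (\<integral>\<^sup>+r. ennreal (real n / r) * (if 0 < r \<and> r * \<alpha> \<le> l \<bullet> u \<and> l \<bullet> u \<le> r * \<beta> then 1 else 0) * (f u * indicator (ball 0 1) u) \<partial>lborel)"
        by (intro nn_integral_cong) (auto simp: G_def indicator_def)
      then show "(\<integral>\<^sup>+r. ennreal (real n / r) * (if 0 < r then 1 else 0) * G r u \<partial>lborel)
        = ennreal (1 / c) * (f u * indicator (ball 0 1) u)"
        using l0[of u] log[of "l \<bullet> u"] by (cases "l \<bullet> u > 0") (simp_all add: nn_integral_multc)
    qed
    also have "\<dots> = ennreal (1 / c) * (\<integral>\<^sup>+u. f u * indicator (ball 0 1) u \<partial>lborel)"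
      by (rule nn_integral_cmult) measurable
    finally show ?thesis .
  qed
  have "ennreal c * (ennreal (1 / c) * y) = y" for y
    using c by (simp add: mult.assoc[symmetric] ennreal_mult[symmetric])
  then show ?thesis using c main unfolding n_def slab_integral_def by (intro exI[of _ c]) simp
qed

text \<open>
  The slab avoids the origin and is not tied to the unit sphere, so it can be chosen to fit the
  rescaling of the directions that matter.
\<close>

lemma uniform_sphere_slab:
  fixes l :: "'a::euclidean_space"
  assumes \<alpha>: "0 < \<alpha>" "\<alpha> < \<beta>"
  shows "\<exists>c>0. \<forall>f\<in>borel_measurable borel. (\<forall>x. l \<bullet> x \<le> 0 \<longrightarrow> f x = 0) \<longrightarrow>
      (\<integral>\<^sup>+x. f x \<partial>uniform_sphere)
       = ennreal c * slab_integral l \<alpha> \<beta> (\<lambda>x. f (x /\<^sub>R norm x))"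
proof -
  obtain c where c0: "c > 0" and c1: "\<forall>f\<in>borel_measurable borel. (\<forall>r x. r > 0 \<longrightarrow> f (r *\<^sub>R x) = f x) \<longrightarrow> (\<forall>x. l \<bullet> x \<le> 0 \<longrightarrow> f x = 0) \<longrightarrow>
      (\<integral>\<^sup>+x. f x * indicator (ball 0 1) x \<partial>lborel)
       = ennreal c * slab_integral l \<alpha> \<beta> f"
    using ball_integral_eq_slab_integral[OF \<alpha>, of l] by (elim exE conjE) (rule that)
  define v where "v = unit_ball_vol (real DIM('a))"
  have v: "v > 0" "emeasure lborel (ball (0::'a) 1) = ennreal v"
    by (simp_all add: v_def emeasure_ball)
  have "(\<integral>\<^sup>+x. f x \<partial>uniform_sphere)
       = ennreal (c / v) * slab_integral l \<alpha> \<beta> (\<lambda>x. f (x /\<^sub>R norm x))"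
    if [measurable]: "f\<in>borel_measurable borel" and f: "\<And>x. l \<bullet> x \<le> 0 \<Longrightarrow> f x = 0" for f
  proof -
    have "(\<integral>\<^sup>+x. f x \<partial>uniform_sphere) = (\<integral>\<^sup>+x. f (x /\<^sub>R norm x) * indicator (ball 0 1) x \<partial>lborel) / ennreal v"
      unfolding uniform_sphere_def
      by (subst nn_integral_distr) (simp_all add: nn_integral_uniform_measure v)
    also have "(\<integral>\<^sup>+x. f (x /\<^sub>R norm x) * indicator (ball 0 1) x \<partial>lborel) =
      ennreal c * slab_integral l \<alpha> \<beta> (\<lambda>x. f (x /\<^sub>R norm x))"
    proof (rule c1[rule_format])
      fix r :: real and x :: 'a assume r: "r > 0"
      then have "(r *\<^sub>R x) /\<^sub>R norm (r *\<^sub>R x) = x /\<^sub>R norm x" by simp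
      then show "f ((r *\<^sub>R x) /\<^sub>R norm (r *\<^sub>R x)) = f (x /\<^sub>R norm x)" by (rule arg_cong)
    next
      fix x assume "l \<bullet> x \<le> 0"
      then show "f (x /\<^sub>R norm x) = 0"
        by (intro f) (simp add: mult_nonneg_nonpos)
    qed auto
    also have "ennreal c * z / ennreal v = ennreal (c / v) * z" for z
      using v(1) c0 by (simp add: divide_ennreal[symmetric] divide_ennreal_def ac_simps)
    finally show ?thesis .
  qed
  then show ?thesis using c0 v(1) by (intro exI[of _ "c / v"]) auto
qed

section \<open>The excess of a radius with a Kotz tail\<close>

abbreviation "std_exponential \<equiv> density lborel (\<lambda>x. ennreal (exponential_density 1 x))"

lemma nn_integral_std_exponential:
  assumes [measurable]: "f \<in> borel_measurable borel"
  shows "(\<integral>\<^sup>+x. f x \<partial>std_exponential) = (\<integral>\<^sup>+x. ennreal (exp (- x)) * indicator {0..} x * f x \<partial>lborel)"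
  by (subst nn_integral_density) (auto simp: exponential_density_def intro!: nn_integral_cong split: split_indicator)

lemma AE_std_exponential_pos: "AE x in std_exponential. x > 0"
  using AE_lborel_singleton[of "0::real"]
  by (subst AE_density) (auto simp: exponential_density_def elim!: eventually_mono)

text \<open>
  The quantile transform, run on an exponential instead of a uniform variable: the limit law of the
  excess is exponential, so that the limit of the transforms is the identity.
\<close>

lemma real_distribution_quantile_exponential:
  assumes "real_distribution D"
  shows "\<exists>Q\<in>borel_measurable borel. distr std_exponential borel Q = D \<and>
    (\<forall>x>0. \<forall>y. 1 - exp (- x) \<le> cdf D y \<longleftrightarrow> Q x \<le> y)"
proof -
  interpret D: real_distribution D by fact
  interpret D: cdf_distribution D ..
  interpret E: prob_space std_exponential
    by (rule prob_space_exponential_density) simp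
  define I where "I \<omega> = Inf {y. \<omega> \<le> cdf D y}" for \<omega>
  have I: "\<omega> \<le> cdf D y \<longleftrightarrow> I \<omega> \<le> y" if "0 < \<omega>" "\<omega> < 1" for \<omega> y
    unfolding I_def by (rule D.pseudoinverse) (use that in auto)
  define Q where "Q x = (if x > 0 then I (1 - exp (- x)) else 0)" for x
  have Q: "1 - exp (- x) \<le> cdf D y \<longleftrightarrow> Q x \<le> y" if "x > 0" for x y
    using that I[of "1 - exp (-x)" y] by (simp add: Q_def)
  have Qm[measurable]: "Q \<in> borel_measurable borel"
  proof -
    have "mono_on {0<..} Q"
    proof (rule mono_onI)
      fix x y :: real assume xy: "x \<in> {0<..}" "y \<in> {0<..}" "x \<le> y"
      have "1 - exp (- y) \<le> cdf D (Q y)" using Q[of y "Q y"] xy by simp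
      moreover have "1 - exp (- x) \<le> 1 - exp (- y)" using xy by simp
      ultimately have "1 - exp (- x) \<le> cdf D (Q y)" by linarith
      then show "Q x \<le> Q y" using Q[of x "Q y"] xy by simp
    qed
    then have "Q \<in> borel_measurable (restrict_space borel {0<..})"
      by (rule borel_measurable_mono_on_fnc)
    then have "(\<lambda>x. if x \<in> {0<..} then Q x else 0) \<in> borel_measurable borel"
      by (subst (asm) measurable_restrict_space_iff[where c=0]) auto
    then show ?thesis by (rule measurable_cong[THEN iffD1, rotated]) (auto simp: Q_def)
  qed
  have "distr std_exponential borel Q = D"
  proof (rule cdf_unique)
    show "real_distribution (distr std_exponential borel Q)"
      by (intro E.real_distribution_distr) simp
    show "cdf (distr std_exponential borel Q) = cdf D"
    proof
      fix y
      have "emeasure std_exponential (Q -` {..y}) = emeasure std_exponential {x. 1 - exp (- x) \<le> cdf D y}"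
      proof (rule emeasure_eq_AE)
        show "AE x in std_exponential. (x \<in> Q -` {..y}) = (x \<in> {x. 1 - exp (- x) \<le> cdf D y})"
          using AE_std_exponential_pos by eventually_elim (simp add: Q)
        have "Q -` {..y} \<inter> space borel \<in> sets borel" by (rule measurable_sets[OF Qm]) simp
        then show "Q -` {..y} \<in> sets std_exponential" by simp
      qed simp
      also have "\<dots> = ennreal (cdf D y)"
      proof (cases "cdf D y < 1")
        case True
        have "1 - exp (- x) \<le> cdf D y \<longleftrightarrow> x \<le> - ln (1 - cdf D y)" for x
        proof -
          have "1 - exp (- x) \<le> cdf D y \<longleftrightarrow> 1 - cdf D y \<le> exp (- x)" by auto
          also have "\<dots> \<longleftrightarrow> ln (1 - cdf D y) \<le> - x" using True by (subst ln_le_cancel_iff[symmetric]) auto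
          finally show ?thesis by auto
        qed
        then have "{x. 1 - exp (- x) \<le> cdf D y} = {.. - ln (1 - cdf D y)}" by auto
        moreover have "0 \<le> - ln (1 - cdf D y)" using True D.cdf_nonneg[of y] by simp
        ultimately show ?thesis using True
          by (simp add: emeasure_erlang_density erlang_CDF_0)
      next
        case False
        then have "cdf D y = 1" using D.cdf_bounded_prob[of y] by simp
        then show ?thesis using E.emeasure_space_1 by simp
      qed
      finally have "emeasure (distr std_exponential borel Q) {..y} = ennreal (cdf D y)"
        by (subst emeasure_distr) auto
      then show "cdf (distr std_exponential borel Q) y = cdf D y"
        using D.cdf_nonneg[of y] by (simp add: cdf_def measure_def)
    qed
  qed fact
  then show ?thesis using Q by (intro bexI[of _ Q]) auto
qed

text \<open>
  Given \<open>r > s\<close>, the excess \<open>lam * (r / s - 1)\<close> has the law of \<open>Q\<close> under the standard exponential law.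
\<close>

definition excess_coupling :: "real measure \<Rightarrow> real \<Rightarrow> real \<Rightarrow> (real \<Rightarrow> real) \<Rightarrow> bool"
  where "excess_coupling D s lam Q \<longleftrightarrow>
    (\<forall>\<Phi>\<in>borel_measurable borel. (\<integral>\<^sup>+r. \<Phi> r * indicator {s<..} r \<partial>D)
      = ennreal (measure D {s<..}) * (\<integral>\<^sup>+x. \<Phi> (s * (1 + Q x / lam)) \<partial>std_exponential))"

text \<open>
  \<open>Q\<close> is the exponential quantile transform of the law of \<open>lam * (r / s - 1)\<close> given \<open>r > s\<close>.
  The equivalence turns tail estimates into bounds for \<open>Q\<close>.
\<close>

lemma excess_quantile:
  assumes D: "real_distribution D" and s: "s > 0" and lam: "lam > 0" and pos: "measure D {s<..} > 0"
  shows "\<exists>Q\<in>borel_measurable borel.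
     excess_coupling D s lam Q \<and>
     (\<forall>x>0. 0 \<le> Q x) \<and>
     (\<forall>x>0. \<forall>y\<ge>0. measure D {s * (1 + y / lam)<..} / measure D {s<..} \<le> exp (- x) \<longleftrightarrow> Q x \<le> y)"
proof -
  interpret D: real_distribution D by fact
  define \<mu> where "\<mu> = distr (uniform_measure D {s<..}) borel (\<lambda>r. lam * (r / s - 1))"
  interpret U: prob_space "uniform_measure D {s<..}"
    using pos by (intro prob_space_uniform_measure) (auto simp: D.emeasure_eq_measure)
  have real_\<mu>: "real_distribution \<mu>"
    unfolding \<mu>_def by (intro U.real_distribution_distr) simp
  interpret \<mu>: real_distribution \<mu> by fact
  obtain Q where Qm[measurable]: "Q \<in> borel_measurable borel" and dQ: "distr std_exponential borel Q = \<mu>"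
    and Q: "\<And>x y. x > 0 \<Longrightarrow> 1 - exp (- x) \<le> cdf \<mu> y \<longleftrightarrow> Q x \<le> y"
    using real_distribution_quantile_exponential[OF real_\<mu>] by blast
  have pre: "lam * (r / s - 1) \<le> y \<longleftrightarrow> r \<le> s * (1 + y / lam)" for r y
    using s lam by (simp add: field_simps)
  have cdf: "cdf \<mu> y = measure D ({s<..} \<inter> {..s * (1 + y / lam)}) / measure D {s<..}" for y
  proof -
    have "(\<lambda>r. lam * (r / s - 1)) -` {..y} = {..s * (1 + y / lam)}" by (auto simp: pre)
    then show ?thesis
      using pos unfolding cdf_def \<mu>_def
      by (subst measure_distr) (auto simp: measure_uniform_measure D.emeasure_eq_measure)
  qed
  have cdf_neg: "cdf \<mu> y = 0" if "y < 0" for y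
  proof -
    have "s * (1 + y / lam) < s" using that s lam by (simp add: field_simps mult_pos_neg)
    then have "{s<..} \<inter> {..s * (1 + y / lam)} = {}" by auto
    then show ?thesis by (simp add: cdf)
  qed
  have cdf_pos: "cdf \<mu> y = 1 - measure D {s * (1 + y / lam)<..} / measure D {s<..}" if "y \<ge> 0" for y
  proof -
    have "s \<le> s * (1 + y / lam)" using that s lam by simp
    then have "{s<..} \<inter> {..s * (1 + y / lam)} = {s<..} - {s * (1 + y / lam)<..}" "{s * (1 + y / lam)<..} \<subseteq> {s<..}" by auto
    then have "measure D ({s<..} \<inter> {..s * (1 + y / lam)}) = measure D {s<..} - measure D {s * (1 + y / lam)<..}"
      by (simp add: D.finite_measure_Diff)
    then show ?thesis using pos by (simp add: cdf diff_divide_distrib)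
  qed
  have 1: "(\<integral>\<^sup>+r. \<Phi> r * indicator {s<..} r \<partial>D)
        = ennreal (measure D {s<..}) * (\<integral>\<^sup>+x. \<Phi> (s * (1 + Q x / lam)) \<partial>std_exponential)"
    if [measurable]: "\<Phi> \<in> borel_measurable borel" for \<Phi>
  proof -
    have "(\<integral>\<^sup>+x. \<Phi> (s * (1 + Q x / lam)) \<partial>std_exponential) = (\<integral>\<^sup>+y. \<Phi> (s * (1 + y / lam)) \<partial>\<mu>)"
      unfolding dQ[symmetric] by (subst nn_integral_distr) auto
    also have "\<dots> = (\<integral>\<^sup>+r. \<Phi> r \<partial>(uniform_measure D {s<..}))"
    proof -
      have "s * (1 + (lam * (r / s - 1)) / lam) = r" for r using s lam by (simp add: field_simps)
      then show ?thesis unfolding \<mu>_def by (subst nn_integral_distr) auto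
    qed
    also have "\<dots> = (\<integral>\<^sup>+r. \<Phi> r * indicator {s<..} r \<partial>D) / ennreal (measure D {s<..})"
      by (subst nn_integral_uniform_measure) (auto simp: D.emeasure_eq_measure)
    finally show ?thesis using pos
      by (simp add: ennreal_times_divide mult.commute[of "ennreal (measure D {s<..})"] ennreal_mult_divide_eq)
  qed
  have 2: "0 \<le> Q x" if "x > 0" for x
  proof (rule ccontr)
    assume "\<not> 0 \<le> Q x"
    then have "cdf \<mu> (Q x) = 0" by (intro cdf_neg) simp
    with Q[OF that, of "Q x"] that show False by simp
  qed
  have 3: "measure D {s * (1 + y / lam)<..} / measure D {s<..} \<le> exp (- x) \<longleftrightarrow> Q x \<le> y" if "x > 0" "y \<ge> 0" for x y
    using Q[OF that(1), of y] cdf_pos[OF that(2)] by auto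
  show ?thesis using 1 2 3 unfolding excess_coupling_def by (intro bexI[of _ Q]) auto
qed

lemma kotz_tail_ratio_eq:
  fixes \<delta> q N s u :: real
  assumes "s > 0" "u > 0"
  shows "((s * u) powr N * exp (- q * (s * u) powr \<delta>)) / (s powr N * exp (- q * s powr \<delta>))
       = u powr N * exp (- (q * s powr \<delta> * (u powr \<delta> - 1)))"
proof -
  have "exp (- q * (s * u) powr \<delta>) / exp (- q * s powr \<delta>) = exp (- (q * s powr \<delta> * (u powr \<delta> - 1)))"
    using assms by (simp add: exp_diff[symmetric] powr_mult algebra_simps)
  moreover have "(s * u) powr N / s powr N = u powr N"
    using assms by (simp add: powr_mult)
  ultimately show ?thesis by (metis times_divide_times_eq)
qed

text \<open>
  With \<open>u = 1 + y / lam\<close>, the inequality \<open>u powr \<delta> \<ge> 1 + \<delta> ln u\<close> bounds the ratio by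
  \<open>u powr (N - lam)\<close>, hence by \<open>u powr (- lam / 2)\<close>. Since \<open>(1 + y / lam) powr lam\<close> increases with
  \<open>lam\<close>, replacing \<open>lam\<close> by \<open>2 m\<close> gives a bound that does not depend on \<open>s\<close>.
\<close>

lemma kotz_tail_ratio_le:
  fixes \<delta> q N :: real and m :: nat
  assumes "\<delta> > 0" "q > 0" "s > 0" "y \<ge> 0" "m \<ge> 1"
    and lam: "lam = q * \<delta> * s powr \<delta>" "lam \<ge> 2 * \<bar>N\<bar>" "lam \<ge> 2 * real m"
  shows "((s * (1 + y / lam)) powr N * exp (- q * (s * (1 + y / lam)) powr \<delta>)) / (s powr N * exp (- q * s powr \<delta>))
       \<le> (1 + y / (2 * real m)) powr (- real m)"
proof -
  have l0: "lam > 0" using assms by simp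
  define u where "u = 1 + y / lam"
  have u: "u \<ge> 1" using l0 assms by (simp add: u_def)
  have "((s * u) powr N * exp (- q * (s * u) powr \<delta>)) / (s powr N * exp (- q * s powr \<delta>))
      = u powr N * exp (- (lam / \<delta>) * (u powr \<delta> - 1))"
    using assms u kotz_tail_ratio_eq[of s u N q \<delta>] by (simp add: lam(1))
  also have "\<dots> \<le> u powr N * u powr (- lam)"
  proof -
    have "1 + \<delta> * ln u \<le> u powr \<delta>" using u by (simp add: powr_def exp_ge_add_one_self)
    then have "lam * ln u \<le> (lam / \<delta>) * (u powr \<delta> - 1)"
      using l0 assms mult_left_mono[of "\<delta> * ln u" "u powr \<delta> - 1" "lam / \<delta>"] by simp
    then have "exp (- (lam / \<delta>) * (u powr \<delta> - 1)) \<le> u powr (- lam)"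
      using u by (simp add: powr_def)
    then show ?thesis using u by (intro mult_left_mono) auto
  qed
  also have "\<dots> = u powr (N - lam)" by (simp add: powr_add[symmetric])
  also have "\<dots> \<le> u powr (- (lam / 2))"
    using lam(2) u by (intro powr_mono) auto
  also have "\<dots> = (u powr (lam / (2 * real m))) powr (- real m)"
    using assms(5) by (simp add: powr_powr)
  also have "\<dots> \<le> (1 + y / (2 * real m)) powr (- real m)"
  proof (rule powr_mono2')
    define \<theta> where "\<theta> = 2 * real m / lam"
    have th: "0 < \<theta>" "\<theta> \<le> 1" using lam(3) l0 assms(5) by (auto simp: \<theta>_def field_simps)
    have pos: "0 < 1 + y / (2 * real m)" using assms by (simp add: add_pos_nonneg)
    \<comment> \<open>Bernoulli's inequality with exponent \<open>\<theta>\<close>, as weighted arithmetic and geometric means\<close>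
    have "(1 + y / (2 * real m)) powr \<theta> * 1 powr (1 - \<theta>) \<le> \<theta> * (1 + y / (2 * real m)) + (1 - \<theta>) * 1"
      using th pos by (intro Youngs_inequality_0) auto
    also have "\<dots> = u" using assms(5) l0 by (simp add: \<theta>_def u_def field_simps)
    finally have "((1 + y / (2 * real m)) powr \<theta>) powr (1 / \<theta>) \<le> u powr (1 / \<theta>)"
      using th by (intro powr_mono2) auto
    then show "1 + y / (2 * real m) \<le> u powr (lam / (2 * real m))"
      using th pos by (simp add: powr_powr) (simp add: \<theta>_def)
    show "0 < 1 + y / (2 * real m)" by (rule pos)
  qed simp
  finally show ?thesis by (simp add: u_def)
qed

text \<open>
  The scale \<open>lam = q \<delta> s powr \<delta>\<close> is the one for which \<open>(lam / \<delta>) ((1 + y / lam) powr \<delta> - 1)\<close> tends to \<open>y\<close>;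
  the power factor tends to \<open>1\<close>.
\<close>

lemma kotz_tail_ratio_tendsto:
  fixes T :: "real \<Rightarrow> real" and \<delta> q p N y :: real and s :: "nat \<Rightarrow> real"
  assumes "\<delta> > 0" "q > 0" "p > 0" "y \<ge> 0" and s: "filterlim s at_top sequentially"
    and T: "((\<lambda>u. T u / (p * u powr N * exp (- q * u powr \<delta>))) \<longlongrightarrow> 1) at_top"
  shows "(\<lambda>n. T (s n * (1 + y / (q * \<delta> * s n powr \<delta>))) / T (s n)) \<longlonglongrightarrow> exp (- y)"
proof -
  define W where "W u = p * u powr N * exp (- q * u powr \<delta>)" for u
  have T': "((\<lambda>u. T u / W u) \<longlongrightarrow> 1) at_top" using T by (simp add: W_def)
  define lam where "lam n = q * \<delta> * s n powr \<delta>" for n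
  have lamlim: "filterlim lam at_top sequentially"
  proof -
    have "filterlim (\<lambda>u. q * \<delta> * u powr \<delta>) at_top at_top" using assms by real_asymp
    from filterlim_compose[OF this s] show ?thesis by (simp add: lam_def[abs_def])
  qed
  define v where "v n = 1 + y / lam n" for n
  have v1: "v \<longlonglongrightarrow> 1"
  proof -
    have "(\<lambda>n. 1 + y / lam n) \<longlonglongrightarrow> 1 + 0"
      by (rule tendsto_add[OF tendsto_const real_tendsto_divide_at_top[OF tendsto_const lamlim]])
    then show ?thesis by (simp add: v_def[abs_def])
  qed
  have ev: "eventually (\<lambda>n. s n > 0 \<and> lam n > 0 \<and> T (s n) / W (s n) > 0) sequentially"
  proof -
    have "eventually (\<lambda>u. T u / W u > 0) at_top" using order_tendstoD(1)[OF T', of 0] by simp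
    then have "eventually (\<lambda>n. T (s n) / W (s n) > 0) sequentially"
      by (rule eventually_compose_filterlim[OF _ s])
    moreover have "eventually (\<lambda>n. s n > 0) sequentially" "eventually (\<lambda>n. lam n > 0) sequentially"
      using s lamlim by (auto simp: filterlim_at_top_dense)
    ultimately show ?thesis by eventually_elim auto
  qed
  have sv: "filterlim (\<lambda>n. s n * v n) at_top sequentially"
    using filterlim_tendsto_pos_mult_at_top[OF v1 _ s] by (simp add: mult.commute)
  have A: "(\<lambda>n. T (s n * v n) / W (s n * v n)) \<longlonglongrightarrow> 1" by (rule filterlim_compose[OF T' sv])
  have B: "(\<lambda>n. T (s n) / W (s n)) \<longlonglongrightarrow> 1" by (rule filterlim_compose[OF T' s])
  have C: "(\<lambda>n. W (s n * v n) / W (s n)) \<longlonglongrightarrow> exp (- y)"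
  proof -
    have "((\<lambda>l. (l / \<delta>) * ((1 + y / l) powr \<delta> - 1)) \<longlongrightarrow> y) at_top"
      using \<open>\<delta> > 0\<close> by real_asymp
    from filterlim_compose[OF this lamlim]
    have "(\<lambda>n. (lam n / \<delta>) * (v n powr \<delta> - 1)) \<longlonglongrightarrow> y" by (simp add: v_def)
    then have "(\<lambda>n. v n powr N * exp (- ((lam n / \<delta>) * (v n powr \<delta> - 1)))) \<longlonglongrightarrow> 1 powr N * exp (- y)"
      by (intro tendsto_intros v1) auto
    then have lim: "(\<lambda>n. v n powr N * exp (- ((lam n / \<delta>) * (v n powr \<delta> - 1)))) \<longlonglongrightarrow> exp (- y)" by simp
    show ?thesis
    proof (rule Lim_transform_eventually[OF lim], use ev in eventually_elim)
      case (elim n)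
      have "v n > 0" using elim assms by (simp add: v_def add_pos_nonneg)
      then show ?case
        using elim assms kotz_tail_ratio_eq[of "s n" "v n" N q \<delta>] by (simp add: W_def lam_def mult.assoc)
    qed
  qed
  have "(\<lambda>n. (T (s n * v n) / W (s n * v n)) * (W (s n * v n) / W (s n)) / (T (s n) / W (s n))) \<longlonglongrightarrow> 1 * exp (- y) / 1"
    by (intro tendsto_intros A B C) auto
  then have "(\<lambda>n. (T (s n * v n) / W (s n * v n)) * (W (s n * v n) / W (s n)) / (T (s n) / W (s n))) \<longlonglongrightarrow> exp (- y)" by simp
  moreover have "eventually (\<lambda>n. (T (s n * v n) / W (s n * v n)) * (W (s n * v n) / W (s n)) / (T (s n) / W (s n)) = T (s n * v n) / T (s n)) sequentially"
    using ev
  proof eventually_elim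
    case (elim n)
    have "v n > 0" using elim assms by (simp add: v_def add_pos_nonneg)
    then have "W (s n * v n) \<noteq> 0" "W (s n) \<noteq> 0" using elim assms by (auto simp: W_def)
    then show ?case using elim by (simp add: field_simps)
  qed
  ultimately have "(\<lambda>n. T (s n * v n) / T (s n)) \<longlonglongrightarrow> exp (- y)"
    by (rule Lim_transform_eventually)
  then show ?thesis by (simp add: v_def lam_def)
qed

text \<open>
  All excesses are realised on the same exponential variable, where they converge pointwise and have
  a common bound. This replaces convergence in law and convergence of moments by a single dominated
  convergence; the parameter \<open>m\<close> is chosen later according to the number of moments required.
\<close>

lemma kotz_excess_coupling:
  fixes D :: "real measure" and \<delta> q p N :: real and s :: "nat \<Rightarrow> real" and m :: nat
  assumes D: "real_distribution D" and par: "\<delta> > 0" "q > 0" "p > 0" and m: "m \<ge> 1"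
    and s: "filterlim s at_top sequentially"
    and T: "(\<lambda>u. measure D {u<..}) \<sim>[at_top] (\<lambda>u. p * u powr N * exp (- q * u powr \<delta>))"
  defines "lam n \<equiv> q * \<delta> * s n powr \<delta>"
  shows "\<exists>Q. (\<forall>n. Q n \<in> borel_measurable borel) \<and>
     eventually (\<lambda>n. excess_coupling D (s n) (lam n) (Q n)) sequentially \<and>
     eventually (\<lambda>n. measure D {s n<..} > 0 \<and> (\<forall>x>0. 0 \<le> Q n x \<and> Q n x \<le> 8 * real m * exp (x / real m))) sequentially \<and>
     (\<forall>x>0. (\<lambda>n. Q n x) \<longlonglongrightarrow> x)"
proof -
  interpret D: real_distribution D by fact
  define W where "W u = p * u powr N * exp (- q * u powr \<delta>)" for u
  define T where "T u = measure D {u<..}" for u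
  have T1: "((\<lambda>u. T u / W u) \<longlongrightarrow> 1) at_top"
  proof -
    have "((\<lambda>u. if T u = 0 \<and> W u = 0 then 1 else T u / W u) \<longlongrightarrow> 1) at_top"
      using T unfolding asymp_equiv_def T_def W_def .
    then show ?thesis
    proof (rule Lim_transform_eventually)
      show "eventually (\<lambda>u. (if T u = 0 \<and> W u = 0 then 1 else T u / W u) = T u / W u) at_top"
        using eventually_gt_at_top[of 0] by eventually_elim (use par in \<open>auto simp: W_def\<close>)
    qed
  qed
  have lamlim: "filterlim lam at_top sequentially"
  proof -
    have "filterlim (\<lambda>u. q * \<delta> * u powr \<delta>) at_top at_top" using par by real_asymp
    from filterlim_compose[OF this s] show ?thesis by (simp add: lam_def[abs_def])
  qed
  obtain u0 where u0: "u0 > 0" "\<And>u. u \<ge> u0 \<Longrightarrow> W u / 2 \<le> T u \<and> T u \<le> 2 * W u"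
  proof -
    have "eventually (\<lambda>u. T u / W u > 1/2 \<and> T u / W u < 2 \<and> u > 0) at_top"
      using order_tendstoD(1)[OF T1, of "1/2"] order_tendstoD(2)[OF T1, of 2] eventually_gt_at_top[of 0]
      by (intro eventually_conj) auto
    then obtain u1 where u1: "\<And>u. u \<ge> u1 \<Longrightarrow> T u / W u > 1/2 \<and> T u / W u < 2 \<and> u > 0"
      by (auto simp: eventually_at_top_linorder)
    show ?thesis
    proof (rule that[of "max u1 1"])
      fix u assume "max u1 1 \<le> u"
      then have *: "T u / W u > 1/2" "T u / W u < 2" "u > 0" using u1[of u] by auto
      then have "W u > 0" using par by (simp add: W_def)
      with * show "W u / 2 \<le> T u \<and> T u \<le> 2 * W u" by (simp add: field_simps)
    qed simp
  qed
  have Wpos: "W u > 0" if "u > 0" for u using that par by (simp add: W_def)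
  \<comment> \<open>the indices from which on the tail is within a factor \<open>2\<close> of its asymptotic form and
    \<open>kotz_tail_ratio_le\<close> applies\<close>
  define good where "good n \<longleftrightarrow> s n \<ge> u0 \<and> lam n \<ge> 2 * \<bar>N\<bar> \<and> lam n \<ge> 2 * real m" for n
  have good: "eventually good sequentially"
    unfolding good_def using s lamlim by (auto simp: filterlim_at_top intro!: eventually_conj)
  have goodD: "s n > 0" "lam n > 0" "T (s n) > 0" if "good n" for n
    using that u0(1) u0(2)[of "s n"] Wpos[of "s n"] m by (auto simp: good_def)
  define PP where "PP n Q \<longleftrightarrow> Q \<in> borel_measurable borel \<and>
     excess_coupling D (s n) (lam n) Q \<and>
     (\<forall>x>0. 0 \<le> Q x) \<and>
     (\<forall>x>0. \<forall>y\<ge>0. T (s n * (1 + y / lam n)) / T (s n) \<le> exp (- x) \<longleftrightarrow> Q x \<le> y)" for n Q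
  have "\<exists>Q. good n \<longrightarrow> PP n Q" for n
    using excess_quantile[OF D goodD(1,2), of n n] goodD(3)[of n] unfolding PP_def T_def by blast
  then obtain Q0 where Q0': "\<And>n. good n \<Longrightarrow> PP n (Q0 n)" by metis
  have Q0: "Q0 n \<in> borel_measurable borel"
     "excess_coupling D (s n) (lam n) (Q0 n)"
     "x > 0 \<Longrightarrow> 0 \<le> Q0 n x"
     "x > 0 \<Longrightarrow> y \<ge> 0 \<Longrightarrow> T (s n * (1 + y / lam n)) / T (s n) \<le> exp (- x) \<longleftrightarrow> Q0 n x \<le> y"
    if "good n" for n x y
    using Q0'[OF that] unfolding PP_def by blast+
  define Q where "Q n = (if good n then Q0 n else (\<lambda>_. 0))" for n
  have Qm: "Q n \<in> borel_measurable borel" for n using Q0(1)[of n] by (simp add: Q_def)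
  have bound: "Q0 n x \<le> 8 * real m * exp (x / real m)" if n: "good n" and x: "x > 0" for n x
  proof -
    define y where "y = 8 * real m * exp (x / real m)"
    have y: "y \<ge> 0" by (simp add: y_def)
    have ge: "s n * (1 + y / lam n) \<ge> s n" using goodD[OF n] y by simp
    have "T (s n * (1 + y / lam n)) / T (s n) \<le> (2 * W (s n * (1 + y / lam n))) / (W (s n) / 2)"
    proof (rule frac_le)
      show "T (s n * (1 + y / lam n)) \<le> 2 * W (s n * (1 + y / lam n))"
        using u0(2)[of "s n * (1 + y / lam n)"] ge n by (simp add: good_def)
      then show "0 \<le> 2 * W (s n * (1 + y / lam n))"
        by (smt (verit) T_def measure_nonneg)
      show "W (s n) / 2 \<le> T (s n)" using u0(2)[of "s n"] n by (simp add: good_def)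
      show "0 < W (s n) / 2" using Wpos goodD[OF n] by simp
    qed
    also have "\<dots> = 4 * (((s n * (1 + y / lam n)) powr N * exp (- q * (s n * (1 + y / lam n)) powr \<delta>)) / (s n powr N * exp (- q * s n powr \<delta>)))"
      using par by (simp add: W_def)
    also have "\<dots> \<le> 4 * (1 + y / (2 * real m)) powr (- real m)"
      using n par goodD[OF n] y m lam_def by (intro mult_left_mono kotz_tail_ratio_le) (auto simp: good_def)
    also have "\<dots> \<le> 4 * (4 * exp (x / real m)) powr (- real m)"
      using m by (intro mult_left_mono powr_mono2') (auto simp: y_def)
    also have "\<dots> = 4 * (4 powr (- real m) * exp (- x))"
      using m by (simp add: powr_mult) (simp add: powr_def)
    also have "\<dots> \<le> exp (- x)"
    proof -
      have "(4::real) powr (- real m) \<le> 4 powr (- 1)" using m by (intro powr_mono) auto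
      also have "\<dots> = 1 / 4" by (simp add: powr_minus_divide)
      finally show ?thesis using mult_right_mono[of "4 powr (- real m)" "1/4" "exp (-x)"] by simp
    qed
    finally show ?thesis using Q0(4)[OF n x y] by (simp add: y_def)
  qed
  have lim: "(\<lambda>n. Q n x) \<longlonglongrightarrow> x" if x: "x > 0" for x
  proof -
    have R: "(\<lambda>n. T (s n * (1 + y / lam n)) / T (s n)) \<longlonglongrightarrow> exp (- y)" if "y \<ge> 0" for y
      using kotz_tail_ratio_tendsto[OF par that s, of T N] T1 by (simp add: lam_def W_def)
    show ?thesis
    proof (rule order_tendstoI)
      fix l assume l: "l < x"
      show "eventually (\<lambda>n. l < Q n x) sequentially"
      proof (cases "l < 0")
        case True
        show ?thesis using good by eventually_elim (use True Q0(3) x in \<open>force simp: Q_def\<close>)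
      next
        case False
        then have l0: "0 \<le> l" and "exp (- x) < exp (- l)" using l by simp_all
        from order_tendstoD(1)[OF R[OF l0] this(2)] good
        show ?thesis
        proof eventually_elim
          case (elim n)
          then show ?case using Q0(4)[of n x l] x l0 by (auto simp: Q_def)
        qed
      qed
    next
      fix l assume l: "x < l"
      define l' where "l' = (x + l) / 2"
      have l': "x < l'" "l' < l" using l by (auto simp: l'_def)
      then have l0: "0 \<le> l'" and "exp (- l') < exp (- x)" using x by simp_all
      from order_tendstoD(2)[OF R[OF l0] this(2)] good
      show "eventually (\<lambda>n. Q n x < l) sequentially"
      proof eventually_elim
        case (elim n)
        then show ?case using Q0(4)[of n x l'] x l' l0 by (auto simp: Q_def)
      qed
    qed
  qed
  show ?thesis
  proof (intro exI[of _ Q] conjI allI impI)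
    show "eventually (\<lambda>n. excess_coupling D (s n) (lam n) (Q n)) sequentially"
      using good by eventually_elim (use Q0(2) in \<open>auto simp: Q_def T_def\<close>)
    show "eventually (\<lambda>n. measure D {s n<..} > 0 \<and> (\<forall>x>0. 0 \<le> Q n x \<and> Q n x \<le> 8 * real m * exp (x / real m))) sequentially"
      using good by eventually_elim (use Q0(3) bound goodD in \<open>auto simp: Q_def T_def\<close>)
  qed (use Qm lim in auto)
qed

section \<open>Splitting the quadratic form of a block covariance matrix\<close>

definition embed :: "('m::finite \<Rightarrow> 'k::finite) \<Rightarrow> real^'m \<Rightarrow> real^'k"
  where "embed e v = (\<chi> k. if k \<in> range e then v $ (inv e k) else 0)"

lemma embed_nth [simp]: "inj e \<Longrightarrow> embed e v $ e i = v $ i"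
  by (simp add: embed_def)

lemma embed_nth_notin: "k \<notin> range e \<Longrightarrow> embed e v $ k = 0"
  by (simp add: embed_def)

lemma linear_embed: "linear (embed e)"
  by (rule linearI) (auto simp: embed_def vec_eq_iff)

lemma linear_subvec: "linear (subvec e)"
  by (rule linearI) (auto simp: subvec_def vec_eq_iff)

lemma subvec_embed: "inj e \<Longrightarrow> subvec e (embed e v) = v"
  by (simp add: subvec_def vec_eq_iff)

lemma inner_embed: "inj e \<Longrightarrow> embed e v \<bullet> x = v \<bullet> subvec e x"
proof -
  assume e: "inj e"
  have "embed e v \<bullet> x = (\<Sum>k\<in>UNIV. embed e v $ k * x $ k)" by (simp add: inner_vec_def)
  also have "\<dots> = (\<Sum>k\<in>range e. embed e v $ k * x $ k)"
    by (rule sum.mono_neutral_right) (auto simp: embed_nth_notin)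
  also have "\<dots> = (\<Sum>i\<in>UNIV. v $ i * x $ e i)"
    by (subst sum.reindex[OF e]) (simp add: e)
  finally show ?thesis by (simp add: inner_vec_def subvec_def)
qed

lemma submat_mult: "inj f \<Longrightarrow> submat e f S *v w = subvec e (S *v embed f w)"
proof -
  assume f: "inj f"
  have "(submat e f S *v w) $ i = subvec e (S *v embed f w) $ i" for i
  proof -
    have "subvec e (S *v embed f w) $ i = embed f w \<bullet> row (e i) S"
      by (simp add: subvec_def matrix_vector_mult_def row_def inner_vec_def mult.commute)
    also have "\<dots> = (submat e f S *v w) $ i"
      unfolding inner_embed[OF f]
      by (simp add: subvec_def submat_def matrix_vector_mult_def row_def inner_vec_def mult.commute)
    finally show ?thesis by simp
  qed
  then show ?thesis by (simp add: vec_eq_iff)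
qed

lemma invertible_pos_def:
  fixes A :: "real^'n^'n"
  assumes "\<And>x. x \<noteq> 0 \<Longrightarrow> 0 < x \<bullet> (A *v x)"
  shows "invertible A"
proof -
  have "\<forall>x. A *v x = 0 \<longrightarrow> x = 0" using assms by (metis inner_zero_right less_irrefl)
  then show ?thesis by (simp add: invertible_left_inverse matrix_left_invertible_ker)
qed

lemma symmetric_inner:
  fixes A :: "real^'n^'n"
  assumes "transpose A = A" shows "(A *v x) \<bullet> y = x \<bullet> (A *v y)"
  by (metis assms dot_lmul_matrix inner_commute transpose_matrix_vector)

lemma transpose_matrix_inv:
  fixes A :: "real^'n^'n"
  assumes "invertible A" "transpose A = A" shows "transpose (matrix_inv A) = matrix_inv A"
proof -
  have "transpose (matrix_inv A) ** A = mat 1"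
    using matrix_inverse(1)[OF assms(1)] by (metis assms(2) matrix_transpose_mul transpose_mat)
  then have "transpose (matrix_inv A) ** (A ** matrix_inv A) = matrix_inv A"
    by (simp add: matrix_mul_assoc)
  then show ?thesis using matrix_inverse[OF assms(1)] by simp
qed

lemma inner_matrix_inv_mult:
  fixes A :: "real^'n^'n"
  assumes "invertible A" "transpose A = A" shows "(A *v u) \<bullet> (matrix_inv A *v (A *v u)) = u \<bullet> (A *v u)"
  using matrix_inverse[OF assms(1)] symmetric_inner[OF assms(2)] by (simp add: matrix_vector_mul_assoc)

locale block_covariance =
  fixes S :: "real^'k^'k::finite" and e :: "'i::finite \<Rightarrow> 'k" and f :: "'j::finite \<Rightarrow> 'k"
  assumes sym: "transpose S = S" and pos: "\<And>x. x \<noteq> 0 \<Longrightarrow> 0 < x \<bullet> (S *v x)"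
    and e: "inj e" and f: "inj f" and rng: "range f = - range e"
begin

abbreviation "Sii \<equiv> submat e e S"
text \<open>
  \<open>L\<close> is the matrix of the regression of the \<open>J\<close> block on the \<open>I\<close> block and \<open>C\<close> is the Schur
  complement. In the coordinates \<open>\<Psi>\<close> the second component is the residual of this regression.
\<close>

definition "L = submat f e S ** matrix_inv Sii"
definition "C = submat f f S - submat f e S ** matrix_inv Sii ** submat e f S"
definition "\<Psi> = (\<lambda>z. embed e (fst z) + embed f (snd z + L *v fst z))"

lemma Sii_sym: "transpose Sii = Sii"
  using sym by (simp add: transpose_def submat_def vec_eq_iff)

lemma inner_S: "embed e u \<bullet> (S *v embed f v) = u \<bullet> (submat e f S *v v)"
   "embed f v \<bullet> (S *v embed e u) = v \<bullet> (submat f e S *v u)"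
   "embed e u \<bullet> (S *v embed e u') = u \<bullet> (Sii *v u')"
   "embed f v \<bullet> (S *v embed f v') = v \<bullet> (submat f f S *v v')"
  by (simp_all add: inner_embed e f submat_mult)

lemma embed_eq_0: "embed e u = 0 \<Longrightarrow> u = 0" "embed f v = 0 \<Longrightarrow> v = 0"
  using subvec_embed[OF e, of u] subvec_embed[OF f, of v] by (simp_all add: subvec_def vec_eq_iff)

lemma Sii_pos: "u \<noteq> 0 \<Longrightarrow> 0 < u \<bullet> (Sii *v u)"
  using pos[of "embed e u"] embed_eq_0(1)[of u] by (auto simp: inner_S)

lemma Sii_inv: "invertible Sii"
  by (rule invertible_pos_def) (rule Sii_pos)

lemma subvec_cross: "subvec e (embed f v) = 0" "subvec f (embed e u) = 0"
  using rng by (auto simp: subvec_def vec_eq_iff intro!: embed_nth_notin)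

lemma subvec_\<Psi>: "subvec e (\<Psi> z) = fst z" "subvec f (\<Psi> z) = snd z + L *v fst z"
  by (simp_all add: \<Psi>_def linear_add[OF linear_subvec] subvec_embed e f subvec_cross)

lemma decompose: "embed e (subvec e x) + embed f (subvec f x) = x"
proof (rule vec_eq_iff[THEN iffD2], rule allI)
  fix k
  show "(embed e (subvec e x) + embed f (subvec f x)) $ k = x $ k"
  proof (cases "k \<in> range e")
    case True
    then have "k \<notin> range f" using rng by auto
    with True show ?thesis by (auto simp: embed_nth_notin e subvec_def)
  next
    case False
    then have "k \<in> range f" using rng by auto
    with False show ?thesis by (auto simp: embed_nth_notin f subvec_def)
  qed
qed

lemma linear_\<Psi>: "linear \<Psi>"
proof (rule linearI)
  show "\<Psi> (x + y) = \<Psi> x + \<Psi> y" for x y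
    by (simp add: \<Psi>_def linear_add[OF linear_embed] matrix_vector_right_distrib)
  show "\<Psi> (r *\<^sub>R x) = r *\<^sub>R \<Psi> x" for r x
    by (simp add: \<Psi>_def linear_add[OF linear_embed] linear_scale[OF linear_embed] matrix_vector_mult_scaleR scaleR_add_right)
qed

lemma bij_\<Psi>: "bij \<Psi>"
proof (rule bijI)
  show "inj \<Psi>"
  proof (rule injI)
    fix x y assume eq: "\<Psi> x = \<Psi> y"
    have "fst x = fst y" "snd x + L *v fst x = snd y + L *v fst y"
      using arg_cong[OF eq, of "subvec e"] arg_cong[OF eq, of "subvec f"] by (simp_all add: subvec_\<Psi>)
    then show "x = y" by (simp add: prod_eq_iff)
  qed
  show "surj \<Psi>"
  proof (rule surjI)
    fix x show "\<Psi> (subvec e x, subvec f x - L *v subvec e x) = x"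
      by (simp add: \<Psi>_def decompose)
  qed
qed

lemma S_split: "(embed e u + embed f v) \<bullet> (S *v (embed e u + embed f v)) =
    u \<bullet> (Sii *v u) + 2 * (u \<bullet> (submat e f S *v v)) + v \<bullet> (submat f f S *v v)"
  "v \<bullet> (submat f e S *v u) = u \<bullet> (submat e f S *v v)"
proof -
  show 1: "v \<bullet> (submat f e S *v u) = u \<bullet> (submat e f S *v v)"
    using symmetric_inner[OF sym, of "embed f v" "embed e u"] by (simp add: inner_S(1,2)[symmetric] inner_commute)
  show "(embed e u + embed f v) \<bullet> (S *v (embed e u + embed f v)) =
    u \<bullet> (Sii *v u) + 2 * (u \<bullet> (submat e f S *v v)) + v \<bullet> (submat f f S *v v)"
    by (simp add: matrix_vector_right_distrib inner_add_left inner_add_right inner_S 1)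
qed

lemma C_mult: "C *v v = submat f f S *v v - submat f e S *v (matrix_inv Sii *v (submat e f S *v v))"
  by (simp add: C_def matrix_vector_mult_diff_rdistrib matrix_vector_mul_assoc matrix_mul_assoc)

text \<open>
  Completing the square in \<open>u\<close>. It yields both the positivity of the Schur complement and the
  splitting of the inverse form, so that no formula for a block inverse is needed.
\<close>

lemma complete_square: "(embed e u + embed f v) \<bullet> (S *v (embed e u + embed f v)) =
    (u + matrix_inv Sii *v (submat e f S *v v)) \<bullet> (Sii *v (u + matrix_inv Sii *v (submat e f S *v v))) + v \<bullet> (C *v v)"
proof -
  define w where "w = matrix_inv Sii *v (submat e f S *v v)"
  have w: "Sii *v w = submat e f S *v v"
    using matrix_inverse(1)[OF Sii_inv] by (simp add: w_def matrix_vector_mul_assoc matrix_mul_assoc)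
  have "v \<bullet> (C *v v) = v \<bullet> (submat f f S *v v) - w \<bullet> (Sii *v w)"
    by (simp add: C_mult inner_diff_right w_def[symmetric] S_split(2) w)
  moreover have "(u + w) \<bullet> (Sii *v (u + w)) = u \<bullet> (Sii *v u) + 2 * (u \<bullet> (submat e f S *v v)) + w \<bullet> (Sii *v w)"
    using symmetric_inner[OF Sii_sym, of w u]
    by (simp add: matrix_vector_right_distrib inner_add_left inner_add_right w inner_commute)
  ultimately show ?thesis by (simp add: S_split w_def[symmetric])
qed

lemma C_pos: "v \<noteq> 0 \<Longrightarrow> 0 < v \<bullet> (C *v v)"
proof -
  assume v: "v \<noteq> 0"
  define u where "u = - (matrix_inv Sii *v (submat e f S *v v))"
  have "subvec f (embed e u + embed f v) = v"
    by (simp add: linear_add[OF linear_subvec] subvec_embed f subvec_cross)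
  then have "embed e u + embed f v \<noteq> 0" using v by (auto simp: linear_0[OF linear_subvec])
  from pos[OF this] show ?thesis by (simp add: complete_square u_def)
qed

lemma C_sym: "transpose C = C"
proof -
  have *: "transpose (submat f e S) = submat e f S" "transpose (submat e f S) = submat f e S" "transpose (submat f f S) = submat f f S"
    using sym by (auto simp: transpose_def submat_def vec_eq_iff)
  have "transpose (A - B) = transpose A - transpose B" for A B :: "real^'j^'j"
    by (simp add: transpose_def vec_eq_iff)
  then show ?thesis
    by (simp add: C_def matrix_transpose_mul * transpose_matrix_inv[OF Sii_inv Sii_sym] matrix_mul_assoc)
qed

lemma C_inv: "invertible C"
  by (rule invertible_pos_def) (rule C_pos)

lemma quadratic_form_\<Psi>: "\<Psi> z \<bullet> (matrix_inv S *v \<Psi> z)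
    = fst z \<bullet> (matrix_inv Sii *v fst z) + snd z \<bullet> (matrix_inv C *v snd z)"
proof -
  have S_inv: "invertible S" by (rule invertible_pos_def) (rule pos)
  define w where "w = matrix_inv S *v \<Psi> z"
  define u v where "u = subvec e w" and "v = subvec f w"
  have w: "w = embed e u + embed f v" by (simp add: u_def v_def decompose)
  have Sw: "S *v w = \<Psi> z" using matrix_inverse(1)[OF S_inv] by (simp add: w_def matrix_vector_mul_assoc)
  define a where "a = matrix_inv Sii *v (submat e f S *v v)"
  have a: "Sii *v a = submat e f S *v v"
    using matrix_inverse(1)[OF Sii_inv] by (simp add: a_def matrix_vector_mul_assoc matrix_mul_assoc)
  have fz: "fst z = Sii *v (u + a)"
  proof -
    have "fst z = subvec e (S *v w)" by (simp add: Sw subvec_\<Psi>)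
    then show ?thesis by (simp add: w a matrix_vector_right_distrib linear_add[OF linear_subvec] submat_mult e f)
  qed
  have Lf: "L *v fst z = submat f e S *v (u + a)"
    using matrix_inverse(2)[OF Sii_inv] by (simp add: fz L_def matrix_vector_mul_assoc matrix_mul_assoc[symmetric])
  have sz: "snd z = C *v v"
  proof -
    have "snd z + L *v fst z = subvec f (S *v w)" by (simp add: Sw subvec_\<Psi>)
    also have "\<dots> = submat f e S *v u + submat f f S *v v"
      by (simp add: w matrix_vector_right_distrib linear_add[OF linear_subvec] submat_mult e f)
    finally show ?thesis by (simp add: Lf C_mult a_def[symmetric] matrix_vector_right_distrib algebra_simps)
  qed
  have "\<Psi> z \<bullet> (matrix_inv S *v \<Psi> z) = w \<bullet> (S *v w)"
    by (simp add: w_def[symmetric]) (simp add: Sw inner_commute)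
  then show ?thesis
    unfolding fz sz inner_matrix_inv_mult[OF Sii_inv Sii_sym] inner_matrix_inv_mult[OF C_inv C_sym]
    by (simp add: w complete_square a_def)
qed

end

text \<open>
  So the form of the inverse covariance matrix, evaluated at an elliptical vector, is the square of
  its radius.
\<close>

lemma inner_matrix_inv_gram:
  fixes A :: "real^'k^'k"
  assumes "invertible A" "invertible (transpose A ** A)"
  shows "(transpose A *v u) \<bullet> (matrix_inv (transpose A ** A) *v (transpose A *v u)) = u \<bullet> u"
proof -
  obtain w where u: "u = A *v w"
    using matrix_inverse(1)[OF assms(1)] by (metis matrix_vector_mul_assoc matrix_vector_mul_lid)
  have "matrix_inv (transpose A ** A) *v (transpose A *v u) = w"
    using matrix_inverse(2)[OF assms(2)] by (simp add: u matrix_vector_mul_assoc matrix_mul_assoc[symmetric])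
  moreover have "(transpose A *v u) \<bullet> w = u \<bullet> (A *v w)"
    by (simp add: transpose_matrix_vector dot_lmul_matrix)
  ultimately show ?thesis by (simp add: u)
qed

section \<open>Convergence of the rescaled conical integral\<close>

lemma borel_measurable_matrix_vector_mult [measurable]:
  fixes A :: "real^'n^'m"
  shows "(\<lambda>x. A *v x) \<in> borel_measurable borel"
  by (intro borel_measurable_continuous_onI linear_continuous_on) auto

text \<open>
  Here \<open>a\<close> stands for \<open>a\<^sub>I\<close>, \<open>B\<close> for \<open>\<Sigma>\<^sub>I\<^sub>I\<^sup>-\<^sup>1\<close> and \<open>D\<close> for the inverse of the Schur complement.
\<close>

locale conic_limit =
  fixes a b :: "real^'i::finite" and \<kappa> :: real
    and B :: "real^'i^'i" and D :: "real^'j^'j::finite" and L :: "real^'i^'j"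
  assumes \<kappa>: "\<kappa> > 0" "\<kappa>\<^sup>2 = a \<bullet> b" and b: "\<And>i. b $ i > 0"
    and Ba: "B *v a = b" and B_sym: "transpose B = B" and B_nonneg: "\<And>x. 0 \<le> x \<bullet> (B *v x)"
    and D_pos: "\<And>y. y \<noteq> 0 \<Longrightarrow> 0 < y \<bullet> (D *v y)"
begin

text \<open>
  At the point with coordinates \<open>\<xi> = a + z / lam\<close> and \<open>\<eta> = \<kappa> y / sqrt lam\<close>, \<open>nu\<close> is the norm divided
  by \<open>\<kappa>\<close>. For the radius \<open>t \<kappa> (1 + \<rho> / lam)\<close>, the elliptical vector in the direction of this point is
  \<open>t * dilation\<close> times the point; \<open>region\<close> is the exceedance event within the slab, and \<open>centred\<close> is the
  centred and scaled \<open>J\<close> block, for the scaling \<open>h = sqrt lam / (t \<kappa>)\<close>.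
\<close>

definition "nu lam z y = sqrt ((a + (1 / lam) *\<^sub>R z) \<bullet> (B *v (a + (1 / lam) *\<^sub>R z))
    + ((\<kappa> / sqrt lam) *\<^sub>R y) \<bullet> (D *v ((\<kappa> / sqrt lam) *\<^sub>R y))) / \<kappa>"

definition "dilation lam \<rho> z y = (1 + \<rho> / lam) / nu lam z y"

definition "region lam \<rho> z y \<longleftrightarrow> 0 \<le> b \<bullet> z \<and> b \<bullet> z \<le> \<kappa>\<^sup>2 \<and>
    (\<forall>i. a $ i < (dilation lam \<rho> z y *\<^sub>R (a + (1 / lam) *\<^sub>R z)) $ i)"

definition "centred lam \<rho> z y = (sqrt lam / \<kappa>) *\<^sub>R (dilation lam \<rho> z y *\<^sub>R ((\<kappa> / sqrt lam) *\<^sub>R y + L *v (a + (1 / lam) *\<^sub>R z)) - L *v a)"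

definition kern :: "(real^'j \<Rightarrow> real) \<Rightarrow> real \<Rightarrow> real \<Rightarrow> real^'i \<Rightarrow> real^'j \<Rightarrow> real"
  where "kern g lam \<rho> z y = (if region lam \<rho> z y then g (centred lam \<rho> z y) / nu lam z y ^ DIM((real^'i) \<times> (real^'j)) else 0)"

text \<open>
  The limit of \<open>lam * (nu - 1)\<close>, that is, the part of the excess of the radius that the direction
  uses up.
\<close>

definition "excess z y = (b \<bullet> z) / \<kappa>\<^sup>2 + (y \<bullet> (D *v y)) / 2"

definition kern_lim :: "(real^'j \<Rightarrow> real) \<Rightarrow> real \<Rightarrow> real^'i \<Rightarrow> real^'j \<Rightarrow> real"
  where "kern_lim g \<rho> z y = (if 0 \<le> b \<bullet> z \<and> b \<bullet> z \<le> \<kappa>\<^sup>2 \<and> (\<forall>i. 0 < z $ i + a $ i * (\<rho> - excess z y)) then g y else 0)"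

lemma D_nonneg: "0 \<le> y \<bullet> (D *v y)"
  using D_pos[of y] by (cases "y = 0") auto

lemma B_form_expand: "(a + u *\<^sub>R z) \<bullet> (B *v (a + u *\<^sub>R z)) = \<kappa>\<^sup>2 + 2 * u * (b \<bullet> z) + u\<^sup>2 * (z \<bullet> (B *v z))"
proof -
  have "a \<bullet> (B *v z) = b \<bullet> z"
    using B_sym by (metis Ba dot_lmul_matrix transpose_matrix_vector)
  then show ?thesis
    by (simp add: matrix_vector_right_distrib matrix_vector_mult_scaleR inner_add_left inner_add_right Ba \<kappa>(2)[symmetric]
      inner_commute[of z b] power2_eq_square[of u] algebra_simps)
qed

lemma B_form_ge: "(b \<bullet> x)\<^sup>2 / \<kappa>\<^sup>2 \<le> x \<bullet> (B *v x)"
proof -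
  define r where "r = - (b \<bullet> x) / \<kappa>\<^sup>2"
  have ax: "a \<bullet> (B *v x) = b \<bullet> x"
    using B_sym by (metis Ba dot_lmul_matrix transpose_matrix_vector)
  have "0 \<le> (x + r *\<^sub>R a) \<bullet> (B *v (x + r *\<^sub>R a))" by (rule B_nonneg)
  also have "\<dots> = x \<bullet> (B *v x) + 2 * r * (b \<bullet> x) + r\<^sup>2 * \<kappa>\<^sup>2"
    by (simp add: matrix_vector_right_distrib matrix_vector_mult_scaleR inner_add_left inner_add_right Ba \<kappa>(2)[symmetric]
      ax inner_commute[of x b] power2_eq_square[of r] algebra_simps)
  also have "\<dots> = x \<bullet> (B *v x) - (b \<bullet> x)\<^sup>2 / \<kappa>\<^sup>2"
    using \<kappa>(1) by (simp add: r_def field_simps power2_eq_square)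
  finally show ?thesis by simp
qed

lemma D_form_scaled: "lam > 0 \<Longrightarrow> ((\<kappa> / sqrt lam) *\<^sub>R y) \<bullet> (D *v ((\<kappa> / sqrt lam) *\<^sub>R y)) = \<kappa>\<^sup>2 * (y \<bullet> (D *v y)) / lam"
proof -
  assume "lam > 0"
  then have "(\<kappa> / sqrt lam) * ((\<kappa> / sqrt lam) * x) = \<kappa>\<^sup>2 * x / lam" for x
    by (simp add: power2_eq_square)
  then show ?thesis
    unfolding matrix_vector_mult_scaleR inner_scaleR_left inner_scaleR_right .
qed

lemma nu_sq: "lam > 0 \<Longrightarrow> (nu lam z y)\<^sup>2 = 1 + 2 * excess z y / lam + (z \<bullet> (B *v z)) / (\<kappa>\<^sup>2 * lam\<^sup>2)"
  and nu_nonneg: "nu lam z y \<ge> 0"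
proof -
  have nn: "0 \<le> (a + (1 / lam) *\<^sub>R z) \<bullet> (B *v (a + (1 / lam) *\<^sub>R z))
    + ((\<kappa> / sqrt lam) *\<^sub>R y) \<bullet> (D *v ((\<kappa> / sqrt lam) *\<^sub>R y))"
    by (intro add_nonneg_nonneg B_nonneg D_nonneg)
  then show "nu lam z y \<ge> 0" using \<kappa> by (simp add: nu_def)
  assume lam: "lam > 0"
  show "(nu lam z y)\<^sup>2 = 1 + 2 * excess z y / lam + (z \<bullet> (B *v z)) / (\<kappa>\<^sup>2 * lam\<^sup>2)"
    using nn \<kappa>(1) lam unfolding nu_def power_divide real_sqrt_pow2[OF nn] B_form_expand D_form_scaled[OF lam] excess_def
    by (simp add: field_simps power2_eq_square)
qed

lemma nu_sq_ge: assumes "lam > 0" "0 \<le> b \<bullet> z"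
  shows "1 + (y \<bullet> (D *v y)) / lam \<le> (nu lam z y)\<^sup>2" "1 \<le> nu lam z y"
proof -
  have "0 \<le> (b \<bullet> z) / \<kappa>\<^sup>2 * 2 / lam" "0 \<le> z \<bullet> (B *v z) / (\<kappa>\<^sup>2 * lam\<^sup>2)"
    using assms \<kappa>(1) B_nonneg[of z] by auto
  show 1: "1 + (y \<bullet> (D *v y)) / lam \<le> (nu lam z y)\<^sup>2"
  proof -
    have "2 * (b \<bullet> z / \<kappa>\<^sup>2 + y \<bullet> (D *v y) / 2) / lam = (b \<bullet> z) / \<kappa>\<^sup>2 * 2 / lam + y \<bullet> (D *v y) / lam"
      by (simp add: add_divide_distrib)
    then show ?thesis using \<open>0 \<le> (b \<bullet> z) / \<kappa>\<^sup>2 * 2 / lam\<close> \<open>0 \<le> z \<bullet> (B *v z) / (\<kappa>\<^sup>2 * lam\<^sup>2)\<close>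
      unfolding nu_sq[OF assms(1)] excess_def by linarith
  qed
  have "0 \<le> (y \<bullet> (D *v y)) / lam" using D_nonneg assms by simp
  with 1 have "1\<^sup>2 \<le> (nu lam z y)\<^sup>2" by simp
  then show "1 \<le> nu lam z y" by (rule power2_le_imp_le) (rule nu_nonneg)
qed

text \<open>
  Pairing the exceedance condition with \<open>b\<close> and using \<open>b \<bullet> z \<le> \<kappa>\<^sup>2\<close> gives
  \<open>nu < (1 + \<rho> / lam) (1 + 1 / lam)\<close>, which bounds \<open>y\<close> through \<open>nu_sq_ge\<close>. The condition itself
  bounds each \<open>z\<^sub>i\<close> from below by a negative multiple of \<open>1 + \<rho>\<close>, and these lower bounds together with
  \<open>b \<bullet> z \<le> \<kappa>\<^sup>2\<close> give upper bounds.
\<close>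

lemma region_bounded:
  "\<exists>C>0. \<forall>lam\<ge>1. \<forall>\<rho>\<ge>0. \<forall>z y. region lam \<rho> z y \<longrightarrow> norm (z, y) \<le> C * (1 + \<rho>)"
proof -
  obtain y0 :: "real^'j" where y0: "norm y0 = 1" "\<And>y. norm y = 1 \<Longrightarrow> y0 \<bullet> (D *v y0) \<le> y \<bullet> (D *v y)"
  proof -
    have "\<exists>x\<in>sphere 0 1. \<forall>y\<in>sphere (0::real^'j) 1. x \<bullet> (D *v x) \<le> y \<bullet> (D *v y)"
      by (intro continuous_attains_inf continuous_intros linear_continuous_on) (auto simp: vector_choose_size)
    then show ?thesis using that by auto
  qed
  define h where "h = sqrt (y0 \<bullet> (D *v y0))"
  have "y0 \<noteq> 0" using y0(1) by auto
  then have h: "h > 0" using D_pos[of y0] by (simp add: h_def)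
  have Dge: "(h * norm y)\<^sup>2 \<le> y \<bullet> (D *v y)" for y
  proof (cases "y = 0")
    case False
    have "h\<^sup>2 \<le> (y /\<^sub>R norm y) \<bullet> (D *v (y /\<^sub>R norm y))"
      using y0(2)[of "y /\<^sub>R norm y"] False D_nonneg by (simp add: h_def)
    also have "\<dots> = (y \<bullet> (D *v y)) / (norm y)\<^sup>2"
      by (simp add: matrix_vector_mult_scaleR power2_eq_square field_simps)
    finally show ?thesis using False by (simp add: field_simps power_mult_distrib)
  qed simp
  define A where "A = norm a"
  define S where "S = (\<Sum>i\<in>UNIV. b $ i)"
  have S: "S \<ge> 0" unfolding S_def using b by (intro sum_nonneg) (simp add: less_imp_le)
  define U where "U i = (\<kappa>\<^sup>2 + S * A) / b $ i + A" for i
  have U: "U i \<ge> 0" for i unfolding U_def A_def using S b[of i] by (intro add_nonneg_nonneg divide_nonneg_pos) auto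
  define C where "C = (\<Sum>i\<in>UNIV. U i) + 2 / h + 1"
  have C: "C > 0" unfolding C_def using h U by (intro add_nonneg_pos add_nonneg_nonneg sum_nonneg) auto
  have "norm (z, y) \<le> C * (1 + \<rho>)" if lam: "lam \<ge> 1" and \<rho>: "\<rho> \<ge> 0" and r: "region lam \<rho> z y" for lam \<rho> z y
  proof -
    define n where "n = nu lam z y"
    define t where "t = dilation lam \<rho> z y"
    have bz: "0 \<le> b \<bullet> z" "b \<bullet> z \<le> \<kappa>\<^sup>2" and cond: "\<And>i. a $ i < t * (a $ i + z $ i / lam)"
      using r by (auto simp: region_def t_def)
    have n1: "n \<ge> 1" using nu_sq_ge(2)[of lam z y] lam bz by (simp add: n_def)
    have t: "t = (1 + \<rho> / lam) / n" by (simp add: t_def dilation_def n_def)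
    have t0: "t > 0" using n1 lam \<rho> by (auto simp: t intro!: divide_pos_pos add_pos_nonneg)
    have "(\<Sum>i\<in>UNIV. b $ i * a $ i) < (\<Sum>i\<in>UNIV. b $ i * (t * (a $ i + z $ i / lam)))"
      using cond b by (intro sum_strict_mono) auto
    also have "\<dots> = t * ((\<Sum>i\<in>UNIV. b $ i * a $ i) + (b \<bullet> z) / lam)"
      by (simp add: inner_vec_def sum_distrib_left sum_divide_distrib sum.distrib[symmetric] algebra_simps)
    also have "(\<Sum>i\<in>UNIV. b $ i * a $ i) = \<kappa>\<^sup>2" by (simp add: \<kappa>(2) inner_vec_def mult.commute)
    also have "t * (\<kappa>\<^sup>2 + (b \<bullet> z) / lam) \<le> t * (\<kappa>\<^sup>2 + \<kappa>\<^sup>2 / lam)"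
      using t0 lam bz by (intro mult_left_mono add_left_mono divide_right_mono) auto
    finally have "\<kappa>\<^sup>2 * 1 < \<kappa>\<^sup>2 * (t * (1 + 1 / lam))" by (simp add: algebra_simps)
    then have t1: "1 < t * (1 + 1 / lam)" using \<kappa>(1) by (subst (asm) mult_less_cancel_left_pos) auto
    then have nle: "n < (1 + \<rho> / lam) * (1 + 1 / lam)" using n1 by (simp add: t field_simps)
    \<comment> \<open>\<open>lam \<ge> 1\<close> absorbs the products of the two corrections: \<open>nu \<le> 1 + w / lam\<close>\<close>
    define w where "w = 2 * \<rho> + 1"
    have "n \<le> 1 + w / lam"
    proof -
      have "\<rho> / lam / lam \<le> \<rho> / lam / 1" using lam \<rho> by (intro divide_left_mono) auto
      have "(1 + \<rho> / lam) * (1 + 1 / lam) \<le> 1 + w / lam"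
      proof -
        have "w / lam = \<rho> / lam + \<rho> / lam + 1 / lam" by (simp add: w_def add_divide_distrib[symmetric])
        moreover have "(1 + \<rho> / lam) * (1 + 1 / lam) = 1 + \<rho> / lam + 1 / lam + \<rho> / lam / lam" by (simp add: algebra_simps)
        ultimately show ?thesis using \<open>\<rho> / lam / lam \<le> \<rho> / lam / 1\<close> by simp
      qed
      with nle show ?thesis by simp
    qed
    then have "n\<^sup>2 \<le> (1 + w / lam)\<^sup>2" using n1 by (intro power_mono) auto
    also have "\<dots> = 1 + (2 * w + w\<^sup>2 / lam) / lam" using lam by (simp add: power2_eq_square field_simps)
    also have "\<dots> \<le> 1 + (2 * w + w\<^sup>2 / 1) / lam"
      using lam by (intro add_left_mono divide_right_mono divide_left_mono) auto
    also have "\<dots> \<le> 1 + (w + 1)\<^sup>2 / lam"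
      using lam by (intro add_left_mono divide_right_mono) (auto simp: power2_eq_square algebra_simps)
    finally have "1 + (y \<bullet> (D *v y)) / lam \<le> 1 + (w + 1)\<^sup>2 / lam"
      using nu_sq_ge(1)[of lam z y] lam bz by (simp add: n_def)
    then have "y \<bullet> (D *v y) \<le> (w + 1)\<^sup>2" using lam by (simp add: divide_le_cancel)
    then have "(h * norm y)\<^sup>2 \<le> (w + 1)\<^sup>2" using Dge[of y] by simp
    then have "h * norm y \<le> w + 1" by (rule power2_le_imp_le) (use \<rho> in \<open>simp add: w_def\<close>)
    then have ny: "norm y \<le> 2 / h * (1 + \<rho>)" using h by (simp add: w_def field_simps)
    define \<beta> where "\<beta> = lam * (1 / t - 1)"
    have \<beta>: "\<bar>\<beta>\<bar> \<le> 1 + \<rho>"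
    proof -
      have "1 / t \<le> 1 + 1 / lam" using t1 t0 by (simp add: field_simps)
      then have "\<beta> \<le> lam * (1 / lam)" unfolding \<beta>_def using lam by (intro mult_left_mono) auto
      moreover have "1 / t \<ge> 1 - \<rho> / lam"
      proof -
        have "(1 - \<rho> / lam) * (1 + \<rho> / lam) \<le> 1" by (simp add: algebra_simps)
        then have "(1 - \<rho> / lam) * (1 + \<rho> / lam) \<le> n" using n1 by linarith
        then have "1 - \<rho> / lam \<le> n / (1 + \<rho> / lam)" using lam \<rho> by (subst pos_le_divide_eq) (auto intro!: add_pos_nonneg)
        then show ?thesis by (simp add: t)
      qed
      then have "\<beta> \<ge> lam * (- (\<rho> / lam))" unfolding \<beta>_def using lam by (intro mult_left_mono) auto
      ultimately show ?thesis using lam \<rho> by (simp add: abs_le_iff)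
    qed
    have lower: "- (A * (1 + \<rho>)) \<le> z $ i" for i
    proof -
      have "a $ i / t < a $ i + z $ i / lam" using cond[of i] t0 by (simp add: field_simps)
      then have "lam * (a $ i / t - a $ i) < lam * (z $ i / lam)" using lam by (intro mult_strict_left_mono) auto
      then have "a $ i * \<beta> < z $ i" using lam by (simp add: \<beta>_def algebra_simps)
      moreover have "\<bar>a $ i * \<beta>\<bar> \<le> A * (1 + \<rho>)"
        unfolding abs_mult A_def using \<beta> component_le_norm_cart[of a i] by (intro mult_mono) auto
      ultimately show ?thesis by linarith
    qed
    have upper: "z $ i \<le> ((\<kappa>\<^sup>2 + S * A) / b $ i) * (1 + \<rho>)" for i
    proof -
      have "b $ i * z $ i + (\<Sum>j\<in>UNIV - {i}. b $ j * z $ j) = b \<bullet> z"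
        by (simp add: inner_vec_def sum.remove[of UNIV i])
      moreover have "(\<Sum>j\<in>UNIV - {i}. b $ j * z $ j) \<ge> (\<Sum>j\<in>UNIV - {i}. b $ j * (- (A * (1 + \<rho>))))"
        using lower b by (intro sum_mono mult_left_mono) (auto simp: less_imp_le)
      moreover have "(\<Sum>j\<in>UNIV - {i}. b $ j * (- (A * (1 + \<rho>)))) = (\<Sum>j\<in>UNIV - {i}. b $ j) * (- (A * (1 + \<rho>)))"
        by (simp only: sum_distrib_right)
      moreover have "(\<Sum>j\<in>UNIV - {i}. b $ j) * (A * (1 + \<rho>)) \<le> S * (A * (1 + \<rho>))"
        unfolding S_def A_def using b \<rho> by (intro mult_right_mono sum_mono2) (auto simp: less_imp_le)
      moreover have "\<kappa>\<^sup>2 \<le> \<kappa>\<^sup>2 * (1 + \<rho>)" using \<rho> by (simp add: algebra_simps)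
      ultimately have "b $ i * z $ i \<le> (\<kappa>\<^sup>2 + S * A) * (1 + \<rho>)" using bz by (simp add: algebra_simps)
      then show ?thesis using b[of i] by (simp add: field_simps)
    qed
    have "\<bar>z $ i\<bar> \<le> U i * (1 + \<rho>)" for i
    proof -
      have "0 \<le> ((\<kappa>\<^sup>2 + S * A) / b $ i) * (1 + \<rho>)" "0 \<le> A * (1 + \<rho>)"
        using S b[of i] \<rho> by (auto simp: A_def intro!: divide_nonneg_pos add_nonneg_nonneg mult_nonneg_nonneg)
      then show ?thesis using lower[of i] upper[of i] by (simp add: U_def distrib_right abs_le_iff)
    qed
    then have "norm z \<le> (\<Sum>i\<in>UNIV. U i * (1 + \<rho>))"
      by (intro order_trans[OF norm_le_l1_cart] sum_mono) auto
    then have "norm z \<le> (\<Sum>i\<in>UNIV. U i) * (1 + \<rho>)" by (simp only: sum_distrib_right)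
    with ny norm_Pair_le[of z y] show ?thesis using \<rho> unfolding C_def by (simp add: distrib_right)
  qed
  with C show ?thesis by blast
qed

lemma tendsto_dilation:
  fixes lam \<rho> :: "nat \<Rightarrow> real" and r :: real
  assumes lam: "filterlim lam at_top sequentially" "\<And>n. lam n \<ge> 1" and \<rho>: "\<rho> \<longlonglongrightarrow> r"
    and z: "0 \<le> b \<bullet> z"
  shows "(\<lambda>n. nu (lam n) z y) \<longlonglongrightarrow> 1" "(\<lambda>n. dilation (lam n) (\<rho> n) z y) \<longlonglongrightarrow> 1"
    "(\<lambda>n. lam n * (dilation (lam n) (\<rho> n) z y - 1)) \<longlonglongrightarrow> r - excess z y"
proof -
  have l0: "lam n > 0" for n using lam(2)[of n] by simp
  have inv: "(\<lambda>n. x / lam n) \<longlonglongrightarrow> 0" for x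
    by (rule real_tendsto_divide_at_top[OF tendsto_const lam(1)])
  define e where "e = (z \<bullet> (B *v z)) / \<kappa>\<^sup>2"
  define n1 where "n1 n = nu (lam n) z y" for n
  have n1: "n1 n \<ge> 1" for n unfolding n1_def by (rule nu_sq_ge(2)[OF l0 z])
  have sq: "(n1 n)\<^sup>2 = 1 + 2 * (excess z y / lam n) + (e / lam n) * (1 / lam n)" for n
    unfolding n1_def nu_sq[OF l0] by (simp add: e_def power2_eq_square)
  have "(\<lambda>n. (n1 n)\<^sup>2) \<longlonglongrightarrow> 1 + 2 * 0 + 0 * 0"
    unfolding sq by (intro tendsto_intros inv)
  then have "(\<lambda>n. sqrt ((n1 n)\<^sup>2)) \<longlonglongrightarrow> sqrt 1" by (intro tendsto_real_sqrt) simp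
  then have n1lim: "n1 \<longlonglongrightarrow> 1" using n1 by (simp add: order_trans[OF zero_le_one n1])
  then show "(\<lambda>n. nu (lam n) z y) \<longlonglongrightarrow> 1" by (simp add: n1_def[abs_def])
  have diff: "lam n * (n1 n - 1) = (2 * excess z y + e / lam n) / (n1 n + 1)" for n
  proof -
    have "lam n * (n1 n - 1) * (n1 n + 1) = lam n * ((n1 n)\<^sup>2 - 1)" by (simp add: power2_eq_square algebra_simps)
    also have "\<dots> = 2 * excess z y + e / lam n" unfolding sq using l0[of n] by (simp add: field_simps)
    finally show ?thesis using n1[of n] by (simp add: eq_divide_eq)
  qed
  have "(\<lambda>n. (2 * excess z y + e / lam n) / (n1 n + 1)) \<longlonglongrightarrow> (2 * excess z y + 0) / (1 + 1)"
    by (intro tendsto_intros inv n1lim) auto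
  then have dlim: "(\<lambda>n. lam n * (n1 n - 1)) \<longlonglongrightarrow> excess z y" unfolding diff by simp
  have \<rho>inv: "(\<lambda>n. \<rho> n / lam n) \<longlonglongrightarrow> 0" by (rule real_tendsto_divide_at_top[OF \<rho> lam(1)])
  have "(\<lambda>n. (1 + \<rho> n / lam n) / n1 n) \<longlonglongrightarrow> (1 + 0) / 1"
    by (intro tendsto_intros \<rho>inv n1lim) auto
  then show "(\<lambda>n. dilation (lam n) (\<rho> n) z y) \<longlonglongrightarrow> 1" by (simp add: dilation_def n1_def)
  have "(\<lambda>n. (\<rho> n - lam n * (n1 n - 1)) / n1 n) \<longlonglongrightarrow> (r - excess z y) / 1"
    by (intro tendsto_intros \<rho> dlim n1lim) auto
  moreover have "(\<rho> n - lam n * (n1 n - 1)) / n1 n = lam n * (dilation (lam n) (\<rho> n) z y - 1)" for n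
    using l0[of n] n1[of n] by (simp add: dilation_def n1_def[symmetric] field_simps)
  ultimately show "(\<lambda>n. lam n * (dilation (lam n) (\<rho> n) z y - 1)) \<longlonglongrightarrow> r - excess z y" by simp
qed

text \<open>
  The leading terms \<open>L a\<close> cancel, and what remains besides \<open>y\<close> is of order \<open>1 / sqrt lam\<close>: the
  fluctuation of the \<open>I\<close> block is negligible on the scale of the \<open>J\<close> block.
\<close>

lemma centred_eq:
  assumes "lam > 0"
  shows "centred lam \<rho> z y = dilation lam \<rho> z y *\<^sub>R y +
     (1 / (\<kappa> * sqrt lam)) *\<^sub>R (L *v ((lam * (dilation lam \<rho> z y - 1)) *\<^sub>R a + dilation lam \<rho> z y *\<^sub>R z))"
proof -
  define t where "t = dilation lam \<rho> z y"
  have l: "lam = sqrt lam * sqrt lam" "sqrt lam > 0" using assms by auto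
  have 1: "sqrt lam / \<kappa> * (t * (\<kappa> / sqrt lam)) = t" using l \<kappa>(1) by (simp add: field_simps)
  have 2: "sqrt lam / \<kappa> * (t - 1) = 1 / (\<kappa> * sqrt lam) * (lam * (t - 1))"
    using l \<kappa>(1) by (subst (2) l(1)) (simp add: field_simps)
  have 3: "sqrt lam / \<kappa> * (t * (1 / lam)) = 1 / (\<kappa> * sqrt lam) * t"
    using l \<kappa>(1) by (subst (2) l(1)) (simp add: field_simps)
  have "centred lam \<rho> z y = (sqrt lam / \<kappa> * (t * (\<kappa> / sqrt lam))) *\<^sub>R y + (sqrt lam / \<kappa> * (t - 1)) *\<^sub>R (L *v a)
     + (sqrt lam / \<kappa> * (t * (1 / lam))) *\<^sub>R (L *v z)"
    by (simp add: centred_def t_def[symmetric] matrix_vector_right_distrib matrix_vector_mult_scaleR scaleR_add_right scaleR_diff_right right_diff_distrib scaleR_diff_left)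
  then show ?thesis
    unfolding 1 2 3 t_def[symmetric] by (simp add: matrix_vector_right_distrib matrix_vector_mult_scaleR scaleR_add_right)
qed

text \<open>
  The hypothesis \<open>nz\<close> keeps \<open>z\<close> off the boundary of the limiting event. It is only required where
  \<open>a\<^sub>i \<noteq> 0\<close>: for \<open>a\<^sub>i = 0\<close> the exceedance condition is \<open>z\<^sub>i > 0\<close> for all indices. Given \<open>z\<close> and \<open>y\<close>,
  it therefore excludes only finitely many values of \<open>r\<close>.
\<close>

lemma tendsto_kern:
  fixes lam \<rho> :: "nat \<Rightarrow> real" and r :: real
  assumes lam: "filterlim lam at_top sequentially" "\<And>n. lam n \<ge> 1" and \<rho>: "\<rho> \<longlonglongrightarrow> r" "\<And>n. \<rho> n \<ge> 0"
    and g: "continuous_on UNIV g"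
    and nz: "\<And>i. a $ i \<noteq> 0 \<Longrightarrow> z $ i + a $ i * (r - excess z y) \<noteq> 0"
  shows "(\<lambda>n. kern g (lam n) (\<rho> n) z y) \<longlonglongrightarrow> kern_lim g r z y"
proof (cases "0 \<le> b \<bullet> z \<and> b \<bullet> z \<le> \<kappa>\<^sup>2")
  case False
  then have "kern g (lam n) (\<rho> n) z y = 0" for n by (auto simp: kern_def region_def)
  moreover have "kern_lim g r z y = 0" using False by (auto simp: kern_lim_def)
  ultimately show ?thesis by simp
next
  case True
  then have bz: "0 \<le> b \<bullet> z" by simp
  have l0: "lam n > 0" for n using lam(2)[of n] by simp
  note T = tendsto_dilation[OF lam \<rho>(1) bz, of y]
  define t where "t n = dilation (lam n) (\<rho> n) z y" for n
  have t0: "t n > 0" for n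
    unfolding t_def dilation_def using nu_sq_ge(2)[OF l0 bz, of n y] \<rho>(2)[of n] l0[of n]
    by (intro divide_pos_pos add_pos_nonneg) auto
  have t1: "t \<longlonglongrightarrow> 1" using T(2) by (simp add: t_def[abs_def])
  have dt: "(\<lambda>n. lam n * (t n - 1)) \<longlonglongrightarrow> r - excess z y" using T(3) by (simp add: t_def)
  have cond: "a $ i < (t n *\<^sub>R (a + (1 / lam n) *\<^sub>R z)) $ i \<longleftrightarrow> 0 < a $ i * (lam n * (t n - 1)) + t n * z $ i" for i n
  proof -
    have "a $ i < (t n *\<^sub>R (a + (1 / lam n) *\<^sub>R z)) $ i \<longleftrightarrow> 0 < lam n * (t n * (a $ i + z $ i / lam n) - a $ i)"
      using l0[of n] by (simp add: zero_less_mult_iff)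
    also have "lam n * (t n * (a $ i + z $ i / lam n) - a $ i) = a $ i * (lam n * (t n - 1)) + t n * z $ i"
      using l0[of n] by (simp add: field_simps)
    finally show ?thesis .
  qed
  have ev: "eventually (\<lambda>n. (a $ i < (t n *\<^sub>R (a + (1 / lam n) *\<^sub>R z)) $ i) = (0 < z $ i + a $ i * (r - excess z y))) sequentially" for i
  proof (cases "a $ i = 0")
    case True
    have "(0 < t n * z $ i) = (0 < z $ i)" for n using t0[of n] by (auto simp: zero_less_mult_iff)
    with True show ?thesis unfolding cond by simp
  next
    case False
    have lim: "(\<lambda>n. a $ i * (lam n * (t n - 1)) + t n * z $ i) \<longlonglongrightarrow> a $ i * (r - excess z y) + 1 * z $ i"
      by (intro tendsto_intros dt t1)
    show ?thesis
    proof (cases "0 < z $ i + a $ i * (r - excess z y)")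
      case True
      then have "eventually (\<lambda>n. 0 < a $ i * (lam n * (t n - 1)) + t n * z $ i) sequentially"
        by (intro order_tendstoD(1)[OF lim]) simp
      then show ?thesis unfolding cond by eventually_elim (use True in simp)
    next
      case F: False
      then have "eventually (\<lambda>n. 0 > a $ i * (lam n * (t n - 1)) + t n * z $ i) sequentially"
        using nz[OF False] by (intro order_tendstoD(2)[OF lim]) simp
      then show ?thesis unfolding cond by eventually_elim (use F in simp)
    qed
  qed
  define P where "P \<longleftrightarrow> (\<forall>i. 0 < z $ i + a $ i * (r - excess z y))"
  have "eventually (\<lambda>n. \<forall>i. (a $ i < (t n *\<^sub>R (a + (1 / lam n) *\<^sub>R z)) $ i) = (0 < z $ i + a $ i * (r - excess z y))) sequentially"
    using ev by (simp add: eventually_all_finite)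
  then have "eventually (\<lambda>n. (if P then g (centred (lam n) (\<rho> n) z y) / nu (lam n) z y ^ DIM((real^'i) \<times> (real^'j)) else 0) = kern g (lam n) (\<rho> n) z y) sequentially"
    by eventually_elim (use True in \<open>simp add: kern_def region_def t_def P_def\<close>)
  moreover have "(\<lambda>n. if P then g (centred (lam n) (\<rho> n) z y) / nu (lam n) z y ^ DIM((real^'i) \<times> (real^'j)) else 0) \<longlonglongrightarrow> kern_lim g r z y"
  proof -
    have Lc: "continuous_on UNIV (\<lambda>x. L *v x)" by (intro linear_continuous_on) auto
    have "(\<lambda>n. L *v ((lam n * (t n - 1)) *\<^sub>R a + t n *\<^sub>R z)) \<longlonglongrightarrow> L *v ((r - excess z y) *\<^sub>R a + 1 *\<^sub>R z)"
      by (rule continuous_on_tendsto_compose[OF Lc], intro tendsto_intros dt t1, simp_all)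
    moreover have "(\<lambda>n. 1 / (\<kappa> * sqrt (lam n))) \<longlonglongrightarrow> 0"
    proof -
      have "((\<lambda>l. 1 / (\<kappa> * sqrt l)) \<longlongrightarrow> 0) at_top" using \<kappa>(1) by real_asymp
      from filterlim_compose[OF this lam(1)] show ?thesis .
    qed
    ultimately have "(\<lambda>n. t n *\<^sub>R y + (1 / (\<kappa> * sqrt (lam n))) *\<^sub>R (L *v ((lam n * (t n - 1)) *\<^sub>R a + t n *\<^sub>R z)))
       \<longlonglongrightarrow> 1 *\<^sub>R y + 0 *\<^sub>R (L *v ((r - excess z y) *\<^sub>R a + 1 *\<^sub>R z))"
      by (intro tendsto_intros t1)
    then have "(\<lambda>n. centred (lam n) (\<rho> n) z y) \<longlonglongrightarrow> y" by (simp add: centred_eq[OF l0] t_def)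
    then have "(\<lambda>n. g (centred (lam n) (\<rho> n) z y)) \<longlonglongrightarrow> g y"
      by (rule continuous_on_tendsto_compose[OF g]) auto
    then have "(\<lambda>n. g (centred (lam n) (\<rho> n) z y) / nu (lam n) z y ^ DIM((real^'i) \<times> (real^'j))) \<longlonglongrightarrow> g y / 1 ^ DIM((real^'i) \<times> (real^'j))"
      by (intro tendsto_intros T(1)) auto
    moreover have "kern_lim g r z y = (if P then g y else 0)"
      using True by (simp add: kern_lim_def P_def)
    ultimately show ?thesis by (cases P) simp_all
  qed
  ultimately show ?thesis by (rule Lim_transform_eventually[rotated])
qed


lemma measurable_kern [measurable]:
  assumes [measurable]: "g \<in> borel_measurable borel" "f1 \<in> borel_measurable M" "f2 \<in> borel_measurable M" "f3 \<in> borel_measurable M"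
  shows "(\<lambda>x. kern g lam (f1 x) (f2 x) (f3 x)) \<in> borel_measurable M"
proof -
  have [measurable]: "(\<lambda>x::real^'i. x $ i) \<in> borel_measurable borel" for i
    by (intro borel_measurable_continuous_onI continuous_intros)
  have [measurable]: "(\<lambda>x. nu lam (f2 x) (f3 x)) \<in> borel_measurable M"
    unfolding nu_def by measurable
  have [measurable]: "(\<lambda>x. dilation lam (f1 x) (f2 x) (f3 x)) \<in> borel_measurable M"
    unfolding dilation_def by measurable
  have [measurable]: "(\<lambda>x. centred lam (f1 x) (f2 x) (f3 x)) \<in> borel_measurable M"
    unfolding centred_def by measurable
  have [measurable]: "Measurable.pred M (\<lambda>x. region lam (f1 x) (f2 x) (f3 x))"
    unfolding region_def by measurable
  show ?thesis unfolding kern_def by measurable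
qed

lemma measurable_kern_lim [measurable]:
  assumes [measurable]: "g \<in> borel_measurable borel" "f1 \<in> borel_measurable M" "f2 \<in> borel_measurable M" "f3 \<in> borel_measurable M"
  shows "(\<lambda>x. kern_lim g (f1 x) (f2 x) (f3 x)) \<in> borel_measurable M"
proof -
  have [measurable]: "(\<lambda>x::real^'i. x $ i) \<in> borel_measurable borel" for i
    by (intro borel_measurable_continuous_onI continuous_intros)
  show ?thesis unfolding kern_lim_def excess_def by measurable
qed

text \<open>
  The volume of the ball of radius \<open>C exp (x / (2 d))\<close> in dimension \<open>d\<close> grows like \<open>exp (x / 2)\<close>, which
  is integrable for the exponential law.
\<close>

lemma nn_integral_dominating_function_finite:
  fixes C :: real
  assumes C: "C > 0"
  shows "(\<integral>\<^sup>+w. (\<integral>\<^sup>+x. ennreal M * indicator {w. norm (w :: 'a::euclidean_space) \<le> C * exp (x / (2 * real DIM('a)))} w \<partial>std_exponential) \<partial>lborel) < \<infinity>"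
proof -
  interpret E: prob_space std_exponential by (rule prob_space_exponential_density) simp
  interpret pair_sigma_finite std_exponential "lborel :: 'a measure" ..
  define V where "V = unit_ball_vol (real DIM('a))"
  have V: "V \<ge> 0" by (simp add: V_def)
  have "(\<integral>\<^sup>+w. (\<integral>\<^sup>+x. ennreal M * indicator {w. norm (w :: 'a) \<le> C * exp (x / (2 * real DIM('a)))} w \<partial>std_exponential) \<partial>lborel)
    = (\<integral>\<^sup>+w. (\<integral>\<^sup>+x. (if norm (w :: 'a) \<le> C * exp (x / (2 * real DIM('a))) then ennreal M else 0) \<partial>std_exponential) \<partial>lborel)"
    by (intro nn_integral_cong) (simp add: indicator_def)
  also have "\<dots> = (\<integral>\<^sup>+x. (\<integral>\<^sup>+w. (if norm (w :: 'a) \<le> C * exp (x / (2 * real DIM('a))) then ennreal M else 0) \<partial>lborel) \<partial>std_exponential)"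
    by (rule Fubini') (simp add: split_beta')
  also have "\<dots> = (\<integral>\<^sup>+x. ennreal M * ennreal (V * C ^ DIM('a)) * ennreal (exp (x / 2)) \<partial>std_exponential)"
  proof (rule nn_integral_cong)
    fix x
    define r where "r = C * exp (x / (2 * real DIM('a)))"
    have r: "r \<ge> 0" using C by (simp add: r_def)
    have "(\<integral>\<^sup>+w. (if norm (w :: 'a) \<le> r then ennreal M else 0) \<partial>lborel) = (\<integral>\<^sup>+w. ennreal M * indicator (cball (0::'a) r) w \<partial>lborel)"
      by (intro nn_integral_cong) (simp add: indicator_def)
    also have "\<dots> = ennreal M * ennreal (V * r ^ DIM('a))"
      by (subst nn_integral_cmult_indicator) (simp_all add: emeasure_cball[OF r] V_def)
    also have "r ^ DIM('a) = C ^ DIM('a) * exp (x / 2)"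
      by (simp add: r_def power_mult_distrib exp_of_nat_mult[symmetric])
    finally show "(\<integral>\<^sup>+w. (if norm (w :: 'a) \<le> C * exp (x / (2 * real DIM('a))) then ennreal M else 0) \<partial>lborel)
      = ennreal M * ennreal (V * C ^ DIM('a)) * ennreal (exp (x / 2))"
      using V C by (simp add: r_def ennreal_mult[symmetric] mult.assoc)
  qed
  also have "\<dots> = ennreal M * ennreal (V * C ^ DIM('a)) * (\<integral>\<^sup>+x. ennreal (exp (x / 2)) \<partial>std_exponential)"
    by (rule nn_integral_cmult) simp
  also have "(\<integral>\<^sup>+x. ennreal (exp (x / 2)) \<partial>std_exponential) = (\<integral>\<^sup>+x. ennreal (exp (- x / 2)) * indicator {0..} x \<partial>lborel)"
    by (subst nn_integral_std_exponential)
       (auto intro!: nn_integral_cong simp: ennreal_mult[symmetric] exp_add[symmetric] split: split_indicator)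
  also have "\<dots> = ennreal (0 - (- 2 * exp (- 0 / 2)))"
  proof (rule nn_integral_FTC_atLeast)
    show "((\<lambda>x::real. - 2 * exp (- x / 2)) \<longlongrightarrow> 0) at_top" by real_asymp
  qed (auto intro!: derivative_eq_intros)
  finally show ?thesis by (simp add: ennreal_mult_less_top)
qed

text \<open>
  The total weight of the limiting integral over \<open>z\<close> and the shifted exponential variable; it is a
  common factor of all limits and cancels.
\<close>

definition "mass = (\<integral>\<^sup>+z. (if 0 \<le> b \<bullet> z \<and> b \<bullet> z \<le> \<kappa>\<^sup>2 then ennreal (exp (- ((b \<bullet> z) / \<kappa>\<^sup>2))) *
    (\<integral>\<^sup>+x. ennreal (exp (- x)) * (if \<forall>i. 0 < z $ i + a $ i * x then 1 else 0) \<partial>lborel) else 0) \<partial>lborel)"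

definition "gauss_integral g = (\<integral>\<^sup>+y. ennreal (exp (- (y \<bullet> (D *v y)) / 2)) * ennreal (g y) \<partial>lborel)"

definition "kern_integral g lam Q =
  (\<integral>\<^sup>+w. (\<integral>\<^sup>+x. ennreal (kern g lam (Q x) (fst w) (snd w)) \<partial>std_exponential) \<partial>lborel)"

text \<open>
  Shift the exponential variable by \<open>excess z y\<close>. Pairing the limiting condition with \<open>b\<close> shows that
  it already forces \<open>x \<ge> - excess z y\<close>, so that after the shift \<open>x\<close> ranges over the whole line and the
  condition does not contain \<open>y\<close>.
\<close>

lemma nn_integral_kern_lim:
  assumes [measurable]: "g \<in> borel_measurable borel" and g: "\<And>y. 0 \<le> g y"
  shows "(\<integral>\<^sup>+w. (\<integral>\<^sup>+x. ennreal (kern_lim g x (fst w) (snd w)) \<partial>std_exponential) \<partial>lborel)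
    = mass * gauss_integral g"
proof -
  interpret E: prob_space std_exponential by (rule prob_space_exponential_density) simp
  have [measurable]: "(\<lambda>x::real^'i. x $ i) \<in> borel_measurable borel" for i
    by (intro borel_measurable_continuous_onI continuous_intros)
  define G where "G z = (\<integral>\<^sup>+x. ennreal (exp (- x)) * (if \<forall>i. 0 < z $ i + a $ i * x then 1 else 0) \<partial>lborel)" for z
  have [measurable]: "G \<in> borel_measurable borel"
    unfolding G_def by measurable
  have inner: "(\<integral>\<^sup>+x. ennreal (kern_lim g x z y) \<partial>std_exponential)
     = (if 0 \<le> b \<bullet> z \<and> b \<bullet> z \<le> \<kappa>\<^sup>2 then ennreal (exp (- ((b \<bullet> z) / \<kappa>\<^sup>2))) * G z else 0)
        * (ennreal (exp (- (y \<bullet> (D *v y)) / 2)) * ennreal (g y))" for z y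
  proof (cases "0 \<le> b \<bullet> z \<and> b \<bullet> z \<le> \<kappa>\<^sup>2")
    case False
    then have "kern_lim g x z y = 0" for x by (auto simp: kern_lim_def)
    then show ?thesis using False by auto
  next
    case True
    have imp: "- excess z y \<le> x" if "\<forall>i. 0 < z $ i + a $ i * x" for x
    proof -
      have "0 \<le> (\<Sum>i\<in>UNIV. b $ i * (z $ i + a $ i * x))"
        using that b by (intro sum_nonneg mult_nonneg_nonneg) (auto simp: less_imp_le)
      also have "\<dots> = b \<bullet> z + \<kappa>\<^sup>2 * x"
        by (simp add: \<kappa>(2) inner_vec_def sum_distrib_left sum.distrib algebra_simps)
      finally have "- ((b \<bullet> z) / \<kappa>\<^sup>2) \<le> x" using \<kappa>(1) by (simp add: field_simps)
      then show ?thesis using D_nonneg[of y] by (simp add: excess_def)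
    qed
    have "(\<integral>\<^sup>+x. ennreal (kern_lim g x z y) \<partial>std_exponential)
      = (\<integral>\<^sup>+x. ennreal (exp (- x)) * indicator {0..} x * ennreal (kern_lim g x z y) \<partial>lborel)"
      by (rule nn_integral_std_exponential) simp
    also have "\<dots> = (\<integral>\<^sup>+x. ennreal (exp (- (excess z y + x))) * indicator {0..} (excess z y + x) * ennreal (kern_lim g (excess z y + x) z y) \<partial>lborel)"
      using nn_integral_real_affine[of "\<lambda>x. ennreal (exp (- x)) * indicator {0..} x * ennreal (kern_lim g x z y)" 1 "excess z y"] by simp
    also have "\<dots> = (\<integral>\<^sup>+x. ennreal (exp (- excess z y) * g y) * (ennreal (exp (- x)) * (if \<forall>i. 0 < z $ i + a $ i * x then 1 else 0)) \<partial>lborel)"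
    proof (rule nn_integral_cong)
      fix x
      show "ennreal (exp (- (excess z y + x))) * indicator {0..} (excess z y + x) * ennreal (kern_lim g (excess z y + x) z y)
        = ennreal (exp (- excess z y) * g y) * (ennreal (exp (- x)) * (if \<forall>i. 0 < z $ i + a $ i * x then 1 else 0))"
      proof (cases "\<forall>i. 0 < z $ i + a $ i * x")
        case t: True
        then have "0 \<le> excess z y + x" using imp by force
        then show ?thesis using t True g[of y]
          by (simp add: kern_lim_def ennreal_mult[symmetric]) (simp add: exp_add[symmetric] exp_diff exp_minus field_simps)
      next
        case False
        then have "kern_lim g (excess z y + x) z y = 0" by (auto simp: kern_lim_def)
        with False show ?thesis by auto
      qed
    qed
    also have "\<dots> = ennreal (exp (- excess z y) * g y) * G z"
      unfolding G_def by (rule nn_integral_cmult) measurable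
    also have "ennreal (exp (- excess z y) * g y) = ennreal (exp (- ((b \<bullet> z) / \<kappa>\<^sup>2))) * (ennreal (exp (- (y \<bullet> (D *v y)) / 2)) * ennreal (g y))"
      using g[of y] by (simp add: ennreal_mult[symmetric] excess_def exp_add[symmetric] mult.assoc[symmetric])
    finally show ?thesis using True by (simp add: ac_simps)
  qed
  show ?thesis
    unfolding inner lborel_prod[symmetric] gauss_integral_def
    by (subst lborel.nn_integral_fst[symmetric])
       (simp_all add: nn_integral_cmult nn_integral_multc mass_def G_def[symmetric] cong del: if_weak_cong)
qed

text \<open>
  The points \<open>z\<close> slightly above \<open>a / 2\<close> and \<open>x\<close> slightly above \<open>- 1 / 2\<close> satisfy all conditions.
\<close>

lemma mass_pos: "mass > 0"
proof -
  have [measurable]: "(\<lambda>x::real^'i. x $ i) \<in> borel_measurable borel" for i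
    by (intro borel_measurable_continuous_onI continuous_intros)
  define S where "S = (\<Sum>i\<in>UNIV. b $ i)"
  have S: "S > 0" unfolding S_def using b by (intro sum_pos) auto
  define \<eta> where "\<eta> = \<kappa>\<^sup>2 / (2 * S)"
  have \<eta>: "\<eta> > 0" using \<kappa>(1) S by (simp add: \<eta>_def)
  define A where "A = norm a + 1"
  have A: "A > 0" unfolding A_def using norm_ge_zero[of a] by linarith
  define \<epsilon> where "\<epsilon> = \<eta> / (2 * A)"
  have \<epsilon>: "\<epsilon> > 0" using \<eta> A by (simp add: \<epsilon>_def)
  define Bx where "Bx = box ((1/2) *\<^sub>R a + (\<eta> / 2) *\<^sub>R (\<chi> i. 1)) ((1/2) *\<^sub>R a + \<eta> *\<^sub>R (\<chi> i. 1))"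
  have "emeasure lborel Bx > 0"
  proof -
    have "emeasure lborel Bx = ennreal (\<Prod>b\<in>Basis. ((1/2) *\<^sub>R a + \<eta> *\<^sub>R (\<chi> i. 1) - ((1/2) *\<^sub>R a + (\<eta> / 2) *\<^sub>R (\<chi> i. 1))) \<bullet> b)"
      unfolding Bx_def by (rule emeasure_lborel_box) (use \<eta> in \<open>auto simp: Basis_vec_def inner_axis inner_add_left\<close>)
    also have "\<dots> > 0"
      using \<eta> by (auto intro!: prod_pos simp: Basis_vec_def inner_axis inner_diff_left)
    finally show ?thesis .
  qed
  have low: "ennreal (exp (- 1)) * ennreal (exp (1 / 2 - \<epsilon>)) * ennreal \<epsilon> * indicator Bx z \<le>
     (if 0 \<le> b \<bullet> z \<and> b \<bullet> z \<le> \<kappa>\<^sup>2 then ennreal (exp (- ((b \<bullet> z) / \<kappa>\<^sup>2))) *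
    (\<integral>\<^sup>+x. ennreal (exp (- x)) * (if \<forall>i. 0 < z $ i + a $ i * x then 1 else 0) \<partial>lborel) else 0)" for z
  proof (cases "z \<in> Bx")
    case True
    then have z: "a $ i / 2 + \<eta> / 2 < z $ i" "z $ i < a $ i / 2 + \<eta>" for i
      by (auto simp: Bx_def mem_box_cart)
    have ab: "(\<Sum>i\<in>UNIV. b $ i * a $ i) = \<kappa>\<^sup>2" by (simp add: \<kappa>(2) inner_vec_def mult.commute)
    have "b \<bullet> z \<le> (\<Sum>i\<in>UNIV. b $ i * (a $ i / 2 + \<eta>))"
      unfolding inner_vec_def inner_real_def using z(2) b by (intro sum_mono mult_left_mono) (auto simp: less_imp_le)
    also have "\<dots> = \<kappa>\<^sup>2 / 2 + S * \<eta>"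
      by (simp add: distrib_left sum.distrib S_def sum_distrib_right ab[symmetric] sum_divide_distrib)
    also have "\<dots> = \<kappa>\<^sup>2" using S by (simp add: \<eta>_def)
    finally have bz: "b \<bullet> z \<le> \<kappa>\<^sup>2" .
    have "(\<Sum>i\<in>UNIV. b $ i * (a $ i / 2)) \<le> b \<bullet> z"
      unfolding inner_vec_def inner_real_def
    proof (intro sum_mono mult_left_mono)
      show "a $ i / 2 \<le> z $ i" "0 \<le> b $ i" for i using z(1)[of i] \<eta> b[of i] by linarith+
    qed
    moreover have "(\<Sum>i\<in>UNIV. b $ i * (a $ i / 2)) = \<kappa>\<^sup>2 / 2" by (simp add: ab[symmetric] sum_divide_distrib)
    ultimately have bz0: "0 \<le> b \<bullet> z" using zero_le_power2[of \<kappa>] by linarith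
    have "exp (- 1) \<le> exp (- ((b \<bullet> z) / \<kappa>\<^sup>2))" using bz \<kappa>(1) by (simp add: field_simps)
    moreover have "ennreal (exp (1 / 2 - \<epsilon>)) * ennreal \<epsilon> \<le> (\<integral>\<^sup>+x. ennreal (exp (- x)) * (if \<forall>i. 0 < z $ i + a $ i * x then 1 else 0) \<partial>lborel)"
    proof -
      have "ennreal (exp (1 / 2 - \<epsilon>)) * ennreal \<epsilon> = (\<integral>\<^sup>+x. ennreal (exp (1 / 2 - \<epsilon>)) * indicator {- 1/2 .. - 1/2 + \<epsilon>} x \<partial>lborel)"
        using \<epsilon> by (subst nn_integral_cmult_indicator) auto
      also have "\<dots> \<le> (\<integral>\<^sup>+x. ennreal (exp (- x)) * (if \<forall>i. 0 < z $ i + a $ i * x then 1 else 0) \<partial>lborel)"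
      proof (rule nn_integral_mono)
        fix x :: real
        show "ennreal (exp (1 / 2 - \<epsilon>)) * indicator {- 1/2 .. - 1/2 + \<epsilon>} x \<le> ennreal (exp (- x)) * (if \<forall>i. 0 < z $ i + a $ i * x then 1 else 0)"
        proof (cases "x \<in> {- 1/2 .. - 1/2 + \<epsilon>}")
          case True
          have "0 < z $ i + a $ i * x" for i
          proof -
            have "\<bar>a $ i * (x + 1/2)\<bar> \<le> A * \<epsilon>"
              unfolding abs_mult A_def using component_le_norm_cart[of a i] True by (intro mult_mono) auto
            also have "A * \<epsilon> = \<eta> / 2" using A by (simp add: \<epsilon>_def)
            finally have "- (\<eta> / 2) \<le> a $ i * (x + 1/2)" by (simp add: abs_le_iff)
            then show ?thesis using z(1)[of i] by (simp add: algebra_simps)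
          qed
          then show ?thesis using True by (auto simp: ennreal_leI)
        qed simp
      qed
      finally show ?thesis .
    qed
    ultimately show ?thesis using True bz bz0 by (auto simp: mult.assoc intro!: mult_mono ennreal_leI)
  qed simp
  have "0 < ennreal (exp (- 1)) * ennreal (exp (1 / 2 - \<epsilon>)) * ennreal \<epsilon> * emeasure lborel Bx"
    using \<open>emeasure lborel Bx > 0\<close> \<epsilon> by (simp add: ennreal_zero_less_mult_iff)
  also have "\<dots> = (\<integral>\<^sup>+z. ennreal (exp (- 1)) * ennreal (exp (1 / 2 - \<epsilon>)) * ennreal \<epsilon> * indicator Bx z \<partial>lborel)"
    by (subst nn_integral_cmult_indicator) (auto simp: Bx_def)
  also have "\<dots> \<le> mass"
    unfolding mass_def by (rule nn_integral_mono) (rule low)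
  finally show ?thesis .
qed

text \<open>
  Dominated convergence in two stages: for fixed \<open>z\<close> and \<open>y\<close> over the exponential variable, where the
  boundary of the limiting event is a finite set, and then over \<open>z\<close> and \<open>y\<close>. The dominating function
  also shows that the limit is finite.
\<close>

lemma kern_integral_tendsto:
  fixes lam :: "nat \<Rightarrow> real" and Q :: "nat \<Rightarrow> real \<Rightarrow> real" and g :: "real^'j \<Rightarrow> real"
  assumes lam: "filterlim lam at_top sequentially" "\<And>n. lam n \<ge> 1"
    and Q[measurable]: "\<And>n. Q n \<in> borel_measurable borel" and Qb: "\<And>n x. x > 0 \<Longrightarrow> 0 \<le> Q n x \<and> Q n x \<le> q * exp (x / (2 * real DIM((real^'i) \<times> (real^'j))))"
    and Ql: "\<And>x. x > 0 \<Longrightarrow> (\<lambda>n. Q n x) \<longlonglongrightarrow> x"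
    and g: "continuous_on UNIV g" "\<And>y. 0 \<le> g y" "\<And>y. g y \<le> M"
  shows "(\<lambda>n. kern_integral g (lam n) (Q n))
     \<longlonglongrightarrow> mass * gauss_integral g"
    and "mass * gauss_integral g < \<infinity>"
proof -
  interpret E: prob_space std_exponential by (rule prob_space_exponential_density) simp
  have gm[measurable]: "g \<in> borel_measurable borel" by (rule borel_measurable_continuous_onI[OF g(1)])
  have [measurable]: "Q n \<in> borel_measurable std_exponential" for n using Q[of n] by simp
  have [measurable]: "(fst :: (real^'i) \<times> (real^'j) \<Rightarrow> real^'i) \<in> borel_measurable borel"
    "(snd :: (real^'i) \<times> (real^'j) \<Rightarrow> real^'j) \<in> borel_measurable borel"
    by (intro borel_measurable_continuous_onI continuous_intros)+
  have E1: "emeasure std_exponential UNIV = 1" using E.emeasure_space_1 by simp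
  define d where "d = DIM((real^'i) \<times> (real^'j))"
  obtain C where C: "C > 0" "\<And>lam \<rho> z y. lam \<ge> 1 \<Longrightarrow> \<rho> \<ge> 0 \<Longrightarrow> region lam \<rho> z y \<Longrightarrow> norm (z, y) \<le> C * (1 + \<rho>)"
    using region_bounded by blast
  define C' where "C' = C * (1 + q)"
  have q: "q \<ge> 0" using Qb[of 1 0] by (smt (verit) exp_gt_zero mult_neg_pos zero_less_one)
  have C': "C' > 0" using C q by (simp add: C'_def)
  define W where "W w = (\<integral>\<^sup>+x. ennreal M * indicator {w. norm (w :: (real^'i) \<times> (real^'j)) \<le> C' * exp (x / (2 * real d))} w \<partial>std_exponential)" for w
  have Wfin: "(\<integral>\<^sup>+w. W w \<partial>lborel) < \<infinity>"
    unfolding W_def d_def by (rule nn_integral_dominating_function_finite[OF C'])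
  have bd: "kern g (lam n) r z y \<le> M" if "r \<ge> 0" for n r z y
  proof -
    have M: "0 \<le> M" using g(2,3) order_trans by blast
    show ?thesis
    proof (cases "region (lam n) r z y")
      case True
      then have "1 \<le> nu (lam n) z y" using lam(2)[of n] by (intro nu_sq_ge(2)) (auto simp: region_def)
      then have "1 \<le> nu (lam n) z y ^ DIM((real^'i) \<times> (real^'j))" by (rule one_le_power)
      then have "g (centred (lam n) r z y) / nu (lam n) z y ^ DIM((real^'i) \<times> (real^'j)) \<le> g (centred (lam n) r z y) / 1"
        using g(2) by (intro divide_left_mono) auto
      also have "\<dots> \<le> M" using g(3) by simp
      finally show ?thesis using True by (simp add: kern_def)
    qed (simp add: kern_def M)
  qed
  have inner_lim: "(\<lambda>n. (\<integral>\<^sup>+x. ennreal (kern g (lam n) (Q n x) z y) \<partial>std_exponential)) \<longlonglongrightarrow> (\<integral>\<^sup>+x. ennreal (kern_lim g x z y) \<partial>std_exponential)" for z y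
  proof (rule nn_integral_dominated_convergence[where w = "\<lambda>_. ennreal M"])
    show "AE x in std_exponential. ennreal (kern g (lam n) (Q n x) z y) \<le> ennreal M" for n
      using AE_std_exponential_pos by eventually_elim (use bd Qb in \<open>auto intro!: ennreal_leI\<close>)
    have fin: "finite ((\<lambda>i. excess z y - z $ i / a $ i) ` UNIV)" by simp
    have "AE x in lborel. x \<notin> (\<lambda>i. excess z y - z $ i / a $ i) ` UNIV"
      by (rule AE_not_in) (rule finite_imp_null_set_lborel[OF fin])
    then have "AE x in std_exponential. x \<notin> (\<lambda>i. excess z y - z $ i / a $ i) ` UNIV"
      by (subst AE_density) (auto elim!: eventually_mono)
    then show "AE x in std_exponential. (\<lambda>n. ennreal (kern g (lam n) (Q n x) z y)) \<longlonglongrightarrow> ennreal (kern_lim g x z y)"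
      using AE_std_exponential_pos
    proof eventually_elim
      case (elim x)
      have "z $ i + a $ i * (x - excess z y) \<noteq> 0" if "a $ i \<noteq> 0" for i
      proof
        assume "z $ i + a $ i * (x - excess z y) = 0"
        then have "x = excess z y - z $ i / a $ i" using that by (simp add: field_simps)
        with elim(1) show False by blast
      qed
      then show ?case
        using Qb[OF elim(2)] by (intro tendsto_ennrealI tendsto_kern lam g(1) Ql elim(2)) auto
    qed
  qed (auto simp: ennreal_mult_less_top E1)
  have outer_bd: "(\<integral>\<^sup>+x. ennreal (kern g (lam n) (Q n x) (fst w) (snd w)) \<partial>std_exponential) \<le> W w" for n w
    unfolding W_def
  proof (rule nn_integral_mono_AE)
    show "AE x in std_exponential. ennreal (kern g (lam n) (Q n x) (fst w) (snd w)) \<le> ennreal M * indicator {w. norm w \<le> C' * exp (x / (2 * real d))} w"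
      using AE_std_exponential_pos
    proof eventually_elim
      case (elim x)
      show ?case
      proof (cases "region (lam n) (Q n x) (fst w) (snd w)")
        case True
        have "norm w \<le> C * (1 + Q n x)" using C(2)[OF lam(2) _ True] Qb[OF elim] by simp
        also have "\<dots> \<le> C * (exp (x / (2 * real d)) + q * exp (x / (2 * real d)))"
          using C(1) Qb[OF elim, of n] elim by (intro mult_left_mono add_mono) (auto simp: d_def)
        also have "\<dots> = C' * exp (x / (2 * real d))" by (simp add: C'_def algebra_simps)
        finally show ?thesis using bd Qb[OF elim] by (simp add: ennreal_leI)
      qed (simp add: kern_def)
    qed
  qed
  have lim: "(\<lambda>n. (\<integral>\<^sup>+w. (\<integral>\<^sup>+x. ennreal (kern g (lam n) (Q n x) (fst w) (snd w)) \<partial>std_exponential) \<partial>lborel))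
     \<longlonglongrightarrow> (\<integral>\<^sup>+w. (\<integral>\<^sup>+x. ennreal (kern_lim g x (fst w) (snd w)) \<partial>std_exponential) \<partial>lborel)"
  proof (rule nn_integral_dominated_convergence[where w = W])
    show "W \<in> borel_measurable lborel"
    proof -
      have "W = (\<lambda>w. \<integral>\<^sup>+x. (if norm w \<le> C' * exp (x / (2 * real d)) then ennreal M else 0) \<partial>std_exponential)"
        unfolding W_def by (intro ext nn_integral_cong) (simp add: indicator_def)
      then show ?thesis by simp
    qed
    show "(\<integral>\<^sup>+w. W w \<partial>lborel) < \<infinity>" by (rule Wfin)
    show "(\<lambda>w. \<integral>\<^sup>+x. ennreal (kern g (lam n) (Q n x) (fst w) (snd w)) \<partial>std_exponential) \<in> borel_measurable lborel" for n
      by measurable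
    show "(\<lambda>w. \<integral>\<^sup>+x. ennreal (kern_lim g x (fst w) (snd w)) \<partial>std_exponential) \<in> borel_measurable lborel"
      by measurable
  qed (auto intro: outer_bd inner_lim)
  then show "(\<lambda>n. kern_integral g (lam n) (Q n))
     \<longlonglongrightarrow> mass * gauss_integral g"
    by (simp only: kern_integral_def nn_integral_kern_lim[OF gm g(2)])
  have "mass * gauss_integral g \<le> (\<integral>\<^sup>+w. W w \<partial>lborel)"
    using lim unfolding nn_integral_kern_lim[OF gm g(2)]
    by (rule LIMSEQ_le_const2) (auto intro!: nn_integral_mono outer_bd)
  then show "mass * gauss_integral g < \<infinity>"
    using Wfin by (rule le_less_trans)
qed

end

section \<open>Conditional limit of the elliptical vector\<close>

lemma joint_law_of_independent_rvs:
  fixes Y :: "'w \<Rightarrow> 'a::second_countable_topology" and Z :: "'w \<Rightarrow> 'b::second_countable_topology"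
  assumes "prob_space M" and [measurable]: "Y \<in> borel_measurable M" "Z \<in> borel_measurable M"
    and ind: "independent_rvs M Y Z"
  shows "distr M (borel \<Otimes>\<^sub>M borel) (\<lambda>\<omega>. (Y \<omega>, Z \<omega>)) = distr M borel Y \<Otimes>\<^sub>M distr M borel Z"
proof -
  interpret prob_space M by fact
  interpret Y: prob_space "distr M borel Y" by (rule prob_space_distr) simp
  interpret Z: prob_space "distr M borel Z" by (rule prob_space_distr) simp
  have "distr M borel Y \<Otimes>\<^sub>M distr M borel Z = distr M (borel \<Otimes>\<^sub>M borel) (\<lambda>\<omega>. (Y \<omega>, Z \<omega>))"
  proof (rule pair_measure_eqI)
    show "sigma_finite_measure (distr M borel Y)" "sigma_finite_measure (distr M borel Z)" by unfold_locales
    show "sets (distr M borel Y \<Otimes>\<^sub>M distr M borel Z) = sets (distr M (borel \<Otimes>\<^sub>M borel) (\<lambda>\<omega>. (Y \<omega>, Z \<omega>)))"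
      by (simp cong: sets_pair_measure_cong)
    fix A B assume "A \<in> sets (distr M borel Y)" "B \<in> sets (distr M borel Z)"
    then have A[measurable]: "A \<in> sets borel" and B[measurable]: "B \<in> sets borel" by auto
    have "prob ((Y -` A \<inter> space M) \<inter> (Z -` B \<inter> space M)) = prob (Y -` A \<inter> space M) * prob (Z -` B \<inter> space M)"
      using ind unfolding independent_rvs_def by (rule indep_setD) (use A B in auto)
    moreover have "(\<lambda>\<omega>. (Y \<omega>, Z \<omega>)) -` (A \<times> B) \<inter> space M = (Y -` A \<inter> space M) \<inter> (Z -` B \<inter> space M)" by auto
    ultimately show "emeasure (distr M borel Y) A * emeasure (distr M borel Z) B
        = emeasure (distr M (borel \<Otimes>\<^sub>M borel) (\<lambda>\<omega>. (Y \<omega>, Z \<omega>))) (A \<times> B)"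
      by (simp add: emeasure_distr emeasure_eq_measure ennreal_mult)
  qed
  then show ?thesis ..
qed

lemma inverse_pos_def:
  fixes A :: "real^'n^'n"
  assumes "invertible A" "\<And>x. x \<noteq> 0 \<Longrightarrow> 0 < x \<bullet> (A *v x)" "y \<noteq> 0"
  shows "0 < y \<bullet> (matrix_inv A *v y)"
proof -
  define x where "x = matrix_inv A *v y"
  have y: "y = A *v x" using matrix_inverse(1)[OF assms(1)] by (simp add: x_def matrix_vector_mul_assoc)
  then have "x \<noteq> 0" using assms(3) by auto
  then show ?thesis using assms(2)[of x] by (simp add: x_def[symmetric]) (simp add: y inner_commute)
qed

locale elliptical_cone = block_covariance S e f +
    conic_limit a b \<kappa> "matrix_inv (submat e e S)" "matrix_inv (block_covariance.C S e f)" "block_covariance.L S e f"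
  for S :: "real^'k^'k::finite" and e :: "'i::finite \<Rightarrow> 'k" and f :: "'j::finite \<Rightarrow> 'k" and a b :: "real^'i" and \<kappa> :: real +
  fixes A :: "real^'k^'k"
  assumes A: "invertible A" "S = transpose A ** A"
begin

(* keeps products with the transpose of A in the form in which the elliptical vector is given *)
declare transpose_matrix_vector [simp del]

lemma invertible_At: "invertible (transpose A)"
  using A(1) by (simp add: invertible_det_nz det_transpose)

definition xi :: "real \<Rightarrow> (real^'i) \<times> (real^'j) \<Rightarrow> (real^'i) \<times> (real^'j)"
  where "xi lam w = (a + (1 / lam) *\<^sub>R fst w, (\<kappa> / sqrt lam) *\<^sub>R snd w)"

text \<open>
  The density of the uniform direction in the slab coordinates, up to a constant.
\<close>

definition weight :: "real \<Rightarrow> (real^'i) \<times> (real^'j) \<Rightarrow> ennreal"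
  where "weight lam w = (if 0 \<le> b \<bullet> fst w \<and> b \<bullet> fst w \<le> \<kappa>\<^sup>2
    then ennreal (1 / nu lam (fst w) (snd w) ^ DIM((real^'i) \<times> (real^'j))) else 0)"

lemma dim_eq: "CARD('k) = DIM((real^'i) \<times> (real^'j))"
proof -
  have "CARD('k) = card (range e \<union> range f)" using rng by simp
  also have "\<dots> = card (range e) + card (range f)" using rng by (intro card_Un_disjoint) auto
  also have "\<dots> = CARD('i) + CARD('j)" using e f by (simp add: card_image)
  finally show ?thesis by simp
qed

lemma norm_preimage:
  assumes "lam > 0" "transpose A *v u = \<Psi> (xi lam w)"
  shows "norm u = \<kappa> * nu lam (fst w) (snd w)"
proof -
  have S_inv: "invertible (transpose A ** A)" using invertible_pos_def[OF pos] A(2) by simp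
  have "(norm u)\<^sup>2 = \<Psi> (xi lam w) \<bullet> (matrix_inv S *v \<Psi> (xi lam w))"
    using inner_matrix_inv_gram[OF A(1) S_inv, of u] unfolding assms(2) A(2)[symmetric] by (simp add: power2_norm_eq_inner)
  then have "norm u = sqrt (\<Psi> (xi lam w) \<bullet> (matrix_inv S *v \<Psi> (xi lam w)))"
    by (metis norm_ge_zero real_sqrt_unique)
  then show ?thesis
    using \<kappa>(1) unfolding quadratic_form_\<Psi> by (simp add: nu_def xi_def)
qed

text \<open>
  The slab representation with the linear functional \<open>x \<mapsto> b \<bullet> x\<^sub>I\<close>, followed by the affine
  substitution that maps \<open>(z, y)\<close> to the point with coordinates \<open>xi\<close>. The constant does not depend on
  the radius \<open>r\<close>.
\<close>

lemma sphere_integral_eq: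
  assumes lam: "lam > 0"
  shows "\<exists>c>0. \<forall>r>0. \<forall>\<Phi>\<in>borel_measurable borel. (\<forall>x. b \<bullet> subvec e x \<le> 0 \<longrightarrow> \<Phi> x = 0) \<longrightarrow>
    (\<integral>\<^sup>+u. \<Phi> (transpose A *v (r *\<^sub>R u)) \<partial>uniform_sphere) = ennreal c *
    (\<integral>\<^sup>+w. \<Phi> ((r / (\<kappa> * nu lam (fst w) (snd w))) *\<^sub>R \<Psi> (xi lam w)) *
      weight lam w \<partial>lborel)"
proof -
  define d where "d = DIM((real^'i) \<times> (real^'j))"
  define Mi where "Mi = matrix_inv (transpose A)"
  have Mi: "transpose A *v (Mi *v x) = x" "Mi *v (transpose A *v x) = x" for x
    using matrix_inverse[OF invertible_At] by (simp_all add: Mi_def matrix_vector_mul_assoc)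
  define l where "l = A *v embed e b"
  have l: "l \<bullet> u = b \<bullet> subvec e (transpose A *v u)" for u
  proof -
    have "b \<bullet> subvec e (transpose A *v u) = embed e b \<bullet> (transpose A *v u)" by (simp add: inner_embed e)
    also have "\<dots> = (transpose A *v u) \<bullet> embed e b" by (rule inner_commute)
    also have "\<dots> = u \<bullet> l" unfolding l_def by (simp add: transpose_matrix_vector dot_lmul_matrix)
    finally show ?thesis by (simp add: inner_commute)
  qed
  let ?Sl = "{x. \<kappa>\<^sup>2 \<le> l \<bullet> x \<and> l \<bullet> x \<le> \<kappa>\<^sup>2 + \<kappa>\<^sup>2 / lam}"
  have \<alpha>: "0 < \<kappa>\<^sup>2" "\<kappa>\<^sup>2 < \<kappa>\<^sup>2 + \<kappa>\<^sup>2 / lam" using \<kappa>(1) lam by auto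
  obtain c1 where c1: "c1 > 0" and c1': "\<forall>f\<in>borel_measurable borel. (\<forall>x. l \<bullet> x \<le> 0 \<longrightarrow> f x = 0) \<longrightarrow>
      (\<integral>\<^sup>+x. f x \<partial>uniform_sphere)
       = ennreal c1 * slab_integral l (\<kappa>\<^sup>2) (\<kappa>\<^sup>2 + \<kappa>\<^sup>2 / lam) (\<lambda>x. f (x /\<^sub>R norm x))"
    using uniform_sphere_slab[OF \<alpha>, of l] by (elim exE conjE) (rule that)
  define lin :: "(real^'i) \<times> (real^'j) \<Rightarrow> (real^'i) \<times> (real^'j)" where "lin w = ((1 / lam) *\<^sub>R fst w, (\<kappa> / sqrt lam) *\<^sub>R snd w)" for w
  define f1 where "f1 w = Mi *v \<Psi> (lin w)" for w
  have lin_lin: "linear lin" by (rule linearI) (auto simp: lin_def scaleR_add_right)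
  have xi: "xi lam w = (a, 0) + lin w" for w by (simp add: xi_def lin_def)
  have lin_f1: "linear f1"
    unfolding f1_def using linear_compose[OF linear_compose[OF lin_lin linear_\<Psi>] matrix_vector_mul_linear[of Mi]] by (simp add: o_def)
  have bij_f1: "bij f1"
  proof -
    have "bij lin"
      by (rule o_bij[of "\<lambda>w. (lam *\<^sub>R fst w, (sqrt lam / \<kappa>) *\<^sub>R snd w)"]) (use lam \<kappa>(1) in \<open>auto simp: lin_def fun_eq_iff\<close>)
    moreover have "bij (\<lambda>x. Mi *v x)"
      by (rule o_bij[of "\<lambda>x. transpose A *v x"]) (auto simp: fun_eq_iff Mi)
    ultimately show ?thesis
      unfolding f1_def using bij_comp[OF bij_comp[OF _ bij_\<Psi>], of lin "\<lambda>x. Mi *v x"] by (simp add: o_def)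
  qed
  obtain c2 where c2: "c2 > 0" "\<And>\<Phi>. \<Phi>\<in>borel_measurable borel \<Longrightarrow>
           (\<integral>\<^sup>+x. \<Phi> (f1 x) \<partial>lborel) = ennreal c2 * (\<integral>\<^sup>+y. \<Phi> y \<partial>lborel)"
    using linear_bij_lborel_scales[OF lin_f1 bij_f1] by blast
  define T where "T w = Mi *v \<Psi> (xi lam w)" for w
  have T: "T w = Mi *v \<Psi> (a, 0) + f1 w" for w
    by (simp add: T_def f1_def xi linear_add[OF linear_\<Psi>] matrix_vector_right_distrib)
  have AT: "transpose A *v T w = \<Psi> (xi lam w)" for w by (simp add: T_def Mi)
  have subst: "(\<integral>\<^sup>+u. \<Phi> u \<partial>lborel) = ennreal (1 / c2) * (\<integral>\<^sup>+w. \<Phi> (T w) \<partial>lborel)"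
    if [measurable]: "\<Phi> \<in> borel_measurable borel" for \<Phi>
  proof -
    have "(\<integral>\<^sup>+w. \<Phi> (T w) \<partial>lborel) = ennreal c2 * (\<integral>\<^sup>+y. \<Phi> (Mi *v \<Psi> (a, 0) + y) \<partial>lborel)"
      unfolding T by (rule c2(2)) measurable
    also have "(\<integral>\<^sup>+y. \<Phi> (Mi *v \<Psi> (a, 0) + y) \<partial>lborel) = (\<integral>\<^sup>+y. \<Phi> y \<partial>distr lborel borel ((+) (Mi *v \<Psi> (a, 0))))"
      by (subst nn_integral_distr) auto
    finally have "(\<integral>\<^sup>+w. \<Phi> (T w) \<partial>lborel) = ennreal c2 * (\<integral>\<^sup>+y. \<Phi> y \<partial>lborel)" by (simp add: lborel_distr_plus)
    then show ?thesis using c2(1) by (simp add: mult.assoc[symmetric] ennreal_mult[symmetric])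
  qed
  define cc where "cc = c1 * (1 / c2) * (1 / \<kappa> ^ d)"
  have cc: "cc > 0" using c1 c2 \<kappa>(1) by (simp add: cc_def)
  have "(\<integral>\<^sup>+u. \<Phi> (transpose A *v (r *\<^sub>R u)) \<partial>uniform_sphere) = ennreal cc *
    (\<integral>\<^sup>+w. \<Phi> ((r / (\<kappa> * nu lam (fst w) (snd w))) *\<^sub>R \<Psi> (xi lam w)) *
      weight lam w \<partial>lborel)"
    if r: "r > 0" and [measurable]: "\<Phi> \<in> borel_measurable borel" and \<Phi>0: "\<And>x. b \<bullet> subvec e x \<le> 0 \<Longrightarrow> \<Phi> x = 0" for r \<Phi>
  proof -
    let ?F = "\<lambda>w. \<Phi> (transpose A *v (r *\<^sub>R (T w /\<^sub>R norm (T w)))) * indicator ?Sl (T w) * ennreal (1 / norm (T w) ^ DIM(real^'k))"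
    have "(\<integral>\<^sup>+u. \<Phi> (transpose A *v (r *\<^sub>R u)) \<partial>uniform_sphere)
      = ennreal c1 * slab_integral l (\<kappa>\<^sup>2) (\<kappa>\<^sup>2 + \<kappa>\<^sup>2 / lam) (\<lambda>x. \<Phi> (transpose A *v (r *\<^sub>R (x /\<^sub>R norm x))))"
    proof (rule c1'[rule_format])
      fix x assume "l \<bullet> x \<le> 0"
      then have "b \<bullet> subvec e (transpose A *v (r *\<^sub>R x)) \<le> 0"
        using r by (simp add: l matrix_vector_mult_scaleR linear_scale[OF linear_subvec] mult_nonneg_nonpos)
      then show "\<Phi> (transpose A *v (r *\<^sub>R x)) = 0" by (rule \<Phi>0)
    qed measurable
    also have "slab_integral l (\<kappa>\<^sup>2) (\<kappa>\<^sup>2 + \<kappa>\<^sup>2 / lam) (\<lambda>x. \<Phi> (transpose A *v (r *\<^sub>R (x /\<^sub>R norm x))))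
      = ennreal (1 / c2) * (\<integral>\<^sup>+w. ?F w \<partial>lborel)"
      unfolding slab_integral_def by (rule subst) measurable
    also have "(\<integral>\<^sup>+w. ?F w \<partial>lborel)
      = (\<integral>\<^sup>+w. ennreal (1 / \<kappa> ^ d) * (\<Phi> ((r / (\<kappa> * nu lam (fst w) (snd w))) *\<^sub>R \<Psi> (xi lam w)) *
      weight lam w) \<partial>lborel)"
    proof (rule nn_integral_cong)
      fix w :: "(real^'i) \<times> (real^'j)"
      define n where "n = nu lam (fst w) (snd w)"
      have n0: "n \<ge> 0" unfolding n_def by (rule nu_nonneg)
      have norm: "norm (T w) = \<kappa> * n" unfolding n_def by (rule norm_preimage[OF lam AT])
      have lT: "l \<bullet> T w = \<kappa>\<^sup>2 + (b \<bullet> fst w) / lam"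
        by (simp add: l AT subvec_\<Psi> xi_def inner_add_right \<kappa>(2) inner_commute[of b a])
      have ind: "indicator ?Sl (T w) = (if 0 \<le> b \<bullet> fst w \<and> b \<bullet> fst w \<le> \<kappa>\<^sup>2 then 1 else 0 :: ennreal)"
        using lam by (simp add: lT indicator_def zero_le_divide_iff divide_le_cancel)
      have arg: "transpose A *v (r *\<^sub>R (T w /\<^sub>R norm (T w))) = (r / (\<kappa> * n)) *\<^sub>R \<Psi> (xi lam w)"
        unfolding norm matrix_vector_mult_scaleR AT by (simp add: divide_inverse)
      have pw: "ennreal (1 / norm (T w) ^ DIM(real^'k)) = ennreal (1 / \<kappa> ^ d) * ennreal (1 / n ^ d)"
        using \<kappa>(1) n0 dim_eq by (simp add: norm d_def power_mult_distrib ennreal_mult[symmetric])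
      show "?F w
        = ennreal (1 / \<kappa> ^ d) * (\<Phi> ((r / (\<kappa> * nu lam (fst w) (snd w))) *\<^sub>R \<Psi> (xi lam w)) *
      weight lam w)"
        unfolding ind arg pw weight_def d_def[symmetric] n_def[symmetric] by (simp add: ac_simps)
    qed
    also have "\<dots> = ennreal (1 / \<kappa> ^ d) * (\<integral>\<^sup>+w. \<Phi> ((r / (\<kappa> * nu lam (fst w) (snd w))) *\<^sub>R \<Psi> (xi lam w)) *
      weight lam w \<partial>lborel)"
    proof (rule nn_integral_cmult)
      have [measurable]: "(fst :: (real^'i) \<times> (real^'j) \<Rightarrow> real^'i) \<in> borel_measurable borel"
        "(snd :: (real^'i) \<times> (real^'j) \<Rightarrow> real^'j) \<in> borel_measurable borel"
        by (intro borel_measurable_continuous_onI continuous_intros)+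
      have [measurable]: "\<Psi> \<in> borel_measurable borel"
        using linear_\<Psi> by (intro borel_measurable_continuous_onI linear_continuous_on) (simp add: linear_conv_bounded_linear)
      have [measurable]: "xi lam \<in> borel_measurable borel"
        unfolding xi_def by (intro borel_measurable_continuous_onI continuous_intros)
      have [measurable]: "(\<lambda>w. nu lam (fst w) (snd w)) \<in> borel_measurable borel"
        unfolding nu_def by measurable
      show "(\<lambda>w. \<Phi> ((r / (\<kappa> * nu lam (fst w) (snd w))) *\<^sub>R \<Psi> (xi lam w)) *
      weight lam w) \<in> borel_measurable lborel"
        unfolding weight_def by measurable
    qed
    also have "ennreal c1 * (ennreal (1 / c2) * (ennreal (1 / \<kappa> ^ d) * x)) = ennreal cc * x" for x
      using c1 c2(1) \<kappa>(1) by (simp add: cc_def ennreal_mult[symmetric] mult.assoc[symmetric])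
    finally show ?thesis .
  qed
  with cc show ?thesis by blast
qed

text \<open>
  Exceedance requires a radius above \<open>t \<kappa>\<close>, by the Cauchy-Schwarz inequality \<open>B_form_ge\<close>; therefore
  only the law of the excess enters.
\<close>

lemma region_imp_radius:
  assumes lam: "lam > 0" and reg: "region lam \<rho> z y"
  shows "\<rho> > 0"
proof -
  have bz: "0 \<le> b \<bullet> z" using reg by (simp add: region_def)
  define n where "n = nu lam z y"
  define x where "x = a + (1 / lam) *\<^sub>R z"
  have n: "n \<ge> 1" unfolding n_def by (rule nu_sq_ge(2)[OF lam bz])
  have ba: "b \<bullet> a = \<kappa>\<^sup>2" by (simp add: \<kappa>(2) inner_commute)
  have bx: "b \<bullet> x > 0" using bz lam \<kappa>(1) by (simp add: x_def inner_add_right ba add_pos_nonneg)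
  have "b \<bullet> x / \<kappa>\<^sup>2 \<le> n"
  proof -
    have "(b \<bullet> x / \<kappa>\<^sup>2 * \<kappa>)\<^sup>2 = (b \<bullet> x)\<^sup>2 / \<kappa>\<^sup>2" using \<kappa>(1) by (simp add: field_simps power2_eq_square)
    also have "\<dots> \<le> x \<bullet> (matrix_inv Sii *v x)" by (rule B_form_ge)
    also have "\<dots> \<le> (n * \<kappa>)\<^sup>2"
    proof -
      have "0 \<le> ((\<kappa> / sqrt lam) *\<^sub>R y) \<bullet> (matrix_inv C *v ((\<kappa> / sqrt lam) *\<^sub>R y))" by (rule D_nonneg)
      then show ?thesis using \<kappa>(1) B_nonneg[of x] by (simp add: n_def nu_def x_def[symmetric])
    qed
    finally have "b \<bullet> x / \<kappa>\<^sup>2 * \<kappa> \<le> n * \<kappa>" by (rule power2_le_imp_le) (use n \<kappa>(1) in simp)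
    then show ?thesis using \<kappa>(1) by (subst (asm) mult_le_cancel_right_pos) auto
  qed
  then have bxn: "b \<bullet> x / n \<le> \<kappa>\<^sup>2" using n \<kappa>(1) by (simp add: field_simps)
  define t where "t = dilation lam \<rho> z y"
  have cond: "\<And>i. a $ i < (t *\<^sub>R x) $ i" using reg by (simp add: region_def t_def x_def)
  have "(\<Sum>i\<in>UNIV. b $ i * a $ i) < (\<Sum>i\<in>UNIV. b $ i * (t *\<^sub>R x) $ i)"
    using cond b by (intro sum_strict_mono mult_strict_left_mono) auto
  then have "b \<bullet> a < b \<bullet> (t *\<^sub>R x)" by (simp only: inner_vec_def inner_real_def)
  then have 1: "\<kappa>\<^sup>2 < (1 + \<rho> / lam) * (b \<bullet> x / n)" by (simp add: ba t_def dilation_def n_def)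
  show "\<rho> > 0"
  proof (rule ccontr)
    assume "\<not> \<rho> > 0"
    then have "1 + \<rho> / lam \<le> 1" using lam by (simp add: divide_nonpos_pos)
    then have "(1 + \<rho> / lam) * (b \<bullet> x / n) \<le> 1 * (b \<bullet> x / n)"
      using bx n by (intro mult_right_mono) auto
    with 1 bxn show False by simp
  qed
qed

text \<open>
  For each threshold, the integral of \<open>g\<close> over the exceedance event is a constant that is independent
  of \<open>g\<close> times the rescaled integral. The choice \<open>g = 1\<close> gives the probability of the event.
\<close>

lemma exceedance_integral_eq:
  fixes P :: "'v measure" and R :: "'v \<Rightarrow> real" and U :: "'v \<Rightarrow> real^'k" and M :: "'w measure" and X :: "'w \<Rightarrow> real^'k"
  assumes P: "prob_space P" and [measurable]: "R \<in> borel_measurable P" "U \<in> borel_measurable P"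
    and ind: "independent_rvs P R U" and U: "distr P borel U = uniform_sphere" and Rpos: "AE \<omega> in P. R \<omega> > 0"
    and X[measurable]: "X \<in> borel_measurable M" and XRU: "distr M borel X = distr P borel (\<lambda>\<omega>. transpose A *v (R \<omega> *\<^sub>R U \<omega>))"
    and t: "t > 0" and lam: "lam > 0" and Q[measurable]: "Q \<in> borel_measurable borel"
    and tailpos: "measure (distr P borel R) {t * \<kappa><..} > 0"
    and coup: "excess_coupling (distr P borel R) (t * \<kappa>) lam Q"
    and h: "h = sqrt lam / (t * \<kappa>)"
  shows "\<exists>c>0. \<forall>g::real^'j \<Rightarrow> real. continuous_on UNIV g \<longrightarrow> (\<forall>y. 0 \<le> g y) \<longrightarrow>
    (\<integral>\<^sup>+\<omega>. ennreal (g (h *\<^sub>R (subvec f (X \<omega>) - t *\<^sub>R (L *v a)))) * indicator {\<omega> \<in> space M. \<forall>i. t * a $ i < subvec e (X \<omega>) $ i} \<omega> \<partial>M)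
    = ennreal c * kern_integral g lam Q"
proof -
  interpret P: prob_space P by fact
  define s where "s = t * \<kappa>"
  have s: "s > 0" using t \<kappa>(1) by (simp add: s_def)
  define D where "D = distr P borel R"
  interpret D: prob_space D unfolding D_def by (rule P.prob_space_distr) simp
  have [measurable_cong, simp]: "sets D = sets borel" by (simp add: D_def)
  interpret US: prob_space "uniform_sphere :: (real^'k) measure" unfolding U[symmetric] by (rule P.prob_space_distr) simp
  have [measurable_cong, simp]: "sets (uniform_sphere :: (real^'k) measure) = sets borel" by (simp add: U[symmetric])
  interpret E: prob_space std_exponential by (rule prob_space_exponential_density) simp
  interpret EL: pair_sigma_finite std_exponential "lborel :: ((real^'i) \<times> (real^'j)) measure" ..
  have [measurable]: "(\<lambda>x::real^'n. x $ i) \<in> borel_measurable borel" for i :: "'n::finite"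
    by (intro borel_measurable_continuous_onI continuous_intros)
  have [measurable]: "subvec e \<in> borel_measurable borel" "subvec f \<in> borel_measurable borel"
    using linear_subvec by (auto intro!: borel_measurable_continuous_onI linear_continuous_on simp: linear_conv_bounded_linear)
  have [measurable]: "(fst :: (real^'i) \<times> (real^'j) \<Rightarrow> real^'i) \<in> borel_measurable borel"
    "(snd :: (real^'i) \<times> (real^'j) \<Rightarrow> real^'j) \<in> borel_measurable borel"
    by (intro borel_measurable_continuous_onI continuous_intros)+
  obtain c where c: "c > 0" and c': "\<forall>r>0. \<forall>\<Phi>\<in>borel_measurable borel. (\<forall>x. b \<bullet> subvec e x \<le> 0 \<longrightarrow> \<Phi> x = 0) \<longrightarrow>
    (\<integral>\<^sup>+u. \<Phi> (transpose A *v (r *\<^sub>R u)) \<partial>uniform_sphere) = ennreal c *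
    (\<integral>\<^sup>+w. \<Phi> ((r / (\<kappa> * nu lam (fst w) (snd w))) *\<^sub>R \<Psi> (xi lam w)) *
      weight lam w \<partial>lborel)"
    using sphere_integral_eq[OF lam] by (elim exE conjE) (rule that)
  define cc where "cc = measure D {s<..} * c"
  have cc: "cc > 0" using c tailpos by (simp add: cc_def D_def s_def)
  have "(\<integral>\<^sup>+\<omega>. ennreal (g (h *\<^sub>R (subvec f (X \<omega>) - t *\<^sub>R (L *v a)))) * indicator {\<omega> \<in> space M. \<forall>i. t * a $ i < subvec e (X \<omega>) $ i} \<omega> \<partial>M)
    = ennreal cc * kern_integral g lam Q" (is "?lhs = _")
    if g: "continuous_on UNIV g" "\<And>y. 0 \<le> g y" for g :: "real^'j \<Rightarrow> real"
  proof -
    have [measurable]: "g \<in> borel_measurable borel" by (rule borel_measurable_continuous_onI[OF g(1)])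
    define G where "G x = (if \<forall>i. t * a $ i < subvec e x $ i then ennreal (g (h *\<^sub>R (subvec f x - t *\<^sub>R (L *v a)))) else 0)" for x
    have [measurable]: "G \<in> borel_measurable borel" unfolding G_def by measurable
    have G0: "G x = 0" if "b \<bullet> subvec e x \<le> 0" for x
    proof (rule ccontr)
      assume "G x \<noteq> 0"
      then have "\<And>i. t * a $ i < subvec e x $ i" by (auto simp: G_def split: if_splits)
      then have "(\<Sum>i\<in>UNIV. b $ i * (t * a $ i)) \<le> (\<Sum>i\<in>UNIV. b $ i * subvec e x $ i)"
        using b by (intro sum_mono mult_left_mono) (auto simp: less_imp_le)
      also have "(\<Sum>i\<in>UNIV. b $ i * (t * a $ i)) = t * \<kappa>\<^sup>2"
        by (simp add: \<kappa>(2) inner_vec_def sum_distrib_left ac_simps)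
      finally have "t * \<kappa>\<^sup>2 \<le> b \<bullet> subvec e x" by (simp add: inner_vec_def)
      moreover have "t * \<kappa>\<^sup>2 > 0" using t \<kappa>(1) by simp
      ultimately show False using that by simp
    qed
    have kernG: "G ((r / (\<kappa> * nu lam (fst w) (snd w))) *\<^sub>R \<Psi> (xi lam w)) *
      weight lam w
      = ennreal (kern g lam (lam * (r / s - 1)) (fst w) (snd w))" for r w
    proof -
      define z y where "z = fst w" and "y = snd w"
      define \<rho> where "\<rho> = lam * (r / s - 1)"
      have rs: "1 + \<rho> / lam = r / s" using lam by (simp add: \<rho>_def)
      have sc: "r / (\<kappa> * nu lam z y) = t * dilation lam \<rho> z y"
        using t \<kappa>(1) by (simp add: dilation_def rs s_def)
      have 1: "subvec e ((r / (\<kappa> * nu lam z y)) *\<^sub>R \<Psi> (xi lam w)) = t *\<^sub>R (dilation lam \<rho> z y *\<^sub>R (a + (1 / lam) *\<^sub>R z))"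
        unfolding sc linear_scale[OF linear_subvec] subvec_\<Psi> by (simp add: xi_def z_def)
      have 2: "h *\<^sub>R (subvec f ((r / (\<kappa> * nu lam z y)) *\<^sub>R \<Psi> (xi lam w)) - t *\<^sub>R (L *v a)) = centred lam \<rho> z y"
      proof -
        have "h *\<^sub>R (subvec f ((r / (\<kappa> * nu lam z y)) *\<^sub>R \<Psi> (xi lam w)) - t *\<^sub>R (L *v a))
          = (h * t) *\<^sub>R (dilation lam \<rho> z y *\<^sub>R ((\<kappa> / sqrt lam) *\<^sub>R y + L *v (a + (1 / lam) *\<^sub>R z)) - L *v a)"
          unfolding sc linear_scale[OF linear_subvec] subvec_\<Psi> by (simp add: xi_def z_def y_def scaleR_diff_right)
        also have "h * t = sqrt lam / \<kappa>" using t by (simp add: h)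
        finally show ?thesis by (simp add: centred_def)
      qed
      have 3: "(\<forall>i. t * a $ i < (t *\<^sub>R (dilation lam \<rho> z y *\<^sub>R (a + (1 / lam) *\<^sub>R z))) $ i) \<longleftrightarrow>
          (\<forall>i. a $ i < (dilation lam \<rho> z y *\<^sub>R (a + (1 / lam) *\<^sub>R z)) $ i)"
        using t by (simp only: vector_scaleR_component real_scaleR_def mult_less_cancel_left_pos)
      define H where "H \<longleftrightarrow> (\<forall>i. a $ i < (dilation lam \<rho> z y *\<^sub>R (a + (1 / lam) *\<^sub>R z)) $ i)"
      have n0: "nu lam z y \<ge> 0" by (rule nu_nonneg)
      show ?thesis
        unfolding weight_def z_def[symmetric] y_def[symmetric] \<rho>_def[symmetric] G_def 1 2 3 kern_def region_def H_def[symmetric]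
        using n0 g(2) by (auto simp: ennreal_mult[symmetric] simp del: DIM_prod)
    qed
    have inner: "(\<integral>\<^sup>+u. G (transpose A *v (r *\<^sub>R u)) \<partial>uniform_sphere)
       = ennreal c * (\<integral>\<^sup>+w. ennreal (kern g lam (lam * (r / s - 1)) (fst w) (snd w)) \<partial>lborel) * indicator {s<..} r" if r: "r > 0" for r
    proof -
      have "(\<integral>\<^sup>+u. G (transpose A *v (r *\<^sub>R u)) \<partial>uniform_sphere)
        = ennreal c * (\<integral>\<^sup>+w. G ((r / (\<kappa> * nu lam (fst w) (snd w))) *\<^sub>R \<Psi> (xi lam w)) *
      weight lam w \<partial>lborel)"
        using r G0 by (intro c'[rule_format]) auto
      also have "\<dots> = ennreal c * (\<integral>\<^sup>+w. ennreal (kern g lam (lam * (r / s - 1)) (fst w) (snd w)) \<partial>lborel)"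
        unfolding kernG ..
      finally have eq: "(\<integral>\<^sup>+u. G (transpose A *v (r *\<^sub>R u)) \<partial>uniform_sphere)
        = ennreal c * (\<integral>\<^sup>+w. ennreal (kern g lam (lam * (r / s - 1)) (fst w) (snd w)) \<partial>lborel)" .
      show ?thesis
      proof (cases "s < r")
        case False
        then have "lam * (r / s - 1) \<le> 0" using s lam by (simp add: mult_nonneg_nonpos)
        then have "kern g lam (lam * (r / s - 1)) (fst w) (snd w) = 0" for w
          using region_imp_radius[OF lam, of "lam * (r / s - 1)" "fst w" "snd w"] by (auto simp: kern_def)
        then show ?thesis using False eq by simp
      qed (simp add: eq)
    qed
    have "?lhs
      = (\<integral>\<^sup>+\<omega>. G (X \<omega>) \<partial>M)"
      by (intro nn_integral_cong) (auto simp: G_def indicator_def)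
    also have "\<dots> = (\<integral>\<^sup>+x. G x \<partial>distr M borel X)" by (subst nn_integral_distr) auto
    also have "\<dots> = (\<integral>\<^sup>+\<omega>. G (transpose A *v (R \<omega> *\<^sub>R U \<omega>)) \<partial>P)"
      unfolding XRU by (subst nn_integral_distr) auto
    also have "\<dots> = (\<integral>\<^sup>+p. G (transpose A *v (fst p *\<^sub>R snd p)) \<partial>distr P (borel \<Otimes>\<^sub>M borel) (\<lambda>\<omega>. (R \<omega>, U \<omega>)))"
      by (subst nn_integral_distr) auto
    also have "distr P (borel \<Otimes>\<^sub>M borel) (\<lambda>\<omega>. (R \<omega>, U \<omega>)) = D \<Otimes>\<^sub>M uniform_sphere"
      unfolding D_def U[symmetric] by (rule joint_law_of_independent_rvs[OF P _ _ ind]) auto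
    also have "(\<integral>\<^sup>+p. G (transpose A *v (fst p *\<^sub>R snd p)) \<partial>(D \<Otimes>\<^sub>M uniform_sphere))
       = (\<integral>\<^sup>+r. (\<integral>\<^sup>+u. G (transpose A *v (r *\<^sub>R u)) \<partial>uniform_sphere) \<partial>D)"
      by (subst US.nn_integral_fst[symmetric]) auto
    also have "\<dots> = (\<integral>\<^sup>+r. ennreal c * (\<integral>\<^sup>+w. ennreal (kern g lam (lam * (r / s - 1)) (fst w) (snd w)) \<partial>lborel) * indicator {s<..} r \<partial>D)"
    proof (rule nn_integral_cong_AE)
      have "AE r in D. r > 0" unfolding D_def using Rpos by (subst AE_distr_iff) auto
      then show "AE r in D. (\<integral>\<^sup>+u. G (transpose A *v (r *\<^sub>R u)) \<partial>uniform_sphere)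
        = ennreal c * (\<integral>\<^sup>+w. ennreal (kern g lam (lam * (r / s - 1)) (fst w) (snd w)) \<partial>lborel) * indicator {s<..} r"
        by eventually_elim (rule inner)
    qed
    also have "\<dots> = ennreal (measure D {s<..}) * (\<integral>\<^sup>+x. ennreal c * (\<integral>\<^sup>+w. ennreal (kern g lam (lam * (s * (1 + Q x / lam) / s - 1)) (fst w) (snd w)) \<partial>lborel) \<partial>std_exponential)"
      unfolding D_def s_def by (rule coup[unfolded excess_coupling_def, rule_format]) measurable
    also have "(\<integral>\<^sup>+x. ennreal c * (\<integral>\<^sup>+w. ennreal (kern g lam (lam * (s * (1 + Q x / lam) / s - 1)) (fst w) (snd w)) \<partial>lborel) \<partial>std_exponential)
      = (\<integral>\<^sup>+x. ennreal c * (\<integral>\<^sup>+w. ennreal (kern g lam (Q x) (fst w) (snd w)) \<partial>lborel) \<partial>std_exponential)"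
      using s lam by simp
    also have "(\<integral>\<^sup>+x. ennreal c * (\<integral>\<^sup>+w. ennreal (kern g lam (Q x) (fst w) (snd w)) \<partial>lborel) \<partial>std_exponential)
       = ennreal c * (\<integral>\<^sup>+x. (\<integral>\<^sup>+w. ennreal (kern g lam (Q x) (fst w) (snd w)) \<partial>lborel) \<partial>std_exponential)"
      by (rule nn_integral_cmult) measurable
    also have "(\<integral>\<^sup>+x. (\<integral>\<^sup>+w. ennreal (kern g lam (Q x) (fst w) (snd w)) \<partial>lborel) \<partial>std_exponential)
       = (\<integral>\<^sup>+w. (\<integral>\<^sup>+x. ennreal (kern g lam (Q x) (fst w) (snd w)) \<partial>std_exponential) \<partial>lborel)"
      by (rule EL.Fubini'[symmetric]) (simp add: split_beta')
    finally show ?thesis using c by (simp add: cc_def ennreal_mult mult.assoc kern_integral_def)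
  qed
  with cc show ?thesis by blast
qed

end


text \<open>
  The conditional expectation of a nonnegative \<open>g\<close> is the quotient of the rescaled integrals for \<open>g\<close> and
  for \<open>1\<close>, whose limits are the unnormalised Gaussian integral of \<open>g\<close> and the Gaussian normalising
  constant, up to the common factor \<open>mass\<close>. A bounded \<open>g\<close> is made nonnegative by adding a constant.
\<close>

theorem theorem4p2:
  fixes M :: "'w measure" and X :: "'w \<Rightarrow> real ^ 'k::finite"
    and P :: "'v measure" and R :: "'v \<Rightarrow> real" and U :: "'v \<Rightarrow> real ^ 'k"
    and A S :: "real ^ 'k ^ 'k"
    and \<delta> p q N :: real
    and t h :: "nat \<Rightarrow> real" and a :: "real ^ 'k"
    and e\<^sub>I :: "'i::finite \<Rightarrow> 'k" and e\<^sub>J :: "'j::finite \<Rightarrow> 'k"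
    and \<Omega> :: "nat \<Rightarrow> 'u measure" and V :: "nat \<Rightarrow> 'u \<Rightarrow> real ^ 'j"
  assumes "CARD('k) \<ge> 2"
    and "invertible A" and "S = transpose A ** A" and "correlation_matrix S"
    and "prob_space P" and "R \<in> borel_measurable P" and "U \<in> borel_measurable P"
    and "independent_rvs P R U"
    and "distr P borel U = uniform_sphere"
    and "AE \<omega> in P. R \<omega> > 0"
    and "\<delta> > 0" and "p > 0" and "q > 0"
    and "(\<lambda>u. measure P {\<omega> \<in> space P. R \<omega> > u})
           \<sim>[at_top] (\<lambda>u. p * u powr N * exp (- q * u powr \<delta>))"
    and "prob_space M" and "X \<in> borel_measurable M"
    and "distr M borel X = distr P borel (\<lambda>\<omega>. transpose A *v (R \<omega> *\<^sub>R U \<omega>))"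
    and "\<And>n. n \<ge> 1 \<Longrightarrow> t n > 0" and "filterlim t at_top sequentially"
    and "\<exists>i. a $ i > 0"
    and "enumerates_minimal_index_set S a e\<^sub>I"
    and "inj e\<^sub>J" and "range e\<^sub>J = - range e\<^sub>I"
    and "\<And>n. n \<ge> 1 \<Longrightarrow> h n = sqrt (q * \<delta>) *
           (t n * sqrt (subvec e\<^sub>I a \<bullet> (matrix_inv (submat e\<^sub>I e\<^sub>I S) *v subvec e\<^sub>I a)))
             powr (\<delta> / 2 - 1)"
    and "\<And>n. n \<ge> 1 \<Longrightarrow> prob_space (\<Omega> n)"
    and "\<And>n. n \<ge> 1 \<Longrightarrow> V n \<in> borel_measurable (\<Omega> n)"
    and "\<And>n. n \<ge> 1 \<Longrightarrow> distr (\<Omega> n) borel (V n) =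
           conditional_law M (\<lambda>\<omega>. \<forall>i. subvec e\<^sub>I (X \<omega>) $ i > t n * subvec e\<^sub>I a $ i)
             (\<lambda>\<omega>. subvec e\<^sub>J (X \<omega>))"
  shows "converges_in_distribution \<Omega>
    (\<lambda>n \<omega>. h n *\<^sub>R (V n \<omega> -
       t n *\<^sub>R (submat e\<^sub>J e\<^sub>I S *v (matrix_inv (submat e\<^sub>I e\<^sub>I S) *v subvec e\<^sub>I a))))
    (gaussian_given_zero S e\<^sub>J e\<^sub>I)"
proof -
  note P = assms(5) and Rm[measurable] = assms(6) and Um[measurable] = assms(7) and M = assms(15) and Xm[measurable] = assms(16)
  interpret P: prob_space P by fact
  interpret M: prob_space M by fact
  have eI: "inj e\<^sub>I" and bpos: "\<And>i. 0 < (matrix_inv (submat e\<^sub>I e\<^sub>I S) *v subvec e\<^sub>I a) $ i"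
    using assms(21) unfolding enumerates_minimal_index_set_def by auto
  interpret block: block_covariance S e\<^sub>I e\<^sub>J
    using assms(4,22,23) eI by unfold_locales (auto simp: correlation_matrix_def)
  define a' where "a' = subvec e\<^sub>I a"
  define b where "b = matrix_inv (submat e\<^sub>I e\<^sub>I S) *v a'"
  define \<kappa> where "\<kappa> = sqrt (a' \<bullet> b)"
  have b0: "\<And>i. 0 < b $ i" using bpos by (simp add: b_def a'_def)
  have a'b: "a' = submat e\<^sub>I e\<^sub>I S *v b"
    using matrix_inverse(1)[OF block.Sii_inv] by (simp add: b_def matrix_vector_mul_assoc)
  have "b \<noteq> 0" using b0 by (metis less_irrefl zero_index)
  then have "0 < a' \<bullet> b" using block.Sii_pos[of b] by (simp add: a'b inner_commute)
  then have \<kappa>: "\<kappa> > 0" "\<kappa>\<^sup>2 = a' \<bullet> b" by (auto simp: \<kappa>_def)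
  interpret elliptical_cone S e\<^sub>I e\<^sub>J a' b \<kappa> A
  proof unfold_locales
    show "0 < \<kappa>" "\<kappa>\<^sup>2 = a' \<bullet> b" by (rule \<kappa>)+
    show "0 < b $ i" for i by (rule b0)
    show "matrix_inv (submat e\<^sub>I e\<^sub>I S) *v a' = b" by (simp add: b_def)
    show "transpose (matrix_inv (submat e\<^sub>I e\<^sub>I S)) = matrix_inv (submat e\<^sub>I e\<^sub>I S)"
      by (rule transpose_matrix_inv[OF block.Sii_inv block.Sii_sym])
    show "0 \<le> x \<bullet> (matrix_inv (submat e\<^sub>I e\<^sub>I S) *v x)" for x
      using inverse_pos_def[OF block.Sii_inv block.Sii_pos, of x] by (cases "x = 0") auto
    show "0 < y \<bullet> (matrix_inv block.C *v y)" if "y \<noteq> 0" for y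
      by (rule inverse_pos_def[OF block.C_inv block.C_pos that])
    show "invertible A" "S = transpose A ** A" by fact+
  qed
  define s where "s n = t n * \<kappa>" for n
  define lam where "lam n = q * \<delta> * s n powr \<delta>" for n
  have slim: "filterlim s at_top sequentially"
    unfolding s_def[abs_def] using filterlim_tendsto_pos_mult_at_top[OF tendsto_const \<kappa>(1) assms(19)]
    by (simp add: mult.commute)
  have lamlim: "filterlim lam at_top sequentially"
  proof -
    have "filterlim (\<lambda>u. q * \<delta> * u powr \<delta>) at_top at_top" using assms(11,13) by real_asymp
    from filterlim_compose[OF this slim] show ?thesis by (simp add: lam_def[abs_def])
  qed
  define D where "D = distr P borel R"
  have D: "real_distribution D" unfolding D_def by (rule P.real_distribution_distr) simp
  have tail: "(\<lambda>u. measure D {u<..}) \<sim>[at_top] (\<lambda>u. p * u powr N * exp (- q * u powr \<delta>))"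
  proof -
    have "measure D {u<..} = measure P {\<omega> \<in> space P. R \<omega> > u}" for u
      unfolding D_def by (subst measure_distr) (auto intro!: arg_cong[where f="measure P"])
    then show ?thesis using assms(14) by simp
  qed
  \<comment> \<open>twice the dimension, so that a ball of radius \<open>exp (x / m)\<close> has integrable volume\<close>
  define m where "m = 2 * DIM((real^'i) \<times> (real^'j))"
  have m: "m \<ge> 1" using DIM_positive[where 'a="(real^'i) \<times> (real^'j)"] unfolding m_def by linarith
  obtain Q where Qm: "\<And>n. Q n \<in> borel_measurable borel"
    and Qc: "eventually (\<lambda>n. excess_coupling D (s n) (lam n) (Q n)) sequentially"
    and Qb: "eventually (\<lambda>n. measure D {s n<..} > 0 \<and> (\<forall>x>0. 0 \<le> Q n x \<and> Q n x \<le> 8 * real m * exp (x / real m))) sequentially"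
    and Ql: "\<And>x. x > 0 \<Longrightarrow> (\<lambda>n. Q n x) \<longlonglongrightarrow> x"
    using kotz_excess_coupling[OF D assms(11,13,12) m slim tail] unfolding lam_def by blast
  have "eventually (\<lambda>n. lam n \<ge> 1 \<and> n \<ge> 1) sequentially"
    using lamlim eventually_ge_at_top[of 1] by (auto simp: filterlim_at_top intro!: eventually_conj)
  then have "eventually (\<lambda>n. lam n \<ge> 1 \<and> n \<ge> 1 \<and> measure D {s n<..} > 0 \<and> (\<forall>x>0. 0 \<le> Q n x \<and> Q n x \<le> 8 * real m * exp (x / real m)) \<and>
      excess_coupling D (s n) (lam n) (Q n)) sequentially"
    using Qc Qb by eventually_elim auto
  then obtain n0 where n0: "\<And>n. n \<ge> n0 \<Longrightarrow> lam n \<ge> 1 \<and> n \<ge> 1 \<and> measure D {s n<..} > 0 \<and> (\<forall>x>0. 0 \<le> Q n x \<and> Q n x \<le> 8 * real m * exp (x / real m)) \<and>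
      excess_coupling D (s n) (lam n) (Q n)"
    unfolding eventually_sequentially by blast
  define Y where "Y n v = h n *\<^sub>R (v - t n *\<^sub>R (block.L *v a'))" for n and v :: "real^'j"
  define Ev where "Ev n = {\<omega> \<in> space M. \<forall>i. t n * a' $ i < subvec e\<^sub>I (X \<omega>) $ i}" for n
  define J where "J n g = kern_integral g (lam n) (Q n)" for n and g :: "real^'j \<Rightarrow> real"
  have hn: "h n = sqrt (lam n) / (t n * \<kappa>)" if "n \<ge> n0" for n
  proof -
    have n: "n \<ge> 1" using n0[OF that] by simp
    have sn: "s n > 0" using assms(18)[OF n] \<kappa>(1) by (simp add: s_def)
    have "h n = sqrt (q * \<delta>) * s n powr (\<delta> / 2 - 1)"
      using assms(24)[OF n] by (simp add: s_def \<kappa>_def b_def a'_def)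
    also have "s n powr (\<delta> / 2 - 1) = s n powr (\<delta> / 2) / s n" using sn by (simp add: powr_diff)
    also have "s n powr (\<delta> / 2) = sqrt (s n powr \<delta>)" using sn by (simp add: powr_half_sqrt[symmetric] powr_powr)
    finally show ?thesis by (simp add: lam_def real_sqrt_mult s_def)
  qed
  have rep: "\<exists>c>0. \<forall>g::real^'j \<Rightarrow> real. continuous_on UNIV g \<longrightarrow> (\<forall>y. 0 \<le> g y) \<longrightarrow>
      (\<integral>\<^sup>+\<omega>. ennreal (g (Y n (subvec e\<^sub>J (X \<omega>)))) * indicator (Ev n) \<omega> \<partial>M) = ennreal c * J n g" if "n \<ge> n0" for n
    unfolding Y_def Ev_def J_def
    using n0[OF that] assms(18)[of n]
    by (intro exceedance_integral_eq[OF P Rm Um assms(8,9,10) Xm assms(17) _ _ Qm _ _ hn[OF that]]) (auto simp: D_def s_def)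
  have Jlim: "(\<lambda>n. J n g) \<longlonglongrightarrow> mass * gauss_integral g" and Jfin: "mass * gauss_integral g < \<infinity>"
    if g: "continuous_on UNIV g" "\<And>y. 0 \<le> g y" "\<And>y. g y \<le> B" for g B
  proof -
    have "filterlim (\<lambda>n. lam (n + n0)) at_top sequentially"
      by (rule filterlim_compose[OF lamlim filterlim_add_const_nat_at_top])
    note * = kern_integral_tendsto[OF this, of "\<lambda>n. Q (n + n0)" "8 * real m" g B, OF _ Qm _ _ g, folded J_def]
    have 1: "1 \<le> lam (n + n0)" for n using n0[of "n + n0"] by simp
    have 2: "0 \<le> Q (n + n0) x \<and> Q (n + n0) x \<le> 8 * real m * exp (x / (2 * real DIM((real^'i) \<times> (real^'j))))" if "x > 0" for n x
      using n0[of "n + n0"] that unfolding m_def by (simp del: DIM_prod)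
    have 3: "(\<lambda>n. Q (n + n0) x) \<longlonglongrightarrow> x" if "x > 0" for x
      using LIMSEQ_ignore_initial_segment[OF Ql[OF that]] .
    show "(\<lambda>n. J n g) \<longlonglongrightarrow> mass * gauss_integral g" by (rule LIMSEQ_offset[of _ n0]) (rule *(1)[OF 1 2 3])
    show "mass * gauss_integral g < \<infinity>" by (rule *(2)[OF 1 2 3])
  qed
  define Z where "Z = sqrt ((2 * pi) ^ CARD('j) * det block.C)"
  have Z: "Z > 0" "gauss_integral (\<lambda>_. 1) = ennreal Z"
    using nn_integral_gaussian[OF block.C_sym block.C_pos] by (auto simp: Z_def gauss_integral_def)
  define \<nu> where "\<nu> = gaussian_given_zero S e\<^sub>J e\<^sub>I"
  have \<nu>: "\<nu> = density lborel (\<lambda>y. ennreal (exp (- (y \<bullet> (matrix_inv block.C *v y)) / 2) / Z))"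
    unfolding \<nu>_def gaussian_given_zero_def centered_gaussian_def block.C_def[symmetric] Z_def ..
  have sets_\<nu>[measurable_cong, simp]: "sets \<nu> = sets borel" by (simp add: \<nu>)
  have \<nu>_int: "(\<integral>\<^sup>+y. ennreal (g y) \<partial>\<nu>) = gauss_integral g / ennreal Z" if [measurable]: "g \<in> borel_measurable borel" for g
  proof -
    have "(\<integral>\<^sup>+y. ennreal (g y) \<partial>\<nu>) = (\<integral>\<^sup>+y. ennreal (exp (- (y \<bullet> (matrix_inv block.C *v y)) / 2) / Z) * ennreal (g y) \<partial>lborel)"
      unfolding \<nu> by (rule nn_integral_density) measurable
    also have "\<dots> = (\<integral>\<^sup>+y. ennreal (exp (- (y \<bullet> (matrix_inv block.C *v y)) / 2)) * ennreal (g y) / ennreal Z \<partial>lborel)"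
      using Z(1) by (intro nn_integral_cong) (simp add: divide_ennreal[symmetric] divide_ennreal_def ac_simps)
    also have "\<dots> = gauss_integral g / ennreal Z" unfolding gauss_integral_def by (rule nn_integral_divide) measurable
    finally show ?thesis .
  qed
  interpret \<nu>: prob_space \<nu>
  proof
    have "emeasure \<nu> (space \<nu>) = (\<integral>\<^sup>+y. ennreal 1 \<partial>\<nu>)" by simp
    also have "\<dots> = gauss_integral (\<lambda>_. 1) / ennreal Z" by (rule \<nu>_int) simp
    also have "\<dots> = 1" using Z by (simp add: divide_ennreal)
    finally show "emeasure \<nu> (space \<nu>) = 1" .
  qed
  have [measurable]: "subvec e\<^sub>J \<in> borel_measurable borel" "subvec e\<^sub>I \<in> borel_measurable borel"
    using linear_subvec by (auto intro!: borel_measurable_continuous_onI linear_continuous_on simp: linear_conv_bounded_linear)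
  have [measurable]: "(\<lambda>x::real^'i. x $ i) \<in> borel_measurable borel" for i
    by (intro borel_measurable_continuous_onI continuous_intros)
  have [measurable]: "Y n \<in> borel_measurable borel" for n unfolding Y_def by measurable
  have Ev[measurable]: "Ev n \<in> sets M" for n unfolding Ev_def by measurable
  have one: "continuous_on UNIV (\<lambda>_::real^'j. 1::real)" by simp
  have Kfin: "mass * gauss_integral (\<lambda>_. 1) < \<infinity>" by (rule Jfin[OF one]) auto
  have Kne: "mass \<noteq> 0" "mass \<noteq> \<top>"
    using mass_pos Kfin Z by (auto simp: ennreal_mult_less_top)
  then obtain k where k: "mass = ennreal k" "k > 0" by (cases mass) (auto simp: less_le)
  have nonneg_case: "(\<lambda>n. \<integral>\<omega>. g (Y n (V n \<omega>)) \<partial>\<Omega> n) \<longlonglongrightarrow> (\<integral>y. g y \<partial>\<nu>)"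
    if g: "continuous_on UNIV g" "\<And>y. 0 \<le> g y" "\<And>y. g y \<le> B" for g :: "real^'j \<Rightarrow> real" and B
  proof -
    have gm[measurable]: "g \<in> borel_measurable borel" by (rule borel_measurable_continuous_onI[OF g(1)])
    have lim1: "(\<lambda>n. J n (\<lambda>_. 1)) \<longlonglongrightarrow> ennreal (k * Z)"
      using Jlim[OF one, of 1] Z k by (simp add: ennreal_mult)
    have "gauss_integral g \<noteq> \<top>" using Jfin[OF g] Kne by (auto simp: ennreal_mult_less_top ennreal_mult_eq_top_iff less_top)
    then obtain i where i: "gauss_integral g = ennreal i" "i \<ge> 0" by (cases "gauss_integral g") auto
    have limg: "(\<lambda>n. J n g) \<longlonglongrightarrow> ennreal (k * i)"
      using Jlim[OF g] i k by (simp add: ennreal_mult)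
    have "(\<lambda>n. enn2real (J n g) / enn2real (J n (\<lambda>_. 1))) \<longlonglongrightarrow> (k * i) / (k * Z)"
      using k i Z by (intro tendsto_intros lim1 limg) auto
    also have "(k * i) / (k * Z) = (\<integral>y. g y \<partial>\<nu>)"
    proof -
      have "(\<integral>y. g y \<partial>\<nu>) = enn2real (\<integral>\<^sup>+y. ennreal (g y) \<partial>\<nu>)"
        by (rule integral_eq_nn_integral) (use g in auto)
      also have "\<dots> = i / Z" using i Z by (simp add: \<nu>_int divide_ennreal)
      finally show ?thesis using k by simp
    qed
    finally have lim: "(\<lambda>n. enn2real (J n g) / enn2real (J n (\<lambda>_. 1))) \<longlonglongrightarrow> (\<integral>y. g y \<partial>\<nu>)" .
    have "eventually (\<lambda>n. 0 < J n (\<lambda>_. 1)) sequentially"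
      using k Z by (intro order_tendstoD(1)[OF lim1]) simp
    moreover have "eventually (\<lambda>n. J n (\<lambda>_. 1) < \<top>) sequentially"
      by (intro order_tendstoD(2)[OF lim1]) simp
    moreover have "eventually (\<lambda>n. J n g < \<top>) sequentially"
      by (intro order_tendstoD(2)[OF limg]) simp
    ultimately have "eventually (\<lambda>n. enn2real (J n g) / enn2real (J n (\<lambda>_. 1)) = (\<integral>\<omega>. g (Y n (V n \<omega>)) \<partial>\<Omega> n)) sequentially"
      using eventually_ge_at_top[of n0]
    proof eventually_elim
      case (elim n)
      have n: "n \<ge> 1" using n0[OF elim(4)] by simp
      note [measurable] = assms(26)[OF n]
      obtain x where x: "J n g = ennreal x" "x \<ge> 0" using elim by (cases "J n g") auto
      obtain y where y: "J n (\<lambda>_. 1) = ennreal y" "y > 0" using elim by (cases "J n (\<lambda>_. 1)") auto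
      obtain c where c: "c > 0" and cg: "\<And>g::real^'j \<Rightarrow> real. continuous_on UNIV g \<Longrightarrow> (\<forall>y. 0 \<le> g y) \<Longrightarrow>
        (\<integral>\<^sup>+\<omega>. ennreal (g (Y n (subvec e\<^sub>J (X \<omega>)))) * indicator (Ev n) \<omega> \<partial>M) = ennreal c * J n g"
        using rep[OF elim(4)] by blast
      have em: "emeasure M (Ev n) = ennreal (c * y)"
        using cg[OF one] c y by (simp add: ennreal_mult)
      have "(\<integral>\<omega>. g (Y n (V n \<omega>)) \<partial>\<Omega> n) = enn2real (\<integral>\<^sup>+\<omega>. ennreal (g (Y n (V n \<omega>))) \<partial>\<Omega> n)"
        by (rule integral_eq_nn_integral) (use g in auto)
      also have "(\<integral>\<^sup>+\<omega>. ennreal (g (Y n (V n \<omega>))) \<partial>\<Omega> n) = (\<integral>\<^sup>+v. ennreal (g (Y n v)) \<partial>distr (\<Omega> n) borel (V n))"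
        by (subst nn_integral_distr) auto
      also have "distr (\<Omega> n) borel (V n) = distr (uniform_measure M (Ev n)) borel (\<lambda>\<omega>. subvec e\<^sub>J (X \<omega>))"
        using assms(27)[OF n] by (simp add: conditional_law_def Ev_def a'_def)
      also have "(\<integral>\<^sup>+v. ennreal (g (Y n v)) \<partial>distr (uniform_measure M (Ev n)) borel (\<lambda>\<omega>. subvec e\<^sub>J (X \<omega>)))
         = (\<integral>\<^sup>+\<omega>. ennreal (g (Y n (subvec e\<^sub>J (X \<omega>)))) \<partial>uniform_measure M (Ev n))"
        by (subst nn_integral_distr) auto
      also have "\<dots> = (\<integral>\<^sup>+\<omega>. ennreal (g (Y n (subvec e\<^sub>J (X \<omega>)))) * indicator (Ev n) \<omega> \<partial>M) / emeasure M (Ev n)"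
        by (rule nn_integral_uniform_measure) auto
      also have "\<dots> = ennreal (c * x) / ennreal (c * y)"
        using cg[OF g(1)] g(2) c x by (simp add: em ennreal_mult)
      also have "\<dots> = ennreal (x / y)" using c x y by (simp add: divide_ennreal)
      finally show ?case using x y by simp
    qed
    with lim show ?thesis by (rule Lim_transform_eventually)
  qed
  show ?thesis
    unfolding converges_in_distribution_def \<nu>_def[symmetric]
  proof (intro allI impI)
    fix g :: "real^'j \<Rightarrow> real" assume g: "continuous_on UNIV g" and "bounded (range g)"
    then obtain B where B: "\<And>y. \<bar>g y\<bar> \<le> B" by (auto simp: bounded_iff)
    have gm[measurable]: "g \<in> borel_measurable borel" by (rule borel_measurable_continuous_onI[OF g])
    have Yeq: "h n *\<^sub>R (V n \<omega> - t n *\<^sub>R (submat e\<^sub>J e\<^sub>I S *v (matrix_inv (submat e\<^sub>I e\<^sub>I S) *v subvec e\<^sub>I a))) = Y n (V n \<omega>)" for n \<omega>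
      by (simp add: Y_def block.L_def a'_def matrix_vector_mul_assoc)
    have "(\<lambda>n. (\<integral>\<omega>. g (Y n (V n \<omega>)) + B \<partial>\<Omega> n) - B) \<longlonglongrightarrow> (\<integral>y. g y + B \<partial>\<nu>) - B"
    proof (intro tendsto_intros nonneg_case)
      show "continuous_on UNIV (\<lambda>y. g y + B)" by (intro continuous_intros g)
      show "0 \<le> g y + B" "g y + B \<le> 2 * B" for y using B[of y] by linarith+
    qed
    moreover have "(\<integral>y. g y + B \<partial>\<nu>) - B = (\<integral>y. g y \<partial>\<nu>)"
    proof -
      have "integrable \<nu> g" by (rule \<nu>.integrable_const_bound[of _ B]) (use B in auto)
      then show ?thesis by (simp add: \<nu>.prob_space)
    qed
    moreover have "eventually (\<lambda>n. (\<integral>\<omega>. g (Y n (V n \<omega>)) + B \<partial>\<Omega> n) - B = (\<integral>\<omega>. g (Y n (V n \<omega>)) \<partial>\<Omega> n)) sequentially"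
      using eventually_ge_at_top[of 1]
    proof eventually_elim
      case (elim n)
      interpret W: prob_space "\<Omega> n" by (rule assms(25)[OF elim])
      note [measurable] = assms(26)[OF elim]
      have "integrable (\<Omega> n) (\<lambda>\<omega>. g (Y n (V n \<omega>)))" by (rule W.integrable_const_bound[of _ B]) (use B in auto)
      then show ?case by (simp add: W.prob_space)
    qed
    ultimately have "(\<lambda>n. \<integral>\<omega>. g (Y n (V n \<omega>)) \<partial>\<Omega> n) \<longlonglongrightarrow> (\<integral>y. g y \<partial>\<nu>)"
      using Lim_transform_eventually by fastforce
    then show "(\<lambda>n. \<integral>\<omega>. g (h n *\<^sub>R (V n \<omega> - t n *\<^sub>R (submat e\<^sub>J e\<^sub>I S *v (matrix_inv (submat e\<^sub>I e\<^sub>I S) *v subvec e\<^sub>I a)))) \<partial>\<Omega> n)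
        \<longlonglongrightarrow> (\<integral>y. g y \<partial>\<nu>)"
      unfolding Yeq .
  qed
qed

end
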